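(* Let $L:U\to V$ be a bounded linear operator between two real Hilbert spaces $U$ and $V$, let $y\in\mathcal R(L)$, and let $u^\dagger$ denote the minimum-norm solution of $Lu=y$. Then, for every $\nu\in(0,2)$, the following conditions are equivalent: (i) the symmetrized variational inequality with parameter $\nu$ holds: there exists a constant $\beta\ge0$ such that $2\langle u^\dagger,u\rangle\le\beta\|L^*Lu\|^{\frac\nu2}\|u\|^{1-\frac\nu2}$ for every $u\in U$; (ii) the problem has a noise-free convergence rate of order $\frac\nu2$: there exists a constant $C>0$ such that $\|u_\alpha(y)-u^\dagger\|\le C\alpha^{\frac\nu2}$ for every $\alpha>0$; (iii) the problem has a convergence rate of order $\frac\nu{\nu+1}$: there exists a constant $C>0$ such that for every $\delta>0$ \[ \sup\Big\{\inf_{\alpha>0}\|u_\alpha(\tilde y)-u^\dagger\| : \tilde y\in V,\ \|\tilde y-y\|\le\delta\Big\}\le C\delta^{\frac\nu{\nu+1}}; \] (iv) $u^\dagger$ has a spectral tail of order $\nu$: there exists a constant $C>0$ such that $\|E_{[0,\lambda]}u^\dagger\|^2\le C^2\lambda^\nu$ for all $\lambda\ge0$. If moreover $\nu\in(0,1)$, then these conditions are additionally equivalent to each of the following: (v) the homogeneous variational inequality with parameter $\nu$ holds: there exists a constant $\beta\ge0$ such that $2\langle u^\dagger,u\rangle\le\beta\|Lu\|^\nu\|u\|^{1-\nu}$ for every $u\in U$; (vi) the inhomogeneous variational inequality with parameter $\mu=\frac{2\nu}{1+\nu}$ holds: there exist constants $\beta\ge0$ and $\gamma\in[0,1)$ such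 that $2\langle u^\dagger,u\rangle\le\beta\|Lu\|^{\mu}+\gamma\|u\|^2$ for every $u\in U$.
   Context: $\mathcal R(L)$ denotes the range of $L$ and $L^*$ its Hilbert space adjoint. For $y\in\mathcal R(L)$, the minimum-norm solution $u^\dagger\in U$ is the unique element with $Lu^\dagger=y$ and $\|u^\dagger\|=\inf\{\|u\|:Lu=y\}$. For $\alpha>0$ and $\tilde y\in V$, the (Tikhonov) regularized solution is the unique minimizer $u_\alpha(\tilde y)=\operatorname{argmin}_{u\in U}\left(\|Lu-\tilde y\|^2+\alpha\|u\|^2\right)$. $A\mapsto E_A$ denotes the projection-valued spectral measure of the bounded, self-adjoint, non-negative operator $L^*L$. *)

theory Defs
  imports "HOL-Analysis.Analysis"
begin

definition min_norm_solution ::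
    "('u::{real_inner,complete_space} \<Rightarrow> 'v::{real_inner,complete_space}) \<Rightarrow> 'v \<Rightarrow> 'u" where
  "min_norm_solution L y = (THE x. L x = y \<and> norm x = Inf {norm u |u. L u = y})"

definition regularized_solution ::
    "('u::{real_inner,complete_space} \<Rightarrow> 'v::{real_inner,complete_space}) \<Rightarrow> real \<Rightarrow> 'v \<Rightarrow> 'u" where
  "regularized_solution L \<alpha> y =
     arg_min (\<lambda>u. (norm (L u - y))\<^sup>2 + \<alpha> * (norm u)\<^sup>2) (\<lambda>u. True)"

definition orthogonal_projection :: "('u::{real_inner,complete_space} \<Rightarrow> 'u) \<Rightarrow> bool" where
  "orthogonal_projection P \<longleftrightarrow>
     bounded_linear P \<and> (\<forall>u. P (P u) = P u) \<and> (\<forall>u v. P u \<bullet> v = u \<bullet> P v)"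

text \<open>Projection-valued measures on the Borel sets of the real line; countable additivity is
  with respect to the strong operator topology.  Values on non-Borel sets are irrelevant.\<close>

definition projection_valued_measure ::
    "(real set \<Rightarrow> 'u::{real_inner,complete_space} \<Rightarrow> 'u) \<Rightarrow> bool" where
  "projection_valued_measure E \<longleftrightarrow>
     (\<forall>A\<in>sets borel. orthogonal_projection (E A)) \<and>
     (\<forall>u. E UNIV u = u) \<and>
     (\<forall>A\<in>sets borel. \<forall>B\<in>sets borel. \<forall>u. E (A \<inter> B) u = E A (E B u)) \<and>
     (\<forall>F. range F \<subseteq> sets borel \<longrightarrow> disjoint_family F \<longrightarrow>
        (\<forall>u. (\<lambda>n::nat. E (F n) u) sums E (\<Union>n. F n) u))"

definition scalar_spectral_measure ::
    "(real set \<Rightarrow> 'u::{real_inner,complete_space} \<Rightarrow> 'u) \<Rightarrow> 'u \<Rightarrow> real measure" where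
  "scalar_spectral_measure E u = measure_of UNIV (sets borel) (\<lambda>A. ennreal ((norm (E A u))\<^sup>2))"

text \<open>\<open>E\<close> is compactly supported and \<open>T\<close> is the integral of the identity function against \<open>E\<close>,
  in the weak sense.  It is enough to test this on the diagonal, since a bounded self-adjoint
  operator is determined by its quadratic form (the predicate is meant for such \<open>T\<close> only).\<close>

definition is_spectral_measure ::
    "('u::{real_inner,complete_space} \<Rightarrow> 'u) \<Rightarrow> (real set \<Rightarrow> 'u \<Rightarrow> 'u) \<Rightarrow> bool" where
  "is_spectral_measure T E \<longleftrightarrow>
     projection_valued_measure E \<and>
     (\<exists>M. \<forall>u. E {-M..M} u = u) \<and>
     (\<forall>u. T u \<bullet> u = (\<integral>t. t \<partial>scalar_spectral_measure E u))"

text \<open>By the spectral theorem, such an \<open>E\<close> exists for every bounded self-adjoint \<open>T\<close>, and it is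
  unique on the Borel sets.\<close>

definition spectral_measure ::
    "('u::{real_inner,complete_space} \<Rightarrow> 'u) \<Rightarrow> real set \<Rightarrow> 'u \<Rightarrow> 'u" where
  "spectral_measure T = (SOME E. is_spectral_measure T E)"

text \<open>In the following conditions \<open>x\<close> stands for the minimum-norm solution.  All exponents of
  possibly vanishing bases are positive in the relevant ranges of the parameters, so that the
  convention \<open>0 powr a = 0\<close> is harmless.\<close>

definition symmetrized_vi ::
    "('u::{real_inner,complete_space} \<Rightarrow> 'v::{real_inner,complete_space}) \<Rightarrow> 'u \<Rightarrow> real \<Rightarrow> bool" where
  "symmetrized_vi L x \<nu> \<longleftrightarrow>
     (\<exists>\<beta>\<ge>0. \<forall>u. 2 * (x \<bullet> u)
        \<le> \<beta> * norm (adjoint L (L u)) powr (\<nu> / 2) * norm u powr (1 - \<nu> / 2))"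

definition noise_free_rate ::
    "('u::{real_inner,complete_space} \<Rightarrow> 'v::{real_inner,complete_space})
      \<Rightarrow> 'v \<Rightarrow> 'u \<Rightarrow> real \<Rightarrow> bool" where
  "noise_free_rate L y x r \<longleftrightarrow>
     (\<exists>C>0. \<forall>\<alpha>>0. norm (regularized_solution L \<alpha> y - x) \<le> C * \<alpha> powr r)"

text \<open>The real supremum below is over a nonempty set bounded by the norm of \<open>x\<close>, because
  the regularized solutions tend to \<open>0\<close> as \<open>\<alpha>\<close> tends to infinity.\<close>

definition convergence_rate ::
    "('u::{real_inner,complete_space} \<Rightarrow> 'v::{real_inner,complete_space})
      \<Rightarrow> 'v \<Rightarrow> 'u \<Rightarrow> real \<Rightarrow> bool" where
  "convergence_rate L y x r \<longleftrightarrow>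
     (\<exists>C>0. \<forall>\<delta>>0.
        (SUP y'\<in>{y'. norm (y' - y) \<le> \<delta>}. INF \<alpha>\<in>{0<..}. norm (regularized_solution L \<alpha> y' - x))
          \<le> C * \<delta> powr r)"

definition spectral_tail ::
    "('u::{real_inner,complete_space} \<Rightarrow> 'v::{real_inner,complete_space}) \<Rightarrow> 'u \<Rightarrow> real \<Rightarrow> bool" where
  "spectral_tail L x \<nu> \<longleftrightarrow>
     (\<exists>C>0. \<forall>t\<ge>0. (norm (spectral_measure (adjoint L \<circ> L) {0..t} x))\<^sup>2 \<le> C\<^sup>2 * t powr \<nu>)"

definition homogeneous_vi ::
    "('u::{real_inner,complete_space} \<Rightarrow> 'v::{real_inner,complete_space}) \<Rightarrow> 'u \<Rightarrow> real \<Rightarrow> bool" where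
  "homogeneous_vi L x \<nu> \<longleftrightarrow>
     (\<exists>\<beta>\<ge>0. \<forall>u. 2 * (x \<bullet> u) \<le> \<beta> * norm (L u) powr \<nu> * norm u powr (1 - \<nu>))"

definition inhomogeneous_vi ::
    "('u::{real_inner,complete_space} \<Rightarrow> 'v::{real_inner,complete_space}) \<Rightarrow> 'u \<Rightarrow> real \<Rightarrow> bool" where
  "inhomogeneous_vi L x \<mu> \<longleftrightarrow>
     (\<exists>\<beta>\<ge>0. \<exists>\<gamma>\<in>{0..<1}. \<forall>u. 2 * (x \<bullet> u) \<le> \<beta> * norm (L u) powr \<mu> + \<gamma> * (norm u)\<^sup>2)"

end

(* Put T = L*L and R_a = a (T + a)^-1. The noise-free error is u_a(y) - x = - R_a x, so (ii) is a
   decay rate of R_a x. Testing (i) with u = R_a^2 x gives (ii), and the decomposition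
   <x, u> = <R_a x, u> + <R_a x, T u> / a with a = |T u| / |u| gives the converse; likewise
   <x, u> = <R_a x, u> + <L (T + a)^-1 x, L u> gives (v) for nu < 1, where the second term is
   estimated by doubling a repeatedly. Conditions (v) and (vi) are exchanged by Young's inequality
   and by scaling u. The spectral tail enters only through the projections E = E_[0,t], which commute
   with T and satisfy T <= t on their range and T >= t on its complement; in (iii) the data
   L (x - E x) force the error to be at least |E x|.

   Since the spectral measure is obtained by choice from the spectral theorem, the latter has to be
   proved. The projection E_(-inf,t] is the one onto the kernel of the positive part of T - t, the
   absolute value being the limit of the iteration Y := (A + Y^2) / 2 for the square root. The monotone
   functions |E_(-inf,t] u|^2 generate scalar measures; a Dynkin argument shows that on every Borel set
   they are given by a projection, orthogonality coming from comparing masses. *)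

theory Submission
  imports Defs
begin

section \<open>Closed subspaces and adjoints\<close>

text \<open>Every condition is compared with one hub, \<open>resolvent_rate\<close>, the decay of
  R_a x as a function of a. With a functional calculus most comparisons would be integrals over the
  spectrum. Here T is controlled only through its quadratic form and its spectral projections, so
  these integrals are replaced by exact identities between the parameters a and 2a, iterated into
  geometric series. These series explain the upper bounds on \<nu>. For \<nu> < 1 the increments of
  norm (L (J a x)) along a, 2a, 4a, ... are dominated by a geometric series. For \<nu> < 2 the
  spectrum can be cut so far above a that, beyond the cut, passing from 2a to a contracts R x by a
  factor q with q * 2 powr (\<nu> / 2) < 1. Since \<open>is_spectral_measure\<close> tests only the
  quadratic form, even the commutation of T with the spectral projections has to be recovered from
  it. Riesz representation, the sign projections and the resolvent all come from a single tool, the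
  projection onto a closed subspace.\<close>

lemma closed_subspace_projection:
  fixes S :: "'a::{real_inner,complete_space} set"
  assumes S: "subspace S" "closed S"
  obtains p where "p \<in> S" "\<And>v. v \<in> S \<Longrightarrow> (z - p) \<bullet> v = 0"
proof -
  define d where "d = (INF v\<in>S. (norm (z - v))\<^sup>2)"
  have ne: "S \<noteq> {}" using S(1) subspace_0 by blast
  have bdd: "bdd_below ((\<lambda>v. (norm (z - v))\<^sup>2) ` S)"
    by (rule bdd_belowI[of _ 0]) auto
  have d_le: "d \<le> (norm (z - v))\<^sup>2" if "v \<in> S" for v
    unfolding d_def by (rule cINF_lower[OF bdd that])
  have "\<exists>v\<in>S. (norm (z - v))\<^sup>2 < d + 1 / (real n + 1)" for n
    using cINF_less_iff[OF ne bdd, of "d + 1 / (real n + 1)"] by (auto simp: d_def)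
  then obtain f where f: "\<And>n. f n \<in> S" "\<And>n. (norm (z - f n))\<^sup>2 < d + 1 / (real n + 1)"
    by metis
  \<comment> \<open>Parallelogram law: the midpoint of \<open>f m\<close> and \<open>f n\<close>
    lies in \<open>S\<close>, so its squared distance to \<open>z\<close> is at least
    \<open>d\<close>. This forces the minimizing sequence to be Cauchy.\<close>
  have par: "(norm (f m - f n))\<^sup>2 \<le> 2 / (real m + 1) + 2 / (real n + 1)" for m n
  proof -
    have "(1/2) *\<^sub>R (f m + f n) \<in> S" using f S(1) by (simp add: subspace_add subspace_scale)
    from d_le[OF this] have "4 * d \<le> 4 * (norm (z - (1/2) *\<^sub>R (f m + f n)))\<^sup>2" by simp
    also have "\<dots> = 2 * (norm (z - f m))\<^sup>2 + 2 * (norm (z - f n))\<^sup>2 - (norm (f m - f n))\<^sup>2"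
      by (simp add: power2_norm_eq_inner inner_simps algebra_simps inner_commute)
    finally show ?thesis using f(2)[of m] f(2)[of n] by linarith
  qed
  have "Cauchy f"
  proof (rule CauchyI)
    fix e :: real assume e: "0 < e"
    obtain N where N: "4 / e\<^sup>2 < real N" using reals_Archimedean2 by blast
    have "norm (f m - f n) < e" if "m \<ge> N" "n \<ge> N" for m n
    proof -
      have *: "2 / (real k + 1) < e\<^sup>2 / 2" if "k \<ge> N" for k
      proof -
        have "4 / e\<^sup>2 < real k + 1" using N that by linarith
        then show ?thesis using e by (simp add: field_simps)
      qed
      have "(norm (f m - f n))\<^sup>2 < e\<^sup>2" using par[of m n] *[OF that(1)] *[OF that(2)] by linarith
      then show ?thesis using e by (simp add: power2_less_imp_less)
    qed
    then show "\<exists>M. \<forall>m\<ge>M. \<forall>n\<ge>M. norm (f m - f n) < e" by blast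
  qed
  then obtain p where p: "f \<longlonglongrightarrow> p" by (meson Cauchy_convergent convergent_def)
  have pS: "p \<in> S" using closed_sequentially[OF S(2)] f(1) p by blast
  have lim1: "(\<lambda>n. (norm (z - f n))\<^sup>2) \<longlonglongrightarrow> (norm (z - p))\<^sup>2"
    by (intro tendsto_intros p)
  have "(\<lambda>n. d + 1 / (real n + 1)) \<longlonglongrightarrow> d + 0"
    using LIMSEQ_inverse_real_of_nat by (intro tendsto_intros) (simp add: inverse_eq_divide add.commute)
  from LIMSEQ_le[OF lim1 this] have pd: "(norm (z - p))\<^sup>2 \<le> d"
    using f(2) less_imp_le by auto
  have "(z - p) \<bullet> v = 0" if v: "v \<in> S" for v
  proof (cases "v = 0")
    case False
    \<comment> \<open>The point of the line through \<open>p\<close> in direction \<open>v\<close>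
      that is closest to \<open>z\<close>; minimality of \<open>p\<close> then forces the inner
      product to vanish.\<close>
    define t where "t = ((z - p) \<bullet> v) / (v \<bullet> v)"
    have "p + t *\<^sub>R v \<in> S" using pS v S(1) by (simp add: subspace_add subspace_scale)
    then have "(norm (z - p))\<^sup>2 \<le> (norm (z - (p + t *\<^sub>R v)))\<^sup>2" using d_le pd by (meson order_trans)
    also have "\<dots> = (norm (z - p))\<^sup>2 - 2 * t * ((z - p) \<bullet> v) + t\<^sup>2 * (v \<bullet> v)"
      unfolding power2_norm_eq_inner by (simp add: inner_simps algebra_simps inner_commute power2_eq_square)
    also have "\<dots> = (norm (z - p))\<^sup>2 - ((z - p) \<bullet> v)\<^sup>2 / (v \<bullet> v)"
      using False by (simp add: t_def power2_eq_square)
    finally have "((z - p) \<bullet> v)\<^sup>2 / (v \<bullet> v) \<le> 0" by simp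
    then show ?thesis using False
      by (metis divide_le_0_iff inner_gt_zero_iff not_less power2_less_0 zero_eq_power2 order_antisym_conv zero_le_power2)
  qed simp
  with pS show ?thesis using that by blast
qed

text \<open>The kernel of a nonzero \<open>f\<close> has codimension one, so a vector
  \<open>w\<close> orthogonal to it represents \<open>f\<close> up to scaling.\<close>

lemma riesz_representation:
  fixes f :: "'a::{real_inner,complete_space} \<Rightarrow> real"
  assumes f: "bounded_linear f"
  shows "\<exists>a. \<forall>u. f u = u \<bullet> a"
proof (cases "\<exists>z. f z \<noteq> 0")
  case True
  then obtain z where z: "f z \<noteq> 0" by blast
  interpret f: bounded_linear f by fact
  have sub: "subspace {u. f u = 0}"
    by (auto simp: subspace_def f.add f.scaleR f.zero)
  have cl: "closed {u. f u = 0}"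
    by (intro closed_Collect_eq continuous_intros linear_continuous_on f)
  obtain p where p: "f p = 0" "\<And>v. f v = 0 \<Longrightarrow> (z - p) \<bullet> v = 0"
    using closed_subspace_projection[OF sub cl, of z] by auto
  define w where "w = z - p"
  have fw: "f w \<noteq> 0" using z p(1) by (simp add: w_def f.diff)
  then have w0: "w \<noteq> 0" using f.zero by blast
  have "f u = u \<bullet> ((f w / (w \<bullet> w)) *\<^sub>R w)" for u
  proof -
    have "f (u - (f u / f w) *\<^sub>R w) = 0" using fw by (simp add: f.diff f.scaleR)
    then have "w \<bullet> (u - (f u / f w) *\<^sub>R w) = 0" using p(2) by (simp add: w_def)
    then have "w \<bullet> u = (f u / f w) * (w \<bullet> w)" by (simp add: inner_simps)
    then show ?thesis using fw w0 by (simp add: inner_commute)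
  qed
  then show ?thesis by blast
qed (auto intro: exI[of _ 0])

text \<open>\<open>adjoint\<close> is a choice of a map with this property; Riesz representation
  shows that there is one to choose.\<close>

lemma adjoint_inner:
  fixes L :: "'u::{real_inner,complete_space} \<Rightarrow> 'v::real_inner"
  assumes L: "bounded_linear L"
  shows "L u \<bullet> v = u \<bullet> adjoint L v"
proof -
  have "\<exists>a. \<forall>u. L u \<bullet> v = u \<bullet> a" for v
    by (rule riesz_representation)
      (rule bounded_linear_compose[OF bounded_linear_inner_left L])
  then obtain g where "\<forall>u v. L u \<bullet> v = u \<bullet> g v" by metis
  then have "\<forall>u v. L u \<bullet> v = u \<bullet> adjoint L v" unfolding adjoint_def by (rule someI[of "\<lambda>g. \<forall>u v. L u \<bullet> v = u \<bullet> g v"])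
  then show ?thesis by blast
qed

lemma bounded_linear_adjoint:
  fixes L :: "'u::{real_inner,complete_space} \<Rightarrow> 'v::real_inner"
  assumes L: "bounded_linear L"
  shows "bounded_linear (adjoint L)"
proof -
  interpret L: bounded_linear L by fact
  note adj = adjoint_inner[OF L]
  obtain K where K: "\<And>u. norm (L u) \<le> norm u * K" "0 \<le> K" using L.nonneg_bounded by blast
  have ext: "a = b" if "\<And>u. u \<bullet> a = u \<bullet> b" for a b :: 'u
    using that[of "a - b"] by (metis inner_diff_right inner_eq_zero_iff right_minus_eq)
  show ?thesis
  proof
    show "adjoint L (a + b) = adjoint L a + adjoint L b" for a b
      by (rule ext) (simp add: adj[symmetric] inner_simps)
    show "adjoint L (r *\<^sub>R b) = r *\<^sub>R adjoint L b" for r b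
      by (rule ext) (simp add: adj[symmetric] inner_simps)
    have "norm (adjoint L v) \<le> norm v * K" for v
    proof -
      have "(norm (adjoint L v))\<^sup>2 = L (adjoint L v) \<bullet> v" by (simp add: adj power2_norm_eq_inner)
      also have "\<dots> \<le> norm (L (adjoint L v)) * norm v" by (rule norm_cauchy_schwarz)
      also have "\<dots> \<le> (norm (adjoint L v) * K) * norm v" using K(1) by (intro mult_right_mono) auto
      finally have "norm (adjoint L v) * norm (adjoint L v) \<le> norm (adjoint L v) * (norm v * K)"
        by (simp add: power2_eq_square ac_simps)
      then show ?thesis using K(2) by (cases "adjoint L v = 0") (auto simp: mult_le_cancel_left)
    qed
    then show "\<exists>K. \<forall>v. norm (adjoint L v) \<le> norm v * K" by blast
  qed
qed

text \<open>Removing from any solution its component in the kernel leaves a solution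
  \<open>w\<close> orthogonal to the kernel, and Pythagoras makes \<open>w\<close> the unique one of
  minimal norm, so the definite description is meaningful. In the end it serves to replace
  \<open>y\<close> by \<open>L x\<close>.\<close>

lemma min_norm_solution_solves:
  fixes L :: "'u::{real_inner,complete_space} \<Rightarrow> 'v::{real_inner,complete_space}"
  assumes L: "bounded_linear L" and y: "y \<in> range L"
  shows "L (min_norm_solution L y) = y"
proof -
  interpret L: bounded_linear L by fact
  obtain z where z: "y = L z" using y by blast
  have sub: "subspace {u. L u = 0}"
    by (auto simp: subspace_def L.add L.scaleR L.zero)
  have cl: "closed {u. L u = 0}"
    by (intro closed_Collect_eq continuous_intros linear_continuous_on L)
  obtain p where p: "L p = 0" "\<And>v. L v = 0 \<Longrightarrow> (z - p) \<bullet> v = 0"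
    using closed_subspace_projection[OF sub cl, of z] by auto
  define w where "w = z - p"
  have w: "L w = y" using p(1) z by (simp add: w_def L.diff)
  have pyth: "(norm u)\<^sup>2 = (norm w)\<^sup>2 + (norm (u - w))\<^sup>2" if "L u = y" for u
  proof -
    have "w \<bullet> (u - w) = 0" using p(2)[of "u - w"] that w by (simp add: w_def L.diff)
    then show ?thesis by (simp add: power2_norm_eq_inner inner_simps inner_commute)
  qed
  have le: "norm w \<le> norm u" if "L u = y" for u
    using pyth[OF that] by (metis le_add_same_cancel1 norm_ge_zero power2_le_imp_le zero_le_power2)
  have inf: "Inf {norm u |u. L u = y} = norm w"
    by (rule cInf_eq_minimum) (use w le in auto)
  have "\<exists>!x. L x = y \<and> norm x = Inf {norm u |u. L u = y}"
  proof (rule ex1I[of _ w])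
    fix x assume x: "L x = y \<and> norm x = Inf {norm u |u. L u = y}"
    then show "x = w" using pyth[of x] inf by simp
  qed (use w inf in auto)
  from theI'[OF this] show ?thesis unfolding min_norm_solution_def by blast
qed

section \<open>Self-adjoint operators\<close>

definition selfadjoint_operator :: "('a::real_inner \<Rightarrow> 'a) \<Rightarrow> bool" where
  "selfadjoint_operator S \<longleftrightarrow> bounded_linear S \<and> (\<forall>u v. S u \<bullet> v = u \<bullet> S v)"

lemma selfadjoint_operatorD:
  assumes "selfadjoint_operator S"
  shows "bounded_linear S" "S u \<bullet> v = u \<bullet> S v"
  using assms by (auto simp: selfadjoint_operator_def)

lemma inner_eqI:
  assumes "\<And>u. u \<bullet> a = u \<bullet> b"
  shows "a = b"
  using assms[of "a - b"] by (metis inner_diff_right inner_eq_zero_iff right_minus_eq)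

section \<open>Orthogonal projections\<close>

lemma orthogonal_projection_selfadjoint:
  "orthogonal_projection P \<Longrightarrow> selfadjoint_operator P"
  by (auto simp: orthogonal_projection_def selfadjoint_operator_def)

lemma orthogonal_projection_norm:
  assumes P: "orthogonal_projection P"
  shows "(norm (P u))\<^sup>2 = P u \<bullet> u" "(norm u)\<^sup>2 = (norm (P u))\<^sup>2 + (norm (u - P u))\<^sup>2"
    "norm (P u) \<le> norm u"
proof -
  show *: "(norm (P u))\<^sup>2 = P u \<bullet> u"
    using P[unfolded orthogonal_projection_def] by (simp add: power2_norm_eq_inner)
  then show **: "(norm u)\<^sup>2 = (norm (P u))\<^sup>2 + (norm (u - P u))\<^sup>2"
    by (simp add: power2_norm_eq_inner inner_simps inner_commute)
  show "norm (P u) \<le> norm u" by (rule power2_le_imp_le) (use ** in auto)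
qed

text \<open>Idempotence and symmetry give Pythagoras, hence the norm bound 1. Projections built as
  pointwise limits become bounded this way.\<close>

lemma orthogonal_projectionI:
  assumes lin: "linear P" and idem: "\<And>u. P (P u) = P u" and sa: "\<And>u v. P u \<bullet> v = u \<bullet> P v"
  shows "orthogonal_projection P"
proof -
  have "norm (P u) \<le> norm u * 1" for u
  proof -
    have "(norm (P u))\<^sup>2 = P u \<bullet> u" using sa[of "P u" u] by (simp add: power2_norm_eq_inner idem)
    then have "(norm u)\<^sup>2 = (norm (P u))\<^sup>2 + (norm (u - P u))\<^sup>2"
      by (simp add: power2_norm_eq_inner inner_simps inner_commute)
    then have "(norm (P u))\<^sup>2 \<le> (norm u)\<^sup>2" by simp
    then show ?thesis using power2_le_imp_le[of _ "norm u"] by simp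
  qed
  then have "bounded_linear P"
    by (intro bounded_linear_intro[where K = 1] linear_add[OF lin] linear_scale[OF lin])
  with idem sa show ?thesis unfolding orthogonal_projection_def by blast
qed

text \<open>The last conclusion holds because a self-adjoint \<open>R\<close> that leaves
  \<open>S\<close> invariant leaves its orthogonal complement invariant too.\<close>

lemma closed_subspace_orthogonal_projection:
  fixes S :: "'a::{real_inner,complete_space} set"
  assumes S: "subspace S" "closed S"
  obtains P where "orthogonal_projection P" "\<And>u. P u \<in> S" "\<And>u. u \<in> S \<Longrightarrow> P u = u"
    "\<And>u v. v \<in> S \<Longrightarrow> (u - P u) \<bullet> v = 0"
    "\<And>R u. selfadjoint_operator R \<Longrightarrow> (\<And>v. v \<in> S \<Longrightarrow> R v \<in> S) \<Longrightarrow> R (P u) = P (R u)"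
proof -
  have "\<exists>p. p \<in> S \<and> (\<forall>v\<in>S. (u - p) \<bullet> v = 0)" for u
    by (rule closed_subspace_projection[OF S, of u]) blast
  then obtain P where P: "\<And>u. P u \<in> S" "\<And>u v. v \<in> S \<Longrightarrow> (u - P u) \<bullet> v = 0" by metis
  \<comment> \<open>Membership in \<open>S\<close> and orthogonality of the remainder determine the
    projection; linearity and commutation are both read off from this characterization.\<close>
  have uniq: "P u = p" if "p \<in> S" "\<And>v. v \<in> S \<Longrightarrow> (u - p) \<bullet> v = 0" for u p
  proof -
    have "P u - p \<in> S" using P(1) that(1) S(1) by (simp add: subspace_diff)
    then have "(u - p) \<bullet> (P u - p) = 0" "(u - P u) \<bullet> (P u - p) = 0" using P(2) that(2) by auto
    then have "(P u - p) \<bullet> (P u - p) = 0" by (simp add: inner_simps)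
    then show ?thesis by simp
  qed
  have "linear P"
  proof
    show "P (a + b) = P a + P b" for a b
    proof (rule uniq)
      show "P a + P b \<in> S" using P(1) S(1) by (simp add: subspace_add)
      show "(a + b - (P a + P b)) \<bullet> v = 0" if "v \<in> S" for v
        unfolding add_diff_add inner_add_left by (simp add: P(2) that)
    qed
    show "P (r *\<^sub>R b) = r *\<^sub>R P b" for r b
    proof (rule uniq)
      show "r *\<^sub>R P b \<in> S" using P(1) S(1) by (simp add: subspace_scale)
      show "(r *\<^sub>R b - r *\<^sub>R P b) \<bullet> v = 0" if "v \<in> S" for v
        unfolding scaleR_diff_right[symmetric] inner_scaleR_left by (simp add: P(2) that)
    qed
  qed
  moreover have fixS: "P u = u" if "u \<in> S" for u by (rule uniq) (use that in auto)
  moreover have "P u \<bullet> v = u \<bullet> P v" for u v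
  proof -
    have "(u - P u) \<bullet> P v = 0" "(v - P v) \<bullet> P u = 0" by (rule P(2)[OF P(1)])+
    then show ?thesis by (simp add: inner_simps inner_commute)
  qed
  ultimately have orth: "orthogonal_projection P"
    by (intro orthogonal_projectionI fixS P(1))
  have comm: "R (P u) = P (R u)" if R: "selfadjoint_operator R" "\<And>v. v \<in> S \<Longrightarrow> R v \<in> S" for R u
  proof (rule uniq[symmetric])
    interpret R: bounded_linear R using R(1) by (rule selfadjoint_operatorD)
    show "R (P u) \<in> S" using P(1) R(2) by blast
    fix v assume "v \<in> S"
    then have "(u - P u) \<bullet> R v = 0" using R(2) P(2) by blast
    then show "(R u - R (P u)) \<bullet> v = 0"
      by (simp only: R.diff[symmetric] selfadjoint_operatorD(2)[OF R(1)])
  qed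
  show ?thesis by (rule that[OF orth P(1) fixS P(2) comm])
qed

section \<open>Operator square roots and the absolute value\<close>

text \<open>A fixed point Y of this iteration satisfies (1 - Y)^2 = 1 - A, so 1 - Y is a square root
  of 1 - A.\<close>

primrec sqrt_iter :: "('a::real_vector \<Rightarrow> 'a) \<Rightarrow> nat \<Rightarrow> 'a \<Rightarrow> 'a" where
  "sqrt_iter A 0 u = 0"
| "sqrt_iter A (Suc n) u = (1/2) *\<^sub>R (A u + sqrt_iter A n (sqrt_iter A n u))"

text \<open>The same iteration with the number 1 in place of \<open>A\<close>: a bounded increasing
  scalar majorant whose convergence is transferred to the operators.\<close>

primrec sqrt_maj :: "nat \<Rightarrow> real" where
  "sqrt_maj 0 = 0"
| "sqrt_maj (Suc n) = (1 + (sqrt_maj n)\<^sup>2) / 2"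

lemma sqrt_maj_bounds: "0 \<le> sqrt_maj n" "sqrt_maj n \<le> 1"
proof -
  have "0 \<le> sqrt_maj n \<and> sqrt_maj n \<le> 1"
  proof (induction n)
    case (Suc n)
    then have "(sqrt_maj n)\<^sup>2 \<le> 1" by (simp add: power_le_one)
    then show ?case by simp
  qed simp
  then show "0 \<le> sqrt_maj n" "sqrt_maj n \<le> 1" by auto
qed

lemma sqrt_maj_Suc_diff: "sqrt_maj (Suc n) - sqrt_maj n = (1 - sqrt_maj n)\<^sup>2 / 2"
  by (simp add: power2_eq_square field_simps)

lemma incseq_sqrt_maj: "incseq sqrt_maj"
  using sqrt_maj_Suc_diff by (intro incseq_SucI) (metis diff_ge_0_iff_ge zero_le_divide_iff zero_le_numeral zero_le_power2)

lemma linear_sqrt_iter: "linear A \<Longrightarrow> linear (sqrt_iter A n)"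
proof (induction n)
  case (Suc n)
  then interpret A: linear A + Y: linear "sqrt_iter A n" by auto
  show ?case by (rule linearI) (simp_all add: A.add A.scale Y.add Y.scale algebra_simps)
qed (auto intro: linearI)

text \<open>The increment of the squares splits as Y' (Y' - Y) + (Y' - Y) Y for successive iterates
  Y and Y'. Bounding each factor by its scalar counterpart c', c gives (c' + c) (c' - c), exactly
  twice the next increment of the majorant.\<close>

lemma sqrt_iter_norms:
  fixes A :: "'a::real_normed_vector \<Rightarrow> 'a"
  assumes lin: "linear A" and contr: "\<And>u. norm (A u) \<le> norm u"
  shows norm_sqrt_iter: "norm (sqrt_iter A n u) \<le> sqrt_maj n * norm u"
    and "norm (sqrt_iter A (Suc n) u - sqrt_iter A n u) \<le> (sqrt_maj (Suc n) - sqrt_maj n) * norm u"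
proof -
  note Ylin = linear_sqrt_iter[OF lin]
  show n1: "norm (sqrt_iter A n u) \<le> sqrt_maj n * norm u" for n u
  proof (induction n arbitrary: u)
    case (Suc n)
    have "norm (sqrt_iter A n (sqrt_iter A n u)) \<le> sqrt_maj n * norm (sqrt_iter A n u)" by (rule Suc)
    also have "\<dots> \<le> sqrt_maj n * (sqrt_maj n * norm u)"
      using sqrt_maj_bounds Suc by (intro mult_left_mono) auto
    finally have "norm (A u + sqrt_iter A n (sqrt_iter A n u)) \<le> norm u + (sqrt_maj n)\<^sup>2 * norm u"
      using contr[of u] by (intro norm_triangle_mono) (auto simp: power2_eq_square mult.assoc)
    then show ?case unfolding sqrt_iter.simps sqrt_maj.simps norm_scaleR by (simp add: algebra_simps)
  qed simp
  show "norm (sqrt_iter A (Suc n) u - sqrt_iter A n u) \<le> (sqrt_maj (Suc n) - sqrt_maj n) * norm u"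
  proof (induction n arbitrary: u)
    case 0
    then show ?case using contr[of u] by simp
  next
    case (Suc n)
    let ?Y = "sqrt_iter A" and ?c = sqrt_maj
    let ?D = "?Y (Suc n) u - ?Y n u" and ?d = "?c (Suc n) - ?c n"
    have d0: "0 \<le> ?d" by (subst sqrt_maj_Suc_diff) simp
    have half: "a - b = (1/2) *\<^sub>R (p - q)"
      if "a = (1/2) *\<^sub>R (A u + p)" "b = (1/2) *\<^sub>R (A u + q)" for a b p q
      unfolding that scaleR_diff_right[symmetric] by simp
    have "?Y (Suc (Suc n)) u - ?Y (Suc n) u
        = (1/2) *\<^sub>R (?Y (Suc n) (?Y (Suc n) u) - ?Y n (?Y n u))"
      by (rule half) (rule sqrt_iter.simps(2))+
    moreover have "?Y (Suc n) (?Y (Suc n) u) = ?Y (Suc n) ?D + ?Y (Suc n) (?Y n u)"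
      unfolding linear_add[OF Ylin, symmetric] by simp
    ultimately have eq: "?Y (Suc (Suc n)) u - ?Y (Suc n) u
        = (1/2) *\<^sub>R (?Y (Suc n) ?D + (?Y (Suc n) (?Y n u) - ?Y n (?Y n u)))"
      by (simp only: add_diff_eq)
    have "norm (?Y (Suc n) ?D) \<le> ?c (Suc n) * norm ?D" by (rule n1)
    also have "\<dots> \<le> ?c (Suc n) * (?d * norm u)"
      by (intro mult_left_mono Suc sqrt_maj_bounds)
    finally have 1: "norm (?Y (Suc n) ?D) \<le> ?c (Suc n) * (?d * norm u)" .
    have "norm (?Y (Suc n) (?Y n u) - ?Y n (?Y n u)) \<le> ?d * norm (?Y n u)" by (rule Suc)
    also have "\<dots> \<le> ?d * (?c n * norm u)" by (intro mult_left_mono n1 d0)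
    finally have "norm (?Y (Suc n) ?D + (?Y (Suc n) (?Y n u) - ?Y n (?Y n u)))
        \<le> ?c (Suc n) * (?d * norm u) + ?d * (?c n * norm u)"
      using 1 by (intro norm_triangle_mono)
    also have "\<dots> = 2 * ((?c (Suc (Suc n)) - ?c (Suc n)) * norm u)"
    proof -
      have "2 * (a - b) = b\<^sup>2 - c\<^sup>2" if "a = (1 + b\<^sup>2) / 2" "b = (1 + c\<^sup>2) / 2" for a b c :: real
        proof -
        have "c\<^sup>2 = 2 * b - 1" using that(2) by simp
        then show ?thesis unfolding that(1) by simp
      qed
      from this[OF sqrt_maj.simps(2) sqrt_maj.simps(2)]
      have "2 * (?c (Suc (Suc n)) - ?c (Suc n)) = (?c (Suc n) + ?c n) * ?d"
        by (simp only: power2_eq_square) (simp only: algebra_simps)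
      then have "2 * (?c (Suc (Suc n)) - ?c (Suc n)) * norm u = (?c (Suc n) + ?c n) * ?d * norm u"
        by (simp only:)
      then show ?thesis by (simp only: ring_distribs mult_ac)
    qed
    finally show ?case unfolding eq by (simp del: sqrt_iter.simps sqrt_maj.simps)
  qed
qed

lemma sqrt_iter_limit:
  fixes A :: "'a::{real_inner,complete_space} \<Rightarrow> 'a"
  assumes lin: "linear A" and contr: "\<And>u. norm (A u) \<le> norm u"
    and sa: "\<And>u v. A u \<bullet> v = u \<bullet> A v"
  obtains Y where "linear Y" "\<And>u. norm (Y u) \<le> norm u" "\<And>u v. Y u \<bullet> v = u \<bullet> Y v"
    "\<And>u. Y (Y u) = 2 *\<^sub>R Y u - A u"
    "\<And>R u. bounded_linear R \<Longrightarrow> (\<And>u. R (A u) = A (R u)) \<Longrightarrow> R (Y u) = Y (R u)"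
proof -
  let ?Y = "sqrt_iter A" and ?c = sqrt_maj
  note Ylin = linear_sqrt_iter[OF lin]
  have diff: "norm (?Y (n + k) u - ?Y n u) \<le> (?c (n + k) - ?c n) * norm u" for n k u
  proof (induction k)
    case (Suc k)
    have "norm (?Y (Suc (n + k)) u - ?Y n u)
        \<le> norm (?Y (Suc (n + k)) u - ?Y (n + k) u) + norm (?Y (n + k) u - ?Y n u)"
      by (metis norm_triangle_ineq add_diff_cancel diff_add_cancel add_diff_eq)
    also have "\<dots> \<le> (?c (Suc (n + k)) - ?c (n + k)) * norm u + (?c (n + k) - ?c n) * norm u"
      by (intro add_mono Suc sqrt_iter_norms(2) lin contr)
    finally show ?case by (simp add: algebra_simps del: sqrt_iter.simps sqrt_maj.simps)
  qed simp
  have ccau: "Cauchy ?c"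
    using incseq_convergent[OF incseq_sqrt_maj] sqrt_maj_bounds by (metis LIMSEQ_imp_Cauchy)
  have "Cauchy (\<lambda>n. ?Y n u)" for u
  proof (rule CauchyI')
    fix e :: real assume e: "0 < e"
    then have "0 < e / (norm u + 1)" by (simp add: add_nonneg_pos)
    then obtain M where M: "\<And>m n. m \<ge> M \<Longrightarrow> n \<ge> M \<Longrightarrow> norm (?c m - ?c n) < e / (norm u + 1)"
      using CauchyD[OF ccau] by blast
    have "dist (?Y m u) (?Y n u) < e" if "m \<ge> M" "m < n" for m n
    proof -
      obtain k where n: "n = m + k" using \<open>m < n\<close> less_imp_add_positive by blast
      have "dist (?Y m u) (?Y n u) \<le> (?c n - ?c m) * norm u"
        using diff[of m k u] n by (simp add: dist_norm norm_minus_commute)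
      also have "\<dots> \<le> (e / (norm u + 1)) * norm u"
        using M[of n m] that by (intro mult_right_mono) auto
      also have "\<dots> < e" using e by (simp add: divide_less_eq add_nonneg_pos distrib_left)
      finally show ?thesis .
    qed
    then show "\<exists>M. \<forall>m\<ge>M. \<forall>n>m. dist (?Y m u) (?Y n u) < e" by blast
  qed
  then have "\<forall>u. \<exists>l. (\<lambda>n. ?Y n u) \<longlonglongrightarrow> l" by (meson Cauchy_convergent convergent_def)
  then obtain Y where Y: "\<And>u. (\<lambda>n. ?Y n u) \<longlonglongrightarrow> Y u" by metis
  have Ylin': "linear Y"
  proof
    show "Y (a + b) = Y a + Y b" for a b
      by (rule LIMSEQ_unique[OF Y]) (simp add: linear_add[OF Ylin] tendsto_add Y)
    show "Y (r *\<^sub>R b) = r *\<^sub>R Y b" for r b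
      by (rule LIMSEQ_unique[OF Y]) (simp add: linear_scale[OF Ylin] tendsto_scaleR Y)
  qed
  have n1: "norm (?Y n u) \<le> norm u" for n u
    using norm_sqrt_iter[OF lin contr, of n u] mult_right_mono[OF sqrt_maj_bounds(2)[of n], of "norm u"]
    by simp
  have n2: "norm (Y u) \<le> norm u" for u
    by (rule LIMSEQ_le_const2[OF tendsto_norm[OF Y]]) (use n1 in auto)
  have Ysa: "?Y n u \<bullet> v = u \<bullet> ?Y n v" for n u v
    by (induction n arbitrary: u v) (simp_all add: inner_simps sa)
  have Ysa': "Y u \<bullet> v = u \<bullet> Y v" for u v
    by (rule LIMSEQ_unique[of "\<lambda>n. ?Y n u \<bullet> v"])
      (rule tendsto_inner[OF Y tendsto_const], simp add: Ysa tendsto_inner Y)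
  \<comment> \<open>The iterates share the norm bound 1, so \<open>?Y n (Y u - ?Y n u)\<close>
    vanishes in the limit and the products converge to the product of the limits.\<close>
  have YY: "(\<lambda>n. ?Y n (?Y n u)) \<longlonglongrightarrow> Y (Y u)" for u
  proof -
    have "(\<lambda>n. Y u - ?Y n u) \<longlonglongrightarrow> 0" using tendsto_diff[OF tendsto_const Y, of "Y u" u] by simp
    then have "(\<lambda>n. ?Y n (Y u - ?Y n u)) \<longlonglongrightarrow> 0"
      by (rule tendsto_0_le[where K = 1]) (use n1 in auto)
    from tendsto_diff[OF Y this, of "Y u"] show ?thesis
      by (simp add: linear_diff[OF Ylin])
  qed
  have sq: "Y (Y u) = 2 *\<^sub>R Y u - A u" for u
  proof -
    have "(\<lambda>n. ?Y (Suc n) u) \<longlonglongrightarrow> (1/2) *\<^sub>R (A u + Y (Y u))"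
      unfolding sqrt_iter.simps by (intro tendsto_intros YY)
    moreover have "(\<lambda>n. ?Y (Suc n) u) \<longlonglongrightarrow> Y u" using Y[of u] by (rule LIMSEQ_Suc)
    ultimately have "Y u = (1/2) *\<^sub>R (A u + Y (Y u))" using LIMSEQ_unique by blast
    then have "2 *\<^sub>R Y u = A u + Y (Y u)" by (metis scaleR_half_double scaleR_2 scaleR_add_right)
    then show ?thesis by simp
  qed
  \<comment> \<open>Each iterate is a polynomial in \<open>A\<close>, so commutation passes to the
    limit.\<close>
  have comm: "R (Y u) = Y (R u)" if R: "bounded_linear R" "\<And>u. R (A u) = A (R u)" for R u
  proof -
    interpret R: bounded_linear R by fact
    have c: "R (?Y n u) = ?Y n (R u)" for n u
      by (induction n arbitrary: u) (simp_all add: R.zero R.scaleR R.add R(2))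
    have "(\<lambda>n. R (?Y n u)) \<longlonglongrightarrow> R (Y u)" by (rule R.tendsto[OF Y])
    then show ?thesis unfolding c by (rule LIMSEQ_unique[OF _ Y])
  qed
  show ?thesis by (rule that[OF Ylin' n2 Ysa' sq comm])
qed

lemma selfadjoint_operator_abs:
  fixes S :: "'a::{real_inner,complete_space} \<Rightarrow> 'a"
  assumes S: "selfadjoint_operator S"
  obtains B where "selfadjoint_operator B" "\<And>u. 0 \<le> B u \<bullet> u" "\<And>u. B (B u) = S (S u)"
    "\<And>R u. bounded_linear R \<Longrightarrow> (\<And>u. R (S u) = S (R u)) \<Longrightarrow> R (B u) = B (R u)"
proof -
  interpret S: bounded_linear S using S by (rule selfadjoint_operatorD)
  note sa = selfadjoint_operatorD(2)[OF S]
  obtain K where K: "0 < K" "\<And>u. norm (S u) \<le> norm u * K" using S.pos_bounded by blast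
  \<comment> \<open>Scaling by a bound \<open>K\<close> for \<open>S\<close> makes 1 - (S / K)^2 a
    contraction. The iteration then yields a square root 1 - Y of (S / K)^2, and \<open>K\<close>
    times it is the absolute value.\<close>
  define A where "A = (\<lambda>u. u - (1 / K\<^sup>2) *\<^sub>R S (S u))"
  have linA: "linear A"
    by (rule linearI) (simp_all add: A_def S.add S.scaleR algebra_simps)
  have contr: "norm (A u) \<le> norm u" for u
  proof -
    have *: "norm (S (S u)) \<le> K * norm (S u)" using K(2)[of "S u"] by (simp add: mult.commute)
    have 1: "(norm (S (S u)))\<^sup>2 \<le> K\<^sup>2 * (norm (S u))\<^sup>2"
      using power_mono[OF *, of 2] by (simp add: power_mult_distrib)
    have "(norm (A u))\<^sup>2 = (norm u)\<^sup>2 - 2 / K\<^sup>2 * (norm (S u))\<^sup>2 + (1 / K\<^sup>2)\<^sup>2 * (norm (S (S u)))\<^sup>2"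
      unfolding power2_norm_eq_inner A_def
      by (simp add: inner_simps sa algebra_simps power2_eq_square)
    also have "\<dots> \<le> (norm u)\<^sup>2 - 2 / K\<^sup>2 * (norm (S u))\<^sup>2 + (1 / K\<^sup>2)\<^sup>2 * (K\<^sup>2 * (norm (S u))\<^sup>2)"
      by (intro add_left_mono mult_left_mono 1) auto
    also have "\<dots> = (norm u)\<^sup>2 - 1 / K\<^sup>2 * (norm (S u))\<^sup>2"
      using K(1) by (simp add: field_simps power2_eq_square)
    also have "\<dots> \<le> (norm u)\<^sup>2" by simp
    finally show ?thesis by (rule power2_le_imp_le) simp
  qed
  have saA: "A u \<bullet> v = u \<bullet> A v" for u v by (simp add: A_def inner_simps sa)
  obtain Y where Y: "linear Y" "\<And>u. norm (Y u) \<le> norm u" "\<And>u v. Y u \<bullet> v = u \<bullet> Y v"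
    "\<And>u. Y (Y u) = 2 *\<^sub>R Y u - A u"
    "\<And>R u. bounded_linear R \<Longrightarrow> (\<And>u. R (A u) = A (R u)) \<Longrightarrow> R (Y u) = Y (R u)"
    by (rule sqrt_iter_limit[OF linA contr saA]) blast
  have Ybl: "bounded_linear Y"
    using Y(2) by (intro bounded_linear_intro[where K = 1] linear_add[OF Y(1)] linear_scale[OF Y(1)]) simp
  define B where "B = (\<lambda>u. K *\<^sub>R (u - Y u))"
  have "bounded_linear B"
    unfolding B_def
    by (intro bounded_linear_compose[OF bounded_linear_scaleR_right] bounded_linear_sub bounded_linear_ident Ybl)
  then have 1: "selfadjoint_operator B"
    by (simp add: selfadjoint_operator_def B_def inner_simps Y(3))
  have 2: "0 \<le> B u \<bullet> u" for u
  proof -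
    have "Y u \<bullet> u \<le> norm (Y u) * norm u" by (rule norm_cauchy_schwarz)
    also have "\<dots> \<le> norm u * norm u" by (intro mult_right_mono Y(2)) simp
    also have "\<dots> = u \<bullet> u" by (simp add: norm_eq_sqrt_inner)
    finally show ?thesis using K(1) by (simp add: B_def inner_diff_left)
  qed
  have 3: "B (B u) = S (S u)" for u
  proof -
    have "B (B u) = (K * K) *\<^sub>R (u - 2 *\<^sub>R Y u + Y (Y u))"
      by (simp add: B_def linear_scale[OF Y(1)] linear_diff[OF Y(1)] scaleR_2 algebra_simps)
    also have "\<dots> = (K * K) *\<^sub>R ((1 / K\<^sup>2) *\<^sub>R S (S u))"
      unfolding Y(4) by (simp add: A_def)
    also have "\<dots> = S (S u)" using K(1) by (simp add: power2_eq_square)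
    finally show ?thesis .
  qed
  have 4: "R (B u) = B (R u)" if R: "bounded_linear R" "\<And>u. R (S u) = S (R u)" for R u
  proof -
    interpret R: bounded_linear R by fact
    have "R (A u) = A (R u)" for u by (simp add: A_def R.diff R.scaleR R(2))
    from Y(5)[OF R(1) this] show ?thesis by (simp add: B_def R.diff R.scaleR)
  qed
  show ?thesis by (rule that[OF 1 2 3 4])
qed

text \<open>If \<open>B u\<close> were nonzero, moving from \<open>u\<close> a small step against
  \<open>B u\<close> would make the form negative, because it vanishes at \<open>u\<close> and its
  derivative there is -2 times the squared norm of \<open>B u\<close>.\<close>

lemma nonneg_operator_zero:
  fixes B :: "'a::real_inner \<Rightarrow> 'a"
  assumes B: "selfadjoint_operator B" "\<And>u. 0 \<le> B u \<bullet> u" and 0: "B u \<bullet> u = 0"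
  shows "B u = 0"
proof -
  interpret B: bounded_linear B using B(1) by (rule selfadjoint_operatorD)
  note sa = selfadjoint_operatorD(2)[OF B(1)]
  define c where "c = B (B u) \<bullet> B u"
  \<comment> \<open>Small enough that the quadratic term stays below the linear one; the added 1
    keeps the denominator positive when \<open>c = 0\<close>.\<close>
  define t where "t = (norm (B u))\<^sup>2 / (c + 1)"
  have c: "0 \<le> c" using B(2) by (simp add: c_def)
  have "0 \<le> B (u - t *\<^sub>R B u) \<bullet> (u - t *\<^sub>R B u)" by (rule B(2))
  also have "\<dots> = t * (t * c - 2 * (norm (B u))\<^sup>2)"
    unfolding power2_norm_eq_inner c_def
    using 0 by (simp add: B.diff B.scaleR inner_simps sa inner_commute algebra_simps)
  also have "t * c = (norm (B u))\<^sup>2 * (c / (c + 1))" by (simp add: t_def)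
  finally have *: "0 \<le> t * ((norm (B u))\<^sup>2 * (c / (c + 1)) - 2 * (norm (B u))\<^sup>2)" .
  show ?thesis
  proof (rule ccontr)
    assume "B u \<noteq> 0"
    then have p: "0 < (norm (B u))\<^sup>2" by simp
    have "c / (c + 1) < 2" using c by (simp add: field_simps)
    then have "(norm (B u))\<^sup>2 * (c / (c + 1)) < (norm (B u))\<^sup>2 * 2"
      by (rule mult_strict_left_mono[OF _ p])
    moreover have "0 < t" using p c by (simp add: t_def)
    ultimately have "t * ((norm (B u))\<^sup>2 * (c / (c + 1)) - 2 * (norm (B u))\<^sup>2) < 0"
      by (intro mult_pos_neg) auto
    with * show False by simp
  qed
qed

text \<open>The projection onto the kernel of the positive part \<open>S\<^sub>+ = (\<bar>S\<bar> + S) / 2\<close>.\<close>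

lemma selfadjoint_sign_projection:
  fixes S :: "'a::{real_inner,complete_space} \<Rightarrow> 'a"
  assumes S: "selfadjoint_operator S"
  obtains P where "orthogonal_projection P" "\<And>u. P u = u \<Longrightarrow> S u \<bullet> u \<le> 0"
    "\<And>u. P u = 0 \<Longrightarrow> u \<noteq> 0 \<Longrightarrow> 0 < S u \<bullet> u"
    "\<And>R u. selfadjoint_operator R \<Longrightarrow> (\<And>u. R (S u) = S (R u)) \<Longrightarrow> R (P u) = P (R u)"
proof -
  obtain B where B: "selfadjoint_operator B" "\<And>u. 0 \<le> B u \<bullet> u" "\<And>u. B (B u) = S (S u)"
    "\<And>R u. bounded_linear R \<Longrightarrow> (\<And>u. R (S u) = S (R u)) \<Longrightarrow> R (B u) = B (R u)"
    by (rule selfadjoint_operator_abs[OF S]) blast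
  interpret S: bounded_linear S using S by (rule selfadjoint_operatorD)
  interpret B: bounded_linear B using B(1) by (rule selfadjoint_operatorD)
  note sa = selfadjoint_operatorD(2)[OF S] selfadjoint_operatorD(2)[OF B(1)]
  have SB: "S (B u) = B (S u)" for u using B(4)[OF S.bounded_linear] by simp
  define D where "D = (\<lambda>u. B u + S u)"
  define N where "N = (\<lambda>u. B u - S u)"
  \<comment> \<open>\<open>D\<close> and \<open>N\<close> are twice the positive and the negative
    part of \<open>S\<close>; as \<open>B\<close> and \<open>S\<close> commute, their product is B^2
    - S^2 = 0.\<close>
  have DN: "D (N u) = 0" for u
    by (simp add: D_def N_def B.diff S.diff SB B(3))
  have D: "bounded_linear D"
    unfolding D_def by (intro bounded_linear_add B.bounded_linear S.bounded_linear)
  interpret D: bounded_linear D by fact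
  let ?M = "{u. D u = 0}"
  have sub: "subspace ?M" by (auto simp: subspace_def D.add D.scaleR D.zero)
  have cl: "closed ?M" by (intro closed_Collect_eq continuous_intros linear_continuous_on D)
  obtain P where P: "orthogonal_projection P" "\<And>u. P u \<in> ?M" "\<And>u. u \<in> ?M \<Longrightarrow> P u = u"
    "\<And>u v. v \<in> ?M \<Longrightarrow> (u - P u) \<bullet> v = 0"
    "\<And>R u. selfadjoint_operator R \<Longrightarrow> (\<And>v. v \<in> ?M \<Longrightarrow> R v \<in> ?M) \<Longrightarrow> R (P u) = P (R u)"
    by (rule closed_subspace_orthogonal_projection[OF sub cl]) blast
  have 1: "S u \<bullet> u \<le> 0" if "P u = u" for u
  proof -
    have "B u + S u = 0" using P(2)[of u] that by (simp add: D_def)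
    then have "S u = - B u" by (metis add.commute add_eq_0_iff)
    then show ?thesis using B(2)[of u] by simp
  qed
  have 2: "0 < S u \<bullet> u" if "P u = 0" "u \<noteq> 0" for u
  proof -
    \<comment> \<open>The range of \<open>N\<close> lies in the kernel of \<open>D\<close>, so a
      vector orthogonal to that kernel is annihilated by the self-adjoint \<open>N\<close>, that is,
      \<open>B\<close> and \<open>S\<close> agree on it.\<close>
    have "u \<bullet> N v = 0" for v using P(4)[of "N v" u] DN that(1) by simp
    then have "N u \<bullet> v = 0" for v by (simp add: N_def inner_simps sa)
    then have "N u = 0" by (metis inner_eq_zero_iff)
    then have BS: "B u = S u" by (simp add: N_def)
    have "S u \<bullet> u \<noteq> 0"
    proof
      assume "S u \<bullet> u = 0"
      then have "B u = 0" using nonneg_operator_zero[OF B(1,2), of u] BS by metis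
      then have "D u = 0" by (simp add: D_def BS[symmetric])
      then show False using P(3) that by auto
    qed
    then show ?thesis using B(2)[of u] BS by simp
  qed
  have 3: "R (P u) = P (R u)" if R: "selfadjoint_operator R" "\<And>u. R (S u) = S (R u)" for R u
  proof (rule P(5)[OF R(1)])
    interpret R: bounded_linear R using R(1) by (rule selfadjoint_operatorD)
    fix v assume "v \<in> ?M"
    moreover have "D (R v) = R (D v)"
      using R(2) B(4)[OF R.bounded_linear R(2)] by (simp add: D_def R.add)
    ultimately show "R v \<in> ?M" by (simp add: R.zero)
  qed
  show ?thesis by (rule that[OF P(1) 1 2 3])
qed

section \<open>Spectral projections of a self-adjoint operator\<close>

text \<open>For nested projections the squared distance of two images is the difference of their
  squared norms; with this lemma the convergence of bounded monotone numbers yields that of the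
  vectors.\<close>

lemma Cauchy_if_norm_diff_le:
  fixes f :: "nat \<Rightarrow> 'a::real_normed_vector" and g :: "nat \<Rightarrow> real"
  assumes le: "\<And>m n. m \<le> n \<Longrightarrow> (norm (f n - f m))\<^sup>2 \<le> \<bar>g n - g m\<bar>" and g: "Cauchy g"
  shows "Cauchy f"
proof (rule CauchyI')
  fix e :: real assume e: "0 < e"
  then obtain M where M: "\<And>m n. m \<ge> M \<Longrightarrow> n \<ge> M \<Longrightarrow> norm (g m - g n) < e\<^sup>2"
    using CauchyD[OF g, of "e\<^sup>2"] by auto
  have "dist (f m) (f n) < e" if "m \<ge> M" "m < n" for m n
  proof -
    have "(norm (f n - f m))\<^sup>2 < e\<^sup>2" using le[of m n] M[of n m] that by auto
    then have "norm (f n - f m) < e" using e by (simp add: power2_less_imp_less)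
    then show ?thesis by (simp add: dist_norm norm_minus_commute)
  qed
  then show "\<exists>M. \<forall>m\<ge>M. \<forall>n>m. dist (f m) (f n) < e" by blast
qed

lemma orthogonal_projection_simps:
  assumes "orthogonal_projection P"
  shows "P (u + v) = P u + P v" "P (u - v) = P u - P v" "P 0 = 0" "P (P u) = P u"
    "P (r *\<^sub>R u) = r *\<^sub>R P u" "P u \<bullet> v = u \<bullet> P v"
proof -
  interpret bounded_linear P using assms by (simp add: orthogonal_projection_def)
  show "P (u + v) = P u + P v" "P (u - v) = P u - P v" "P 0 = 0" "P (r *\<^sub>R u) = r *\<^sub>R P u"
    by (simp_all add: add diff zero scaleR)
qed (use assms in \<open>auto simp: orthogonal_projection_def\<close>)

lemma orthogonal_projection_tendsto:
  "orthogonal_projection P \<Longrightarrow> f \<longlonglongrightarrow> l \<Longrightarrow> (\<lambda>n. P (f n)) \<longlonglongrightarrow> P l"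
  unfolding orthogonal_projection_def by (metis bounded_linear.tendsto)

lemma orthogonal_projection_norm_diff:
  assumes "orthogonal_projection P" "P (Q u) = P u"
  shows "(norm (Q u - P u))\<^sup>2 = (norm (Q u))\<^sup>2 - (norm (P u))\<^sup>2"
  using orthogonal_projection_norm(2)[OF assms(1), of "Q u"] assms(2) by simp

section \<open>The resolution of the identity of a self-adjoint operator\<close>

text \<open>\<open>P t\<close> plays the role of the spectral projection of \<open>{..t}\<close>.
  Strictness in \<open>above\<close> puts eigenvectors with eigenvalue \<open>t\<close> into the
  range of \<open>P t\<close>, and it drives both monotonicity and right continuity below.\<close>

locale spectral_resolution =
  fixes T :: "'a::{real_inner,complete_space} \<Rightarrow> 'a" and P :: "real \<Rightarrow> 'a \<Rightarrow> 'a"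
  assumes T: "selfadjoint_operator T"
    and P: "\<And>t. orthogonal_projection (P t)"
    and below: "\<And>t u. P t u = u \<Longrightarrow> T u \<bullet> u \<le> t * (u \<bullet> u)"
    and above: "\<And>t u. P t u = 0 \<Longrightarrow> u \<noteq> 0 \<Longrightarrow> t * (u \<bullet> u) < T u \<bullet> u"
    and T_commute: "\<And>t u. T (P t u) = P t (T u)"
    and P_commute: "\<And>s t u. P s (P t u) = P t (P s u)"

text \<open>The commutation clause of the sign projections of T - t is used twice: first with
  \<open>T\<close> itself, then with another projection \<open>P s\<close>, which by the first use
  commutes with \<open>T\<close>.\<close>

lemma spectral_resolution_exists:
  fixes T :: "'a::{real_inner,complete_space} \<Rightarrow> 'a"
  assumes T: "selfadjoint_operator T"
  shows "\<exists>P. spectral_resolution T P"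
proof -
  interpret T: bounded_linear T using T by (rule selfadjoint_operatorD)
  have "\<exists>P. orthogonal_projection P \<and> (\<forall>u. P u = u \<longrightarrow> T u \<bullet> u \<le> t * (u \<bullet> u)) \<and>
      (\<forall>u. P u = 0 \<longrightarrow> u \<noteq> 0 \<longrightarrow> t * (u \<bullet> u) < T u \<bullet> u) \<and>
      (\<forall>R u. selfadjoint_operator R \<longrightarrow> (\<forall>u. R (T u) = T (R u)) \<longrightarrow> R (P u) = P (R u))" for t
  proof -
    define S where "S = (\<lambda>u. T u - t *\<^sub>R u)"
    have "bounded_linear S"
      unfolding S_def by (intro bounded_linear_sub T.bounded_linear bounded_linear_scaleR_right)
    then have S: "selfadjoint_operator S"
      using selfadjoint_operatorD(2)[OF T] by (simp add: selfadjoint_operator_def S_def inner_simps)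
    obtain P where P: "orthogonal_projection P" "\<And>u. P u = u \<Longrightarrow> S u \<bullet> u \<le> 0"
      "\<And>u. P u = 0 \<Longrightarrow> u \<noteq> 0 \<Longrightarrow> 0 < S u \<bullet> u"
      "\<And>R u. selfadjoint_operator R \<Longrightarrow> (\<And>u. R (S u) = S (R u)) \<Longrightarrow> R (P u) = P (R u)"
      by (rule selfadjoint_sign_projection[OF S]) blast
    have "R (P u) = P (R u)" if R: "selfadjoint_operator R" "\<And>u. R (T u) = T (R u)" for R u
    proof (rule P(4)[OF R(1)])
      interpret R: bounded_linear R using R(1) by (rule selfadjoint_operatorD)
      show "R (S u) = S (R u)" for u by (simp add: S_def R.diff R.scaleR R(2))
    qed
    moreover have "T u \<bullet> u \<le> t * (u \<bullet> u)" if "P u = u" for u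
      using P(2)[OF that] by (simp add: S_def inner_diff_left)
    moreover have "t * (u \<bullet> u) < T u \<bullet> u" if "P u = 0" "u \<noteq> 0" for u
      using P(3)[OF that] by (simp add: S_def inner_diff_left)
    ultimately show ?thesis using P(1) by blast
  qed
  then obtain P where P: "\<And>t. orthogonal_projection (P t)"
      "\<And>t u. P t u = u \<Longrightarrow> T u \<bullet> u \<le> t * (u \<bullet> u)"
      "\<And>t u. P t u = 0 \<Longrightarrow> u \<noteq> 0 \<Longrightarrow> t * (u \<bullet> u) < T u \<bullet> u"
      "\<And>t R u. selfadjoint_operator R \<Longrightarrow> \<forall>u. R (T u) = T (R u) \<Longrightarrow> R (P t u) = P t (R u)"
    by metis
  have T_P: "T (P t u) = P t (T u)" for t u by (rule P(4)[OF T]) simp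
  have P_P: "P s (P t u) = P t (P s u)" for s t u
    by (rule P(4)[OF orthogonal_projection_selfadjoint[OF P(1)]]) (simp add: T_P)
  show ?thesis
    by (rule exI[of _ P], unfold_locales) (fact T P(1) P(2) P(3) T_P P_P)+
qed

context spectral_resolution
begin

lemmas P_simps = orthogonal_projection_simps[OF P]

lemma T_linear: "bounded_linear T"
  using T by (rule selfadjoint_operatorD)

text \<open>A nonzero vector in the range of \<open>P s\<close> and the kernel of \<open>P t\<close>
  would have a form at most s and more than t times its squared norm, although s \<le> t.\<close>

lemma P_absorb:
  assumes "s \<le> t"
  shows "P s (P t u) = P s u" "P t (P s u) = P s u"
proof -
  define v where "v = P s u - P t (P s u)"
  have "P s v = v" unfolding v_def P_simps P_commute[of s t] ..
  moreover have "P t v = 0" unfolding v_def P_simps by simp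
  ultimately have "v = 0"
    using below[of s v] above[of t v] mult_right_mono[OF assms, of "v \<bullet> v"] by fastforce
  then show *: "P t (P s u) = P s u" by (simp add: v_def)
  then show "P s (P t u) = P s u" by (simp add: P_commute)
qed

definition F :: "'a \<Rightarrow> real \<Rightarrow> real" where
  "F u t = (norm (P t u))\<^sup>2"

lemma F_diff: "s \<le> t \<Longrightarrow> (norm (P t u - P s u))\<^sup>2 = F u t - F u s"
  unfolding F_def by (rule orthogonal_projection_norm_diff[OF P]) (simp add: P_absorb)

lemma F_mono: "s \<le> t \<Longrightarrow> F u s \<le> F u t"
  using F_diff[of s t u] by (metis diff_ge_0_iff_ge zero_le_power2)

text \<open>Let \<open>w\<close> be the limit of \<open>P t u\<close> as t decreases to a. Then w -
  P a w lies in the range of every \<open>P (X n)\<close>, so its form is at most a times its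
  squared norm, and in the kernel of \<open>P a\<close>, so \<open>above\<close> leaves only
  0.\<close>

lemma F_right_continuous: "continuous (at_right a) (F u)"
  unfolding continuous_within
proof (rule tendsto_at_right_sequentially[of a "a + 1"])
  fix X :: "nat \<Rightarrow> real"
  assume X: "\<And>n. a < X n" "decseq X" "X \<longlonglongrightarrow> a"
  have dec: "decseq (\<lambda>n. F u (X n))"
    using X(2) by (auto simp: decseq_def intro: F_mono)
  have "\<exists>L. (\<lambda>n. F u (X n)) \<longlonglongrightarrow> L"
    by (rule decseq_convergent[OF dec, of 0]) (auto simp: F_def)
  then have cau: "Cauchy (\<lambda>n. F u (X n))" by (auto intro: LIMSEQ_imp_Cauchy)
  have "Cauchy (\<lambda>n. P (X n) u)"
  proof (rule Cauchy_if_norm_diff_le[OF _ cau])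
    fix m n :: nat assume "m \<le> n"
    then have "X n \<le> X m" using X(2) by (simp add: decseqD)
    from F_diff[OF this, of u] show "(norm (P (X n) u - P (X m) u))\<^sup>2 \<le> \<bar>F u (X n) - F u (X m)\<bar>"
      by (simp add: norm_minus_commute)
  qed
  then obtain w where w: "(\<lambda>n. P (X n) u) \<longlonglongrightarrow> w" by (meson Cauchy_convergent convergent_def)
  have Paw: "P a w = P a u"
  proof (rule LIMSEQ_unique[OF orthogonal_projection_tendsto[OF P w]])
    show "(\<lambda>n. P a (P (X n) u)) \<longlonglongrightarrow> P a u"
      using X(1) by (simp add: P_absorb less_imp_le)
  qed
  have PXw: "P (X n) w = w" for n
  proof (rule LIMSEQ_unique[OF orthogonal_projection_tendsto[OF P w]])
    have "P (X n) (P (X m) u) = P (X m) u" if "m \<ge> n" for m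
      using decseqD[OF X(2) that] by (rule P_absorb)
    then have "\<forall>\<^sub>F m in sequentially. P (X m) u = P (X n) (P (X m) u)"
      unfolding eventually_sequentially by (intro exI[of _ n]) simp
    from Lim_transform_eventually[OF w this] show "(\<lambda>m. P (X n) (P (X m) u)) \<longlonglongrightarrow> w" .
  qed
  define v where "v = w - P a w"
  have "P (X n) v = v" for n
    unfolding v_def P_simps P_commute[of _ a] PXw ..
  then have "T v \<bullet> v \<le> X n * (v \<bullet> v)" for n by (rule below)
  then have "T v \<bullet> v \<le> a * (v \<bullet> v)"
    by (intro LIMSEQ_le_const[OF tendsto_mult_right[OF X(3)]]) auto
  moreover have "P a v = 0" unfolding v_def P_simps by simp
  ultimately have "v = 0" using above[of a v] by fastforce
  then have "w = P a u" using Paw by (simp add: v_def)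
  then show "(\<lambda>n. F u (X n)) \<longlonglongrightarrow> F u a"
    unfolding F_def using w by (intro tendsto_intros) simp
qed simp

lemma form_bound: obtains K where "0 < K" "\<And>u. \<bar>T u \<bullet> u\<bar> \<le> K * (u \<bullet> u)"
proof -
  obtain K where K: "0 < K" "\<And>u. norm (T u) \<le> norm u * K"
    using bounded_linear.pos_bounded[OF T_linear] by blast
  have "\<bar>T u \<bullet> u\<bar> \<le> K * (u \<bullet> u)" for u
  proof -
    have "\<bar>T u \<bullet> u\<bar> \<le> norm (T u) * norm u" by (rule Cauchy_Schwarz_ineq2)
    also have "\<dots> \<le> (norm u * K) * norm u" by (intro mult_right_mono K(2)) simp
    also have "\<dots> = K * (u \<bullet> u)" by (simp add: power2_norm_eq_inner[symmetric] power2_eq_square)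
    finally show ?thesis .
  qed
  with K(1) show ?thesis by (rule that)
qed

lemma support:
  obtains K where "0 < K" "\<And>t u. t < - K \<Longrightarrow> P t u = 0" "\<And>t u. K \<le> t \<Longrightarrow> P t u = u"
proof -
  obtain K where K: "0 < K" "\<And>u. \<bar>T u \<bullet> u\<bar> \<le> K * (u \<bullet> u)" by (rule form_bound) blast
  have 1: "P t u = 0" if "t < - K" for t u
  proof (rule ccontr)
    assume "P t u \<noteq> 0"
    then have "t * (P t u \<bullet> P t u) < - K * (P t u \<bullet> P t u)"
      using that by (intro mult_strict_right_mono) auto
    moreover have "T (P t u) \<bullet> P t u \<le> t * (P t u \<bullet> P t u)" by (rule below) (simp add: P_simps)
    ultimately show False using K(2)[of "P t u"] by linarith
  qed
  have 2: "P t u = u" if "K \<le> t" for t u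
  proof (rule ccontr)
    define v where "v = u - P t u"
    assume "P t u \<noteq> u"
    then have "v \<noteq> 0" by (simp add: v_def)
    moreover have "P t v = 0" by (simp add: v_def P_simps)
    ultimately have "t * (v \<bullet> v) < T v \<bullet> v" using above by blast
    moreover have "K * (v \<bullet> v) \<le> t * (v \<bullet> v)" using that by (intro mult_right_mono) auto
    ultimately show False using K(2)[of v] by linarith
  qed
  show ?thesis by (rule that[OF K(1) 1 2])
qed

section \<open>Stieltjes measures of the resolution\<close>

text \<open>Intended to give a Borel set A the mass of the squared norm of the still missing
  spectral projection of A applied to \<open>u\<close>.\<close>

definition \<mu> :: "'a \<Rightarrow> real measure" where
  "\<mu> u = interval_measure (F u)"

lemma sets_mu [simp, measurable_cong]: "sets (\<mu> u) = sets borel" and space_mu [simp]: "space (\<mu> u) = UNIV"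
  by (simp_all add: \<mu>_def)

lemma emeasure_mu_Ioc: "a \<le> b \<Longrightarrow> emeasure (\<mu> u) {a<..b} = ennreal (F u b - F u a)"
  unfolding \<mu>_def by (intro emeasure_interval_measure_Ioc F_mono F_right_continuous)

text \<open>The masses are known on bounded half-open intervals, so both half-lines are exhausted by
  such intervals, all of mass 0.\<close>

lemma emeasure_mu_support:
  obtains K where "0 < K" "\<And>t u. t < - K \<Longrightarrow> P t u = 0" "\<And>t u. K \<le> t \<Longrightarrow> P t u = u"
    "\<And>t u. t < - K \<Longrightarrow> emeasure (\<mu> u) {..t} = 0" "\<And>u. emeasure (\<mu> u) {K<..} = 0"
proof -
  obtain K where K: "0 < K" "\<And>t u. t < - K \<Longrightarrow> P t u = 0" "\<And>t u. K \<le> t \<Longrightarrow> P t u = u"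
    by (rule support) blast
  have 1: "emeasure (\<mu> u) {..t} = 0" if t: "t < - K" for t u
  proof -
    have "emeasure (\<mu> u) (\<Union>n::nat. {t - real n<..t}) = 0"
    proof (rule emeasure_UN_eq_0)
      show "emeasure (\<mu> u) {t - real n<..t} = 0" for n
        using t by (simp add: emeasure_mu_Ioc F_def K(2))
    qed auto
    also have "(\<Union>n::nat. {t - real n<..t}) = {..t}"
    proof (intro equalityI subsetI)
      fix s assume "s \<in> {..t}"
      moreover obtain n where "t - s < real n" using reals_Archimedean2 by blast
      ultimately show "s \<in> (\<Union>n::nat. {t - real n<..t})" by (auto intro!: exI[of _ n])
    qed auto
    finally show ?thesis .
  qed
  have 2: "emeasure (\<mu> u) {K<..} = 0" for u
  proof -
    have "emeasure (\<mu> u) (\<Union>n::nat. {K<..K + real n}) = 0"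
    proof (rule emeasure_UN_eq_0)
      show "emeasure (\<mu> u) {K<..K + real n} = 0" for n
        by (simp add: emeasure_mu_Ioc F_def K(3))
    qed auto
    also have "(\<Union>n::nat. {K<..K + real n}) = {K<..}"
    proof (intro equalityI subsetI)
      fix s assume "s \<in> {K<..}"
      moreover obtain n where "s - K < real n" using reals_Archimedean2 by blast
      ultimately show "s \<in> (\<Union>n::nat. {K<..K + real n})" by (auto intro!: exI[of _ n])
    qed auto
    finally show ?thesis .
  qed
  show ?thesis by (rule that[OF K 1 2])
qed

lemma emeasure_mu_atMost: "emeasure (\<mu> u) {..t} = ennreal (F u t)"
proof -
  obtain K where K: "\<And>t u. t < - K \<Longrightarrow> P t u = 0" "\<And>t u. t < - K \<Longrightarrow> emeasure (\<mu> u) {..t} = 0"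
    by (rule emeasure_mu_support) blast
  define s where "s = min t (- K - 1)"
  have s: "s \<le> t" "s < - K" by (auto simp: s_def)
  have "emeasure (\<mu> u) {..t} = emeasure (\<mu> u) ({..s} \<union> {s<..t})"
    using s(1) by (intro arg_cong[where f = "emeasure _"]) auto
  also have "\<dots> = emeasure (\<mu> u) {..s} + emeasure (\<mu> u) {s<..t}"
    by (intro plus_emeasure[symmetric]) auto
  also have "\<dots> = ennreal (F u t)"
    using s by (simp add: K emeasure_mu_Ioc F_def)
  finally show ?thesis .
qed

lemma emeasure_mu_UNIV: "emeasure (\<mu> u) UNIV = ennreal ((norm u)\<^sup>2)"
proof -
  obtain K where K: "\<And>t u. K \<le> t \<Longrightarrow> P t u = u" "\<And>u. emeasure (\<mu> u) {K<..} = 0"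
    by (rule emeasure_mu_support) blast
  have "emeasure (\<mu> u) UNIV = emeasure (\<mu> u) ({..K} \<union> {K<..})"
    by (intro arg_cong[where f = "emeasure _"]) auto
  also have "\<dots> = emeasure (\<mu> u) {..K} + emeasure (\<mu> u) {K<..}"
    by (intro plus_emeasure[symmetric]) auto
  also have "\<dots> = ennreal ((norm u)\<^sup>2)"
    by (simp add: K emeasure_mu_atMost F_def)
  finally show ?thesis .
qed

end

section \<open>From scalar measures to a projection-valued measure\<close>

lemma orthogonal_projection_add:
  assumes P: "orthogonal_projection P" and Q: "orthogonal_projection Q"
    and PQ: "\<And>u. P (Q u) = 0" "\<And>u. Q (P u) = 0"
  shows "orthogonal_projection (\<lambda>u. P u + Q u)"
    and "(norm (P u + Q u))\<^sup>2 = (norm (P u))\<^sup>2 + (norm (Q u))\<^sup>2"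
proof -
  note s = orthogonal_projection_simps[OF P] orthogonal_projection_simps[OF Q]
  show "orthogonal_projection (\<lambda>u. P u + Q u)"
    by (rule orthogonal_projectionI)
      (auto intro!: linearI simp: s(1-5,7-11) PQ scaleR_add_right inner_add_left inner_add_right s(6,12))
  have "P u \<bullet> Q u = 0" unfolding s(6) PQ by simp
  then show "(norm (P u + Q u))\<^sup>2 = (norm (P u))\<^sup>2 + (norm (Q u))\<^sup>2"
    by (simp add: power2_norm_eq_inner inner_simps inner_commute)
qed

text \<open>The partial sums are nested projections whose squared norms obey Bessel's inequality, so
  they converge pointwise; \<open>S n (R u) = S n u\<close> makes the limit idempotent. It serves
  countable unions here and the countable additivity of scalar spectral measures later.\<close>

lemma orthogonal_projection_sums:
  fixes Q :: "nat \<Rightarrow> 'a::{real_inner,complete_space} \<Rightarrow> 'a"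
  assumes Q: "\<And>n. orthogonal_projection (Q n)"
    and orth: "\<And>i j u. i \<noteq> j \<Longrightarrow> Q i (Q j u) = 0"
  shows "\<exists>R. orthogonal_projection R \<and> (\<forall>u. (\<lambda>n. Q n u) sums R u) \<and>
    (\<forall>u. (\<lambda>n. (norm (Q n u))\<^sup>2) sums (norm (R u))\<^sup>2)"
proof -
  note Qs = orthogonal_projection_simps[OF Q]
  define S where "S = (\<lambda>n u. \<Sum>i<n. Q i u)"
  have S_Suc: "S (Suc n) u = S n u + Q n u" for n u by (simp add: S_def)
  have QS: "Q m (S n u) = (if m < n then Q m u else 0)" for m n u
    by (induction n) (auto simp: S_def Qs orth less_Suc_eq)
  have SQ: "S n (Q m u) = (if m < n then Q m u else 0)" for m n u
    by (induction n) (auto simp: S_def Qs orth less_Suc_eq)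
  have S: "orthogonal_projection (S n) \<and> (\<forall>u. (norm (S n u))\<^sup>2 = (\<Sum>i<n. (norm (Q i u))\<^sup>2))" for n
  proof (induction n)
    case 0
    then show ?case by (auto simp: S_def orthogonal_projection_def)
  next
    case (Suc n)
    have Sn: "orthogonal_projection (S n)" "\<And>u. (norm (S n u))\<^sup>2 = (\<Sum>i<n. (norm (Q i u))\<^sup>2)"
      using Suc by auto
    have SQ0: "S n (Q n u) = 0" "Q n (S n u) = 0" for u by (simp_all add: SQ QS)
    note add = orthogonal_projection_add[OF Sn(1) Q SQ0]
    have "S (Suc n) = (\<lambda>u. S n u + Q n u)" by (simp add: S_Suc fun_eq_iff)
    then show ?case using add by (simp add: Sn(2))
  qed
  have SS: "S n (S m u) = S n u" if "n \<le> m" for n m u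
  proof -
    have "S n (S m u) = (\<Sum>i<n. Q i (S m u))" by (simp add: S_def)
    also have "\<dots> = (\<Sum>i<n. Q i u)" by (rule sum.cong) (use that QS in auto)
    also have "\<dots> = S n u" by (simp add: S_def)
    finally show ?thesis .
  qed
  have summ: "summable (\<lambda>n. (norm (Q n u))\<^sup>2)" for u
  proof (rule summableI_nonneg_bounded)
    show "(\<Sum>i<n. (norm (Q i u))\<^sup>2) \<le> (norm u)\<^sup>2" for n
      using S[of n] power_mono[OF orthogonal_projection_norm(3)[of "S n" u], of 2] by simp
  qed simp
  have "Cauchy (\<lambda>n. S n u)" for u
  proof (rule Cauchy_if_norm_diff_le)
    have "(\<lambda>n. \<Sum>i<n. (norm (Q i u))\<^sup>2) = (\<lambda>n. (norm (S n u))\<^sup>2)" using S by auto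
    then show "Cauchy (\<lambda>n. (norm (S n u))\<^sup>2)"
      using LIMSEQ_imp_Cauchy[OF summable_LIMSEQ[OF summ[of u]]] by simp
    show "(norm (S n u - S m u))\<^sup>2 \<le> \<bar>(norm (S n u))\<^sup>2 - (norm (S m u))\<^sup>2\<bar>" if "m \<le> n" for m n
      using orthogonal_projection_norm_diff[of "S m" "S n" u] S SS[OF that] by auto
  qed
  then have "\<forall>u. \<exists>l. (\<lambda>n. S n u) \<longlonglongrightarrow> l" by (meson Cauchy_convergent convergent_def)
  then obtain R where R: "\<And>u. (\<lambda>n. S n u) \<longlonglongrightarrow> R u" by metis
  note Ss = orthogonal_projection_simps(1,5,6)[OF conjunct1[OF S]]
  have 1: "(\<lambda>n. Q n u) sums R u" for u using R[of u] by (simp add: sums_def S_def)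
  have SR: "S n (R u) = S n u" for n u
  proof (rule LIMSEQ_unique)
    show "(\<lambda>m. S n (S m u)) \<longlonglongrightarrow> S n (R u)"
      by (rule orthogonal_projection_tendsto[OF conjunct1[OF S] R])
    have "\<forall>\<^sub>F m in sequentially. S n u = S n (S m u)"
      unfolding eventually_sequentially by (intro exI[of _ n]) (simp add: SS)
    from Lim_transform_eventually[OF tendsto_const this]
    show "(\<lambda>m. S n (S m u)) \<longlonglongrightarrow> S n u" .
  qed
  have 2: "orthogonal_projection R"
  proof (rule orthogonal_projectionI)
    show "linear R"
    proof
      show "R (a + b) = R a + R b" for a b
        by (rule LIMSEQ_unique[OF R]) (simp add: Ss(1) tendsto_add R)
      show "R (r *\<^sub>R a) = r *\<^sub>R R a" for r a
        by (rule LIMSEQ_unique[OF R]) (simp add: Ss(2) tendsto_scaleR R)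
    qed
    show "R (R u) = R u" for u
      using R[of "R u"] unfolding SR by (rule LIMSEQ_unique[OF _ R])
    show "R u \<bullet> v = u \<bullet> R v" for u v
    proof (rule LIMSEQ_unique)
      show "(\<lambda>n. S n u \<bullet> v) \<longlonglongrightarrow> R u \<bullet> v" by (intro tendsto_intros R)
      show "(\<lambda>n. S n u \<bullet> v) \<longlonglongrightarrow> u \<bullet> R v" unfolding Ss(3) by (intro tendsto_intros R)
    qed
  qed
  have 3: "(\<lambda>n. (norm (Q n u))\<^sup>2) sums (norm (R u))\<^sup>2" for u
  proof -
    have "(\<lambda>n. (norm (S n u))\<^sup>2) \<longlonglongrightarrow> (norm (R u))\<^sup>2" by (intro tendsto_intros R)
    moreover have "(\<lambda>n. \<Sum>i<n. (norm (Q i u))\<^sup>2) = (\<lambda>n. (norm (S n u))\<^sup>2)" using S by auto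
    ultimately show ?thesis by (simp add: sums_def)
  qed
  show ?thesis by (intro exI[of _ R] conjI allI 1 2 3)
qed

text \<open>A projection fixes every vector whose norm it keeps. Hence \<open>Q\<close> fixes the
  range of \<open>P\<close>, and it annihilates the kernel of \<open>P\<close>.\<close>

lemma orthogonal_projection_eqI:
  assumes P: "orthogonal_projection P" and Q: "orthogonal_projection Q"
    and eq: "\<And>u. norm (P u) = norm (Q u)"
  shows "P u = Q u"
proof -
  note s = orthogonal_projection_simps[OF P] orthogonal_projection_simps[OF Q]
  have "norm (Q (P u)) = norm (P u)" using eq[of "P u"] s(4) by simp
  then have "Q (P u) = P u" using orthogonal_projection_norm(2)[OF Q, of "P u"] by simp
  moreover have "norm (Q (u - P u)) = 0" using eq[of "u - P u"] s(2,4) by simp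
  ultimately show ?thesis by (simp add: s(8))
qed

text \<open>The scalar measures come from projections on the half-lines \<open>{..t}\<close> only, a
  generator of the Borel sets closed under intersection; this is extended to all Borel sets.\<close>

locale projection_generating_measures =
  fixes \<mu> :: "'a::{real_inner,complete_space} \<Rightarrow> real measure"
  assumes sets_mu': "\<And>u. sets (\<mu> u) = sets borel"
    and emeasure_UNIV: "\<And>u. emeasure (\<mu> u) UNIV = ennreal ((norm u)\<^sup>2)"
    and generators: "\<And>t. \<exists>Q. orthogonal_projection Q \<and> (\<forall>u. measure (\<mu> u) {..t} = (norm (Q u))\<^sup>2)"
begin

lemma finite_mu: "finite_measure (\<mu> u)"
proof (rule finite_measureI)
  have "space (\<mu> u) = UNIV" using sets_eq_imp_space_eq[OF sets_mu'[of u]] by simp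
  then show "emeasure (\<mu> u) (space (\<mu> u)) \<noteq> \<infinity>" using emeasure_UNIV[of u] by simp
qed

lemma space_mu': "space (\<mu> u) = UNIV"
  using sets_eq_imp_space_eq[OF sets_mu'[of u]] by simp

lemma measure_UNIV: "measure (\<mu> u) UNIV = (norm u)\<^sup>2"
  by (simp add: measure_def emeasure_UNIV)

lemma measure_Un:
  "A \<in> sets borel \<Longrightarrow> B \<in> sets borel \<Longrightarrow> A \<inter> B = {} \<Longrightarrow>
    measure (\<mu> u) (A \<union> B) = measure (\<mu> u) A + measure (\<mu> u) B"
  by (intro finite_measure.finite_measure_Union[OF finite_mu]) (auto simp: sets_mu')

definition represents :: "real set \<Rightarrow> ('a \<Rightarrow> 'a) \<Rightarrow> bool" where
  "represents A Q \<longleftrightarrow> orthogonal_projection Q \<and> (\<forall>u. measure (\<mu> u) A = (norm (Q u))\<^sup>2)"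

lemma represents_unique:
  assumes "represents A P" "represents A Q"
  shows "P u = Q u"
proof (rule orthogonal_projection_eqI[of P Q])
  fix u show "norm (P u) = norm (Q u)"
    using assms unfolding represents_def by (metis norm_ge_zero power2_eq_imp_eq)
qed (use assms in \<open>auto simp: represents_def\<close>)

text \<open>The vector \<open>Q u\<close> has its whole mass, the squared norm, in \<open>B\<close>,
  so nothing is left for a disjoint set.\<close>

lemma represents_disjoint:
  assumes "represents A P" "represents B Q" "A \<in> sets borel" "B \<in> sets borel" "A \<inter> B = {}"
  shows "P (Q u) = 0"
proof -
  have Q: "orthogonal_projection Q" using assms by (simp add: represents_def)
  have "measure (\<mu> (Q u)) (A \<union> B) \<le> measure (\<mu> (Q u)) (space (\<mu> (Q u)))"
    by (rule finite_measure.bounded_measure[OF finite_mu])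
  then have "(norm (P (Q u)))\<^sup>2 + (norm (Q (Q u)))\<^sup>2 \<le> (norm (Q u))\<^sup>2"
    using assms by (simp add: measure_Un represents_def space_mu' measure_UNIV)
  then show ?thesis by (simp add: orthogonal_projection_simps[OF Q])
qed

lemma represents_Un:
  assumes "represents A P" "represents B Q" "A \<in> sets borel" "B \<in> sets borel" "A \<inter> B = {}"
  shows "represents (A \<union> B) (\<lambda>u. P u + Q u)"
proof -
  have "orthogonal_projection P" "orthogonal_projection Q" using assms by (auto simp: represents_def)
  moreover have "P (Q u) = 0" "Q (P u) = 0" for u
    using represents_disjoint assms by (auto simp: Int_commute)
  ultimately show ?thesis
    using assms orthogonal_projection_add[of P Q] by (auto simp: represents_def measure_Un)
qed

lemma represents_UN:
  fixes A :: "nat \<Rightarrow> real set"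
  assumes A: "range A \<subseteq> sets borel" "disjoint_family A" and Q: "\<And>n. represents (A n) (Q n)"
  obtains R where "represents (\<Union>n. A n) R" "\<And>u. (\<lambda>n. Q n u) sums R u"
proof -
  have Q': "\<And>n. orthogonal_projection (Q n)" using Q by (simp add: represents_def)
  have orth: "Q i (Q j u) = 0" if "i \<noteq> j" for i j u
    by (rule represents_disjoint[OF Q Q]) (use that A in \<open>auto simp: disjoint_family_on_def\<close>)
  obtain R where R: "orthogonal_projection R" "\<And>u. (\<lambda>n. Q n u) sums R u"
    "\<And>u. (\<lambda>n. (norm (Q n u))\<^sup>2) sums (norm (R u))\<^sup>2"
    using orthogonal_projection_sums[of Q, OF Q' orth] by blast
  have "measure (\<mu> u) (\<Union>n. A n) = (norm (R u))\<^sup>2" for u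
  proof -
    have "(\<lambda>n. measure (\<mu> u) (A n)) sums measure (\<mu> u) (\<Union>n. A n)"
      by (rule finite_measure.finite_measure_UNION[OF finite_mu]) (use A in \<open>auto simp: sets_mu'\<close>)
    moreover have "(\<lambda>n. measure (\<mu> u) (A n)) = (\<lambda>n. (norm (Q n u))\<^sup>2)"
      using Q by (auto simp: represents_def)
    ultimately show ?thesis using R(3)[of u] sums_unique2 by fastforce
  qed
  with R show ?thesis using that by (auto simp: represents_def)
qed

lemma represents_Compl:
  assumes "represents A P" "A \<in> sets borel"
  shows "represents (UNIV - A) (\<lambda>u. u - P u)"
proof -
  have P: "orthogonal_projection P" using assms by (simp add: represents_def)
  note s = orthogonal_projection_simps[OF P]
  have "orthogonal_projection (\<lambda>u. u - P u)"
    by (rule orthogonal_projectionI)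
      (auto intro!: linearI simp: s(1-5) scaleR_diff_right inner_diff_left inner_diff_right s(6))
  moreover have "measure (\<mu> u) (UNIV - A) = (norm (u - P u))\<^sup>2" for u
    using measure_Un[of A "UNIV - A" u] assms orthogonal_projection_norm(2)[OF P, of u]
    by (simp add: measure_UNIV represents_def)
  ultimately show ?thesis by (simp add: represents_def)
qed

text \<open>Disjointness is what makes two representing projections orthogonal and their sum a
  projection; therefore the induction over the Borel sets goes through complements and disjoint
  unions.\<close>

lemma represents_exists:
  assumes "A \<in> sets borel"
  shows "\<exists>Q. represents A Q"
proof -
  have borel: "sets (borel :: real measure) = sigma_sets UNIV (range (\<lambda>a. {..a}))"
    unfolding borel_eq_atMost by (rule sets_measure_of) auto
  have "Int_stable (range (\<lambda>a::real. {..a}))"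
    by (auto simp: Int_stable_def)
  moreover have "range (\<lambda>a::real. {..a}) \<subseteq> Pow UNIV" by auto
  moreover have "A \<in> sigma_sets UNIV (range (\<lambda>a. {..a}))" using assms borel by simp
  ultimately show ?thesis
  proof (induction rule: sigma_sets_induct_disjoint)
    case (basic A)
    then show ?case using generators by (auto simp: represents_def)
  next
    case empty
    have "represents {} (\<lambda>u. 0)" by (simp add: represents_def orthogonal_projection_def)
    then show ?case by blast
  next
    case (compl A)
    then show ?case using represents_Compl borel by blast
  next
    case (union A)
    then obtain Q where "\<And>n. represents (A n) (Q n)" by metis
    with union represents_UN[of A Q] show ?case using borel by metis
  qed
qed

definition E :: "real set \<Rightarrow> 'a \<Rightarrow> 'a" where
  "E A = (SOME Q. represents A Q)"

lemma represents_E: "A \<in> sets borel \<Longrightarrow> represents A (E A)"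
  unfolding E_def by (rule someI_ex[OF represents_exists])

lemma measure_E: "A \<in> sets borel \<Longrightarrow> measure (\<mu> u) A = (norm (E A u))\<^sup>2"
  using represents_E by (simp add: represents_def)

text \<open>Multiplicativity follows from additivity: \<open>A\<close> and \<open>B\<close> are
  split along their intersection, and the differences contribute nothing by disjointness.\<close>

lemma E_Int:
  assumes A: "A \<in> sets borel" and B: "B \<in> sets borel"
  shows "E (A \<inter> B) u = E A (E B u)"
proof -
  have AB: "A \<inter> B \<in> sets borel" "A - B \<in> sets borel" "B - A \<in> sets borel" using A B by auto
  note rep = AB[THEN represents_E]
  have 1: "E A v = E (A \<inter> B) v + E (A - B) v" for v
  proof (rule represents_unique[OF represents_E[OF A]])
    show "represents A (\<lambda>v. E (A \<inter> B) v + E (A - B) v)"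
      using represents_Un[OF rep(1,2) AB(1,2)] by (simp add: Int_Diff_disjoint Int_Diff_Un)
  qed
  have 2: "E B v = E (A \<inter> B) v + E (B - A) v" for v
  proof (rule represents_unique[OF represents_E[OF B]])
    have "A \<inter> B \<inter> (B - A) = {}" "A \<inter> B \<union> (B - A) = B" by auto
    then show "represents B (\<lambda>v. E (A \<inter> B) v + E (B - A) v)"
      using represents_Un[OF rep(1,3) AB(1,3)] by simp
  qed
  have "E (A - B) (E B u) = 0"
    by (rule represents_disjoint[OF rep(2) represents_E[OF B] AB(2) B]) auto
  moreover have "E (A \<inter> B) (E (B - A) u) = 0"
    by (rule represents_disjoint[OF rep(1,3) AB(1,3)]) auto
  moreover have "orthogonal_projection (E (A \<inter> B))" using rep(1) by (simp add: represents_def)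
  ultimately show ?thesis
    by (simp add: 1[of "E B u"]) (simp add: 2 orthogonal_projection_simps)
qed

lemma projection_valued_measure_E: "projection_valued_measure E"
  unfolding projection_valued_measure_def
proof (intro conjI allI ballI impI)
  show "orthogonal_projection (E A)" if "A \<in> sets borel" for A
    using represents_E[OF that] by (simp add: represents_def)
  show "E UNIV u = u" for u
  proof (rule represents_unique[OF represents_E])
    show "represents UNIV (\<lambda>u. u)"
      by (simp add: represents_def measure_UNIV orthogonal_projection_def)
  qed simp
  show "E (A \<inter> B) u = E A (E B u)" if "A \<in> sets borel" "B \<in> sets borel" for A B u
    by (rule E_Int[OF that])
  fix F :: "nat \<Rightarrow> real set" and u
  assume F: "range F \<subseteq> sets borel" "disjoint_family F"
  have "represents (F n) (E (F n))" for n using F(1) by (intro represents_E) auto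
  from represents_UN[OF F this]
  obtain R where R: "represents (\<Union>n. F n) R" "\<And>u. (\<lambda>n. E (F n) u) sums R u"
    by blast
  have "(\<Union>n. F n) \<in> sets borel" using F(1) by auto
  from represents_unique[OF represents_E[OF this] R(1)]
  show "(\<lambda>n. E (F n) u) sums E (\<Union>n. F n) u" using R(2) by simp
qed

lemma scalar_spectral_measure_E: "scalar_spectral_measure E u = \<mu> u"
proof (rule measure_eqI)
  have "scalar_spectral_measure E u = measure_of UNIV (sets (\<mu> u)) (emeasure (\<mu> u))"
    unfolding scalar_spectral_measure_def sets_mu'
  proof (rule measure_of_eq)
    show "ennreal ((norm (E A u))\<^sup>2) = emeasure (\<mu> u) A" if "A \<in> sigma_sets UNIV (sets borel)" for A
    proof -
      have "A \<in> sets borel" using that sets.sigma_sets_eq[of "borel :: real measure"] by simp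
      then show ?thesis
        using finite_measure.emeasure_eq_measure[OF finite_mu, of u A] by (simp add: measure_E)
    qed
  qed simp
  also have "\<dots> = \<mu> u" using measure_of_of_measure[of "\<mu> u"] by (simp add: space_mu')
  finally have *: "scalar_spectral_measure E u = \<mu> u" .
  then show "sets (scalar_spectral_measure E u) = sets (\<mu> u)"
    "emeasure (scalar_spectral_measure E u) A = emeasure (\<mu> u) A" for A by auto
qed

end

section \<open>Existence and basic calculus of the spectral measure\<close>

context spectral_resolution
begin

lemma finite_measure_mu: "finite_measure (\<mu> u)"
  by (rule finite_measureI) (simp add: emeasure_mu_UNIV)

lemma measure_mu_Ioc: "a \<le> b \<Longrightarrow> measure (\<mu> u) {a<..b} = F u b - F u a"
  by (simp add: measure_def emeasure_mu_Ioc F_mono)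

lemma integral_mu_Ioc_bounds:
  assumes "a \<le> b"
  shows "integrable (\<mu> u) (\<lambda>t. indicator {a<..b} t * t)"
    and "a * (F u b - F u a) \<le> (\<integral>t. indicator {a<..b} t * t \<partial>\<mu> u)"
    and "(\<integral>t. indicator {a<..b} t * t \<partial>\<mu> u) \<le> b * (F u b - F u a)"
proof -
  interpret finite_measure "\<mu> u" by (rule finite_measure_mu)
  have I: "integrable (\<mu> u) (\<lambda>t. indicator {a<..b} t * c)" for c :: real
    by (rule integrable_const_bound[where B = "\<bar>c\<bar>"]) (auto simp: indicator_def)
  have c: "(\<integral>t. indicator {a<..b} t * c \<partial>\<mu> u) = c * (F u b - F u a)" for c :: real
    using measure_mu_Ioc[OF assms, of u] by simp
  show i: "integrable (\<mu> u) (\<lambda>t. indicator {a<..b} t * t)"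
    by (rule integrable_const_bound[where B = "\<bar>a\<bar> + \<bar>b\<bar>"]) (auto simp: indicator_def)
  show "a * (F u b - F u a) \<le> (\<integral>t. indicator {a<..b} t * t \<partial>\<mu> u)"
    unfolding c[symmetric] by (intro integral_mono I i) (auto simp: indicator_def)
  show "(\<integral>t. indicator {a<..b} t * t \<partial>\<mu> u) \<le> b * (F u b - F u a)"
    unfolding c[symmetric] by (intro integral_mono I i) (auto simp: indicator_def)
qed

text \<open>The increment \<open>w\<close> lies in the range of \<open>P b\<close> and in the kernel
  of \<open>P a\<close>, which squeezes its form; commutation with \<open>T\<close> removes the
  cross terms.\<close>

lemma form_Ioc_bounds:
  fixes u
  assumes "a \<le> b"
  defines "G \<equiv> \<lambda>t. T (P t u) \<bullet> P t u"
  shows "a * (F u b - F u a) \<le> G b - G a" and "G b - G a \<le> b * (F u b - F u a)"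
proof -
  interpret T: bounded_linear T by (rule T_linear)
  define w where "w = P b u - P a u"
  have w: "P b w = w" "P a w = 0"
    by (simp_all add: w_def P_simps P_absorb[OF assms(1)])
  have Tw: "T (P a u) \<bullet> w = 0" "T w \<bullet> P a u = 0"
    by (simp_all only: T_commute P_simps(6) w inner_zero_right)
      (simp only: P_simps(6)[symmetric] T_commute[symmetric] w T.zero inner_zero_left)
  have "G b = T (P a u + w) \<bullet> (P a u + w)" by (simp add: G_def w_def)
  also have "\<dots> = G a + T w \<bullet> w"
    using Tw by (simp add: G_def T.add inner_simps)
  finally have G: "G b - G a = T w \<bullet> w" by simp
  have ww: "w \<bullet> w = F u b - F u a"
    using F_diff[OF assms(1), of u] by (simp add: w_def power2_norm_eq_inner)
  show "a * (F u b - F u a) \<le> G b - G a"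
    using above[OF w(2)] unfolding G ww[symmetric] by (cases "w = 0") (auto simp: T.zero)
  show "G b - G a \<le> b * (F u b - F u a)"
    unfolding G ww[symmetric] by (rule below[OF w(1)])
qed

text \<open>Both sides change by at most the mesh size times the mass of the cell when one
  passes to the next cell of a partition of the support.\<close>

lemma form_eq_integral: "T u \<bullet> u = (\<integral>t. t \<partial>\<mu> u)"
proof -
  interpret T: bounded_linear T by (rule T_linear)
  interpret finite_measure "\<mu> u" by (rule finite_measure_mu)
  obtain K where K: "0 < K" "\<And>t u. t < - K \<Longrightarrow> P t u = 0" "\<And>t u. K \<le> t \<Longrightarrow> P t u = u"
    "\<And>t u. t < - K \<Longrightarrow> emeasure (\<mu> u) {..t} = 0" "\<And>u. emeasure (\<mu> u) {K<..} = 0"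
    by (rule emeasure_mu_support) blast
  \<comment> \<open>Strictly below the support, so that both \<open>P s\<close> and the mass of
    \<open>{..s}\<close> vanish.\<close>
  define s where "s = - K - 1"
  define G where "G = (\<lambda>t. T (P t u) \<bullet> P t u)"
  define I where "I = (\<lambda>c. \<integral>t. indicator {s<..c} t * t \<partial>\<mu> u)"
  have step: "\<bar>(G b - I b) - (G a - I a)\<bar> \<le> (b - a) * (F u b - F u a)" if "s \<le> a" "a \<le> b" for a b
  proof -
    have "I b = (\<integral>t. indicator {s<..a} t * t + indicator {a<..b} t * t \<partial>\<mu> u)"
      unfolding I_def using that by (intro Bochner_Integration.integral_cong) (auto simp: indicator_def)
    also have "\<dots> = I a + (\<integral>t. indicator {a<..b} t * t \<partial>\<mu> u)"
      unfolding I_def by (intro Bochner_Integration.integral_add integral_mu_Ioc_bounds that)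
    finally have "I b - I a = (\<integral>t. indicator {a<..b} t * t \<partial>\<mu> u)" by simp
    then show ?thesis
      using form_Ioc_bounds[OF that(2), of u] integral_mu_Ioc_bounds(2,3)[OF that(2), of u]
      unfolding G_def abs_le_iff left_diff_distrib by linarith
  qed
  have grid: "\<bar>G (s + real n * e) - I (s + real n * e)\<bar> \<le> e * F u (s + real n * e)" if "0 < e" for n e
  proof (induction n)
    case 0
    have "P s u = 0" by (rule K(2)) (simp add: s_def)
    then show ?case by (simp add: G_def I_def F_def T.zero)
  next
    case (Suc n)
    have "s + real (Suc n) * e - (s + real n * e) = e" by (simp add: algebra_simps)
    moreover have "s \<le> s + real n * e" "s + real n * e \<le> s + real (Suc n) * e"
      using that by (auto simp: algebra_simps)
    ultimately show ?case
      using step[of "s + real n * e" "s + real (Suc n) * e"] Suc by (simp add: right_diff_distrib)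
  qed
  have G: "G c = T u \<bullet> u" if "K \<le> c" for c by (simp add: G_def K(3)[OF that])
  have I: "I c = (\<integral>t. t \<partial>\<mu> u)" if "K \<le> c" for c
    unfolding I_def
  proof (rule integral_cong_AE)
    have "emeasure (\<mu> u) {..s} = 0" by (rule K(4)) (simp add: s_def)
    then have "AE t in \<mu> u. t \<notin> {..s}" by (intro AE_not_in) (auto simp: null_sets_def)
    moreover have "AE t in \<mu> u. t \<notin> {K<..}" using K(5) by (intro AE_not_in) (auto simp: null_sets_def)
    ultimately show "AE t in \<mu> u. indicator {s<..c} t * t = t"
      by eventually_elim (use that in auto)
  qed auto
  have bnd: "\<bar>T u \<bullet> u - (\<integral>t. t \<partial>\<mu> u)\<bar> \<le> e * (norm u)\<^sup>2" if e: "0 < e" for e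
  proof -
    obtain n where "(K - s) / e < real n" using reals_Archimedean2 by blast
    then have "K \<le> s + real n * e" using e by (simp add: field_simps)
    from G[OF this] I[OF this] K(3)[OF this] show ?thesis
      using grid[OF e, of n] by (simp add: F_def)
  qed
  have "\<bar>T u \<bullet> u - (\<integral>t. t \<partial>\<mu> u)\<bar> \<le> 0"
  proof (rule field_le_epsilon)
    fix e :: real assume e: "0 < e"
    have N: "0 < (norm u)\<^sup>2 + 1" by (intro add_nonneg_pos) auto
    have "\<bar>T u \<bullet> u - (\<integral>t. t \<partial>\<mu> u)\<bar> \<le> e / ((norm u)\<^sup>2 + 1) * (norm u)\<^sup>2"
      by (rule bnd) (intro divide_pos_pos e N)
    also have "\<dots> \<le> e" using e N by (simp add: divide_le_eq)
    finally show "\<bar>T u \<bullet> u - (\<integral>t. t \<partial>\<mu> u)\<bar> \<le> 0 + e" by simp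
  qed
  then show ?thesis by simp
qed

end

theorem spectral_measure_exists:
  fixes T :: "'a::{real_inner,complete_space} \<Rightarrow> 'a"
  assumes T: "selfadjoint_operator T"
  shows "\<exists>E. is_spectral_measure T E"
proof -
  obtain P where "spectral_resolution T P" using spectral_resolution_exists[OF T] by blast
  then interpret spectral_resolution T P .
  interpret projection_generating_measures \<mu>
  proof
    show "\<exists>Q. orthogonal_projection Q \<and> (\<forall>u. measure (\<mu> u) {..t} = (norm (Q u))\<^sup>2)" for t
      by (rule exI[of _ "P t"]) (simp add: P measure_def emeasure_mu_atMost F_def)
  qed (simp_all add: emeasure_mu_UNIV)
  obtain K where K: "0 < K" "\<And>t u. t < - K \<Longrightarrow> emeasure (\<mu> u) {..t} = 0" "\<And>u. emeasure (\<mu> u) {K<..} = 0"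
    by (rule emeasure_mu_support) blast
  \<comment> \<open>Only half-lines \<open>{..t}\<close> with t strictly below -K are known to be
    null, hence the widening by 1.\<close>
  have "E {- (K + 1)..K + 1} u = u" for u
  proof -
    have "measure (\<mu> u) ({..- (K + 1)} \<union> {K<..}) = 0"
      using K(2)[of "- (K + 1)" u] K(3)[of u] by (simp add: measure_def emeasure_Un_null_set null_sets_def)
    moreover have "UNIV - {- (K + 1)..K + 1} \<subseteq> {..- (K + 1)} \<union> {K<..}" by auto
    then have "measure (\<mu> u) (UNIV - {- (K + 1)..K + 1}) \<le> measure (\<mu> u) ({..- (K + 1)} \<union> {K<..})"
      by (rule finite_measure.finite_measure_mono[OF finite_mu]) simp
    ultimately have "measure (\<mu> u) (UNIV - {- (K + 1)..K + 1}) = 0"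
      by (simp add: measure_le_0_iff)
    then have "(norm (u - E {- (K + 1)..K + 1} u))\<^sup>2 = 0"
      using represents_Compl[OF represents_E, of "{- (K + 1)..K + 1}"] by (simp add: represents_def)
    then show ?thesis by simp
  qed
  then have "is_spectral_measure T E"
    unfolding is_spectral_measure_def scalar_spectral_measure_E
    by (intro conjI exI[of _ "K + 1"] allI projection_valued_measure_E form_eq_integral)
  then show ?thesis by blast
qed

section \<open>Calculus with a given spectral measure\<close>

text \<open>Everything here is derived from \<open>is_spectral_measure\<close> alone, so it applies
  to whichever \<open>E\<close> the choice in \<open>spectral_measure\<close> selects.\<close>

locale operator_with_spectral_measure =
  fixes T :: "'a::{real_inner,complete_space} \<Rightarrow> 'a" and E :: "real set \<Rightarrow> 'a \<Rightarrow> 'a"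
  assumes T: "selfadjoint_operator T" and E: "is_spectral_measure T E"
begin

lemma E_proj: "A \<in> sets borel \<Longrightarrow> orthogonal_projection (E A)"
  and E_UNIV: "E UNIV u = u"
  and E_Int: "A \<in> sets borel \<Longrightarrow> B \<in> sets borel \<Longrightarrow> E (A \<inter> B) u = E A (E B u)"
  and E_sums: "range F \<subseteq> sets borel \<Longrightarrow> disjoint_family F \<Longrightarrow>
    (\<lambda>n::nat. E (F n) u) sums E (\<Union>n. F n) u"
  using E unfolding is_spectral_measure_def projection_valued_measure_def by blast+

lemma E_empty: "E {} u = 0"
proof -
  have "(\<lambda>n::nat. E {} u) sums E (\<Union>n::nat. {}) u"
    by (rule E_sums) (auto simp: disjoint_family_on_def)
  then have "(\<lambda>n::nat. E {} u) \<longlonglongrightarrow> 0" by (intro summable_LIMSEQ_zero) (rule sums_summable)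
  then show ?thesis using LIMSEQ_const_iff by blast
qed

abbreviation M :: "'a \<Rightarrow> real measure" where
  "M \<equiv> scalar_spectral_measure E"

lemma sets_M [simp, measurable_cong]: "sets (M u) = sets borel"
  and space_M [simp]: "space (M u) = UNIV"
  unfolding scalar_spectral_measure_def
  using sets.sigma_sets_eq[of "borel :: real measure"]
  by (auto simp: sets_measure_of_conv space_measure_of_conv)

lemma emeasure_M:
  assumes A: "A \<in> sets borel"
  shows "emeasure (M u) A = ennreal ((norm (E A u))\<^sup>2)"
  unfolding scalar_spectral_measure_def
proof (rule emeasure_measure_of_sigma[OF _ _ _ A])
  show "sigma_algebra UNIV (sets (borel :: real measure))"
    using sets.sigma_algebra_axioms[of "borel :: real measure"] by simp
  show "positive (sets borel) (\<lambda>A. ennreal ((norm (E A u))\<^sup>2))"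
    by (simp add: positive_def E_empty)
  show "countably_additive (sets borel) (\<lambda>A. ennreal ((norm (E A u))\<^sup>2))"
  proof (rule countably_additiveI)
    fix F :: "nat \<Rightarrow> real set"
    assume F: "range F \<subseteq> sets borel" "disjoint_family F"
    then have Fb: "F n \<in> sets borel" for n by auto
    have proj: "orthogonal_projection (E (F n))" for n by (rule E_proj[OF Fb])
    have orth: "E (F i) (E (F j) v) = 0" if "i \<noteq> j" for i j v
    proof -
      have "F i \<inter> F j = {}" using F(2) that by (auto simp: disjoint_family_on_def)
      then show ?thesis using E_Int[OF Fb Fb, of i j v] E_empty by simp
    qed
    obtain R where R: "\<And>u. (\<lambda>n. E (F n) u) sums R u"
      "\<And>u. (\<lambda>n. (norm (E (F n) u))\<^sup>2) sums (norm (R u))\<^sup>2"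
      using orthogonal_projection_sums[of "\<lambda>n. E (F n)", OF proj orth] by blast
    have "R u = E (\<Union>n. F n) u" using R(1) E_sums[OF F] by (rule sums_unique2)
    then show "(\<Sum>n. ennreal ((norm (E (F n) u))\<^sup>2)) = ennreal ((norm (E (\<Union>n. F n) u))\<^sup>2)"
      using R(2)[of u] by (intro suminf_ennreal_eq) auto
  qed
qed

lemma finite_M: "finite_measure (M u)"
  by (rule finite_measureI) (simp add: emeasure_M)

lemma measure_M: "A \<in> sets borel \<Longrightarrow> measure (M u) A = (norm (E A u))\<^sup>2"
  by (simp add: measure_def emeasure_M)

text \<open>Projecting by \<open>E B\<close> restricts the scalar measure to \<open>B\<close>; this
  turns the form at \<open>E B u\<close> into an integral over \<open>B\<close>.\<close>

lemma M_E:
  assumes B: "B \<in> sets borel"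
  shows "M (E B u) = density (M u) (indicator B)"
proof (rule measure_eqI)
  fix A assume "A \<in> sets (M (E B u))"
  then have A: "A \<in> sets borel" by simp
  show "emeasure (M (E B u)) A = emeasure (density (M u) (indicator B)) A"
    using A B E_Int[OF A B, of u] by (simp add: emeasure_restricted emeasure_M Int_commute)
qed simp

lemma AE_M_bounded: obtains K where "\<And>u. AE t in M u. \<bar>t\<bar> \<le> K"
proof -
  obtain K where K: "\<And>u. E {-K..K} u = u"
    using E unfolding is_spectral_measure_def by blast
  have "AE t in M u. \<bar>t\<bar> \<le> K" for u
  proof (rule AE_I')
    have "E (UNIV - {-K..K}) u = E (UNIV - {-K..K}) (E {-K..K} u)" by (simp add: K)
    also have "\<dots> = E ((UNIV - {-K..K}) \<inter> {-K..K}) u" by (rule E_Int[symmetric]) auto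
    also have "(UNIV - {-K..K}) \<inter> {-K..K} = {}" by auto
    finally show "UNIV - {-K..K} \<in> null_sets (M u)"
      by (auto simp: null_sets_def emeasure_M E_empty)
  qed auto
  then show ?thesis by (rule that)
qed

lemma integrable_M_indicator:
  assumes B: "B \<in> sets borel"
  shows "integrable (M u) (\<lambda>t. indicator B t * t)"
proof -
  interpret finite_measure "M u" by (rule finite_M)
  obtain K where K: "\<And>u. AE t in M u. \<bar>t\<bar> \<le> K" by (rule AE_M_bounded) blast
  have [measurable]: "B \<in> sets borel" by (rule B)
  show ?thesis
  proof (rule integrable_const_bound[where B = "\<bar>K\<bar>"])
    show "AE t in M u. norm (indicator B t * t) \<le> \<bar>K\<bar>"
      using K[of u] by eventually_elim (auto simp: indicator_def)
  qed auto
qed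

lemma form_E:
  assumes B: "B \<in> sets borel"
  shows "T (E B u) \<bullet> E B u = (\<integral>t. indicator B t * t \<partial>M u)"
proof -
  have [measurable]: "B \<in> sets borel" by (rule B)
  have "T (E B u) \<bullet> E B u = (\<integral>t. t \<partial>M (E B u))"
    using E unfolding is_spectral_measure_def by blast
  also have "\<dots> = (\<integral>t. t \<partial>density (M u) (\<lambda>t. ennreal (indicator B t)))"
    unfolding M_E[OF B] by (simp add: ennreal_indicator)
  also have "\<dots> = (\<integral>t. indicator B t *\<^sub>R t \<partial>M u)"
    by (rule integral_density) auto
  finally show ?thesis by simp
qed

text \<open>Additivity of the scalar measure shows that the projection given by the sum of
  \<open>E B\<close> and \<open>E (- B)\<close> keeps the norm of every vector, hence fixes
  it.\<close>

lemma E_Compl: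
  assumes B: "B \<in> sets borel"
  shows "E (- B) u = u - E B u"
proof -
  have B': "- B \<in> sets borel" using B by auto
  note P = E_proj[OF B] and P' = E_proj[OF B']
  have 0: "E B (E (- B) u) = 0" "E (- B) (E B u) = 0"
    using E_Int[OF B B', of u] E_Int[OF B' B, of u] by (simp_all add: E_empty Int_commute)
  have "emeasure (M u) UNIV = emeasure (M u) (B \<union> - B)" by simp
  also have "\<dots> = emeasure (M u) B + emeasure (M u) (- B)"
    by (rule plus_emeasure[symmetric]) (use B B' in auto)
  finally have "(norm u)\<^sup>2 = (norm (E B u))\<^sup>2 + (norm (E (- B) u))\<^sup>2"
    using B B' by (simp add: emeasure_M E_UNIV ennreal_plus[symmetric] del: ennreal_plus)
  also have "\<dots> = (norm (E B u + E (- B) u))\<^sup>2"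
    by (rule orthogonal_projection_add(2)[OF P P', symmetric])
      (use E_Int[OF B B'] E_Int[OF B' B] in \<open>simp_all add: E_empty Int_commute\<close>)
  finally have n: "(norm u)\<^sup>2 = (norm (E B u + E (- B) u))\<^sup>2" .
  have proj: "orthogonal_projection (\<lambda>u. E B u + E (- B) u)"
    by (rule orthogonal_projection_add(1)[OF P P'])
      (use E_Int[OF B B'] E_Int[OF B' B] in \<open>simp_all add: E_empty Int_commute\<close>)
  have "(norm (u - (E B u + E (- B) u)))\<^sup>2 = 0"
    using orthogonal_projection_norm(2)[OF proj, of u] n by simp
  then have "u = E B u + E (- B) u" by simp
  then show ?thesis by (metis add_diff_cancel_left')
qed

lemma form_split:
  assumes B: "B \<in> sets borel"
  shows "T u \<bullet> u = T (E B u) \<bullet> E B u + T (u - E B u) \<bullet> (u - E B u)"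
proof -
  have B': "- B \<in> sets borel" using B by auto
  have "T u \<bullet> u = (\<integral>t. indicator B t * t + indicator (- B) t * t \<partial>M u)"
    using form_E[of UNIV u] E_UNIV
    by (simp add: indicator_compl algebra_simps)
  also have "\<dots> = (\<integral>t. indicator B t * t \<partial>M u) + (\<integral>t. indicator (- B) t * t \<partial>M u)"
    by (intro Bochner_Integration.integral_add integrable_M_indicator B B')
  finally show ?thesis by (simp add: form_E[symmetric] B B' E_Compl)
qed

text \<open>By \<open>form_split\<close> the form of a + b has no cross terms when a is in the range
  and b in the kernel of \<open>E B\<close>. With \<open>T\<close> symmetric this makes T a
  orthogonal to b, so \<open>T\<close> preserves both subspaces.\<close>

lemma T_E_commute:
  assumes B: "B \<in> sets borel"
  shows "T (E B u) = E B (T u)"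
proof -
  interpret T: bounded_linear T using T by (rule selfadjoint_operatorD)
  note sa = selfadjoint_operatorD(2)[OF T]
  note s = orthogonal_projection_simps[OF E_proj[OF B]]
  have orth: "T (E B v) \<bullet> (w - E B w) = 0" for v w
  proof -
    define a where "a = E B v"
    define b where "b = w - E B w"
    have "E B (a + b) = a" by (simp only: a_def b_def s) simp
    then have "T (a + b) \<bullet> (a + b) = T a \<bullet> a + T b \<bullet> b"
      using form_split[OF B, of "a + b"] by simp
    then have "T a \<bullet> b + T b \<bullet> a = 0" by (simp add: T.add inner_simps)
    moreover have "T b \<bullet> a = T a \<bullet> b" using sa[of b a] by (simp add: inner_commute)
    ultimately show ?thesis by (simp add: a_def b_def)
  qed
  show ?thesis
  proof (rule inner_eqI)
    fix w
    have "w \<bullet> T (E B u) = E B w \<bullet> T (E B u)"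
      using orth[of u w] by (simp add: inner_diff_right inner_commute)
    also have "\<dots> = T (E B w) \<bullet> E B u" by (simp only: sa)
    also have "\<dots> = T (E B w) \<bullet> u"
      using orth[of w u] by (simp add: inner_diff_right)
    also have "\<dots> = w \<bullet> E B (T u)" by (simp only: sa s(6))
    finally show "w \<bullet> T (E B u) = w \<bullet> E B (T u)" .
  qed
qed

lemma integral_M_indicator_const:
  fixes c :: real
  assumes B: "B \<in> sets borel"
  shows "integrable (M u) (\<lambda>t. indicator B t * c)"
    and "(\<integral>t. indicator B t * c \<partial>M u) = c * (norm (E B u))\<^sup>2"
proof -
  interpret finite_measure "M u" by (rule finite_M)
  have [measurable]: "B \<in> sets borel" by (rule B)
  show "integrable (M u) (\<lambda>t. indicator B t * c)"
    by (rule integrable_const_bound[where B = "\<bar>c\<bar>"]) (auto simp: indicator_def)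
  show "(\<integral>t. indicator B t * c \<partial>M u) = c * (norm (E B u))\<^sup>2"
    using measure_M[OF B] by simp
qed

lemma form_E_le:
  assumes B: "B \<in> sets borel" "B \<subseteq> {..c}"
  shows "T (E B u) \<bullet> E B u \<le> c * (norm (E B u))\<^sup>2"
  unfolding form_E[OF B(1)] integral_M_indicator_const(2)[OF B(1), symmetric]
  by (intro integral_mono integrable_M_indicator integral_M_indicator_const B)
    (use B(2) in \<open>auto simp: indicator_def\<close>)

lemma form_E_ge:
  assumes B: "B \<in> sets borel" "B \<subseteq> {c..}"
  shows "c * (norm (E B u))\<^sup>2 \<le> T (E B u) \<bullet> E B u"
  unfolding form_E[OF B(1)] integral_M_indicator_const(2)[OF B(1), symmetric]
  by (intro integral_mono integrable_M_indicator integral_M_indicator_const B)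
    (use B(2) in \<open>auto simp: indicator_def\<close>)

text \<open>On \<open>{..- 1 / (real n + 1)}\<close> the form is bounded by a strictly negative
  multiple of the squared norm, which positivity of \<open>T\<close> allows only for the zero
  vector.\<close>

lemma emeasure_M_negative:
  assumes T_nonneg: "\<And>u. 0 \<le> T u \<bullet> u"
  shows "emeasure (M u) {..<0} = 0"
proof -
  have "emeasure (M u) (\<Union>n::nat. {..- 1 / (real n + 1)}) = 0"
  proof (rule emeasure_UN_eq_0)
    fix n :: nat
    have "- 1 / (real n + 1) < 0" by simp
    moreover have "0 \<le> - 1 / (real n + 1) * (norm (E {..- 1 / (real n + 1)} u))\<^sup>2"
      by (rule order_trans[OF T_nonneg form_E_le]) auto
    ultimately have "(norm (E {..- 1 / (real n + 1)} u))\<^sup>2 = 0"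
      by (smt (verit) mult_neg_pos zero_le_power2)
    then show "emeasure (M u) {..- 1 / (real n + 1)} = 0" by (simp add: emeasure_M)
  qed auto
  also have "(\<Union>n::nat. {..- 1 / (real n + 1)}) = {..<0}"
  proof (intro equalityI subsetI)
    fix t :: real assume "t \<in> (\<Union>n::nat. {..- 1 / (real n + 1)})"
    then obtain n :: nat where "t \<le> - 1 / (real n + 1)" by auto
    also have "\<dots> < 0" by simp
    finally show "t \<in> {..<0}" by simp
  next
    fix t :: real assume t: "t \<in> {..<0}"
    obtain n where n: "1 / (- t) < real n" using reals_Archimedean2 by blast
    have "1 / (- t) < real n + 1" using n by simp
    then have "t \<le> - 1 / (real n + 1)" using t by (simp add: field_simps)
    then show "t \<in> (\<Union>n::nat. {..- 1 / (real n + 1)})" by blast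
  qed
  finally show ?thesis .
qed

text \<open>The spectral tail speaks of intervals starting at 0, whereas the lower bound needs the
  whole of \<open>{..c}\<close> to be null; for a nonnegative \<open>T\<close> the negative
  half-line adds no mass.\<close>

lemma form_above:
  assumes T_nonneg: "\<And>u. 0 \<le> T u \<bullet> u" and c: "0 \<le> c" and v: "E {0..c} v = 0"
  shows "c * (norm v)\<^sup>2 \<le> T v \<bullet> v"
proof -
  have "emeasure (M v) {..c} = emeasure (M v) ({..<0} \<union> {0..c})"
    using c by (intro arg_cong[where f = "emeasure _"]) auto
  also have "\<dots> = emeasure (M v) {..<0} + emeasure (M v) {0..c}"
    by (rule plus_emeasure[symmetric]) auto
  also have "\<dots> = 0"
    using v emeasure_M_negative[OF T_nonneg, of v] by (simp add: emeasure_M)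
  finally have "E {..c} v = 0" by (simp add: emeasure_M)
  then have "E {c<..} v = v" using E_Compl[of "{..c}" v] by (simp add: Compl_atMost)
  moreover have "{c<..} \<subseteq> {c..}" by auto
  ultimately show ?thesis using form_E_ge[of "{c<..}" c v] by simp
qed

end

section \<open>Tikhonov regularization\<close>

locale tikhonov =
  fixes L :: "'u::{real_inner,complete_space} \<Rightarrow> 'v::{real_inner,complete_space}"
  assumes L: "bounded_linear L"
begin

sublocale L: bounded_linear L by (rule L)
sublocale A: bounded_linear "adjoint L" by (rule bounded_linear_adjoint[OF L])

lemmas adj = adjoint_inner[OF L]

definition T :: "'u \<Rightarrow> 'u" where
  "T = adjoint L \<circ> L"

lemma T_apply: "T u = adjoint L (L u)"
  by (simp add: T_def)

lemma T_inner: "T u \<bullet> v = L u \<bullet> L v"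
  by (simp add: T_apply adj inner_commute[of _ v]) (simp add: adj[symmetric] inner_commute)

lemma T_selfadjoint: "selfadjoint_operator T"
proof -
  have "bounded_linear T" unfolding T_def comp_def
    by (rule bounded_linear_compose[OF A.bounded_linear L])
  moreover have "T u \<bullet> v = u \<bullet> T v" for u v
    using T_inner[of u v] T_inner[of v u] by (simp add: inner_commute)
  ultimately show ?thesis by (simp add: selfadjoint_operator_def)
qed

sublocale T: bounded_linear T by (rule selfadjoint_operatorD(1)[OF T_selfadjoint])

lemma T_sym: "T u \<bullet> v = u \<bullet> T v"
  by (rule selfadjoint_operatorD(2)[OF T_selfadjoint])

text \<open>The component of the projection of \<open>(0, z / s)\<close> onto the closed subspace
  \<open>{(L u, s *\<^sub>R u)}\<close> of \<open>V \<times> U\<close>, where \<open>s = sqrt \<alpha>\<close>.\<close>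

lemma resolvent_exists:
  assumes \<alpha>: "0 < \<alpha>"
  shows "\<exists>u. T u + \<alpha> *\<^sub>R u = z"
proof -
  define s where "s = sqrt \<alpha>"
  have s: "0 < s" "s * s = \<alpha>" using \<alpha> by (simp_all add: s_def)
  let ?S = "{p :: 'v \<times> 'u. s *\<^sub>R fst p = L (snd p)}"
  have sub: "subspace ?S"
    by (auto simp: subspace_def L.zero L.add L.scaleR scaleR_add_right scaleR_left_commute
        simp del: scaleR_scaleR)
  have cl: "closed ?S"
    by (intro closed_Collect_eq continuous_intros L.continuous_on)
  obtain p where p: "p \<in> ?S" "\<And>v. v \<in> ?S \<Longrightarrow> ((0, (1 / s) *\<^sub>R z) - p) \<bullet> v = 0"
    by (rule closed_subspace_projection[OF sub cl]) blast
  define u where "u = (1 / s) *\<^sub>R snd p"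
  have sp: "snd p = s *\<^sub>R u" using s by (simp add: u_def)
  then have "s *\<^sub>R fst p = s *\<^sub>R L u" using p(1) by (simp add: L.scaleR)
  then have fp: "fst p = L u" using s by simp
  have "T u + \<alpha> *\<^sub>R u = z"
  proof (rule inner_eqI)
    fix v
    \<comment> \<open>Orthogonality to the pairs \<open>(L v, s *\<^sub>R v)\<close> is the weak
      form of the resolvent equation for \<open>u\<close>.\<close>
    have "((0, (1 / s) *\<^sub>R z) - p) \<bullet> (L v, s *\<^sub>R v) = 0"
      by (rule p(2)) (simp add: L.scaleR)
    then have "z \<bullet> v = L u \<bullet> L v + (s * s) * (u \<bullet> v)"
      using s(1) by (simp add: inner_prod_def fp sp inner_simps algebra_simps)
    then show "v \<bullet> (T u + \<alpha> *\<^sub>R u) = v \<bullet> z"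
      unfolding inner_commute[of v] using s(2) by (simp add: inner_simps T_inner)
  qed
  then show ?thesis by blast
qed

text \<open>The resolvent (T + \<alpha>)^-1.\<close>

definition J :: "real \<Rightarrow> 'u \<Rightarrow> 'u" where
  "J \<alpha> z = (SOME u. T u + \<alpha> *\<^sub>R u = z)"

lemma J_eq: "0 < \<alpha> \<Longrightarrow> T (J \<alpha> z) + \<alpha> *\<^sub>R J \<alpha> z = z"
  unfolding J_def by (rule someI_ex[OF resolvent_exists])

lemma J_unique:
  assumes \<alpha>: "0 < \<alpha>" and u: "T u + \<alpha> *\<^sub>R u = z"
  shows "J \<alpha> z = u"
proof -
  define d where "d = J \<alpha> z - u"
  have "T d + \<alpha> *\<^sub>R d = (T (J \<alpha> z) + \<alpha> *\<^sub>R J \<alpha> z) - (T u + \<alpha> *\<^sub>R u)"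
    by (simp add: d_def T.diff scaleR_diff_right)
  then have "T d + \<alpha> *\<^sub>R d = 0" using J_eq[OF \<alpha>] u by simp
  then have "L d \<bullet> L d + \<alpha> * (d \<bullet> d) = 0"
    unfolding T_inner[symmetric] by (metis inner_add_left inner_scaleR_left inner_zero_left)
  moreover have "0 \<le> L d \<bullet> L d" "0 \<le> \<alpha> * (d \<bullet> d)" using \<alpha> by auto
  ultimately have "\<alpha> * (d \<bullet> d) = 0" by linarith
  then show ?thesis using \<alpha> by (simp add: d_def)
qed

lemma J_linear:
  assumes "0 < \<alpha>"
  shows "J \<alpha> (a + b) = J \<alpha> a + J \<alpha> b" "J \<alpha> (a - b) = J \<alpha> a - J \<alpha> b" "J \<alpha> (r *\<^sub>R a) = r *\<^sub>R J \<alpha> a"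
    "J \<alpha> (T a) = T (J \<alpha> a)"
proof -
  note e = J_eq[OF assms]
  show "J \<alpha> (a + b) = J \<alpha> a + J \<alpha> b"
    using e[of a] e[of b] by (intro J_unique[OF assms]) (simp add: T.add algebra_simps)
  show "J \<alpha> (a - b) = J \<alpha> a - J \<alpha> b"
  proof (rule J_unique[OF assms])
    have "T (J \<alpha> a - J \<alpha> b) + \<alpha> *\<^sub>R (J \<alpha> a - J \<alpha> b)
        = (T (J \<alpha> a) + \<alpha> *\<^sub>R J \<alpha> a) - (T (J \<alpha> b) + \<alpha> *\<^sub>R J \<alpha> b)"
      by (simp add: T.diff algebra_simps)
    then show "T (J \<alpha> a - J \<alpha> b) + \<alpha> *\<^sub>R (J \<alpha> a - J \<alpha> b) = a - b" by (simp only: e)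
  qed
  show "J \<alpha> (r *\<^sub>R a) = r *\<^sub>R J \<alpha> a"
  proof (rule J_unique[OF assms])
    have "T (r *\<^sub>R J \<alpha> a) + \<alpha> *\<^sub>R (r *\<^sub>R J \<alpha> a) = r *\<^sub>R (T (J \<alpha> a) + \<alpha> *\<^sub>R J \<alpha> a)"
      by (simp add: T.scaleR algebra_simps)
    then show "T (r *\<^sub>R J \<alpha> a) + \<alpha> *\<^sub>R (r *\<^sub>R J \<alpha> a) = r *\<^sub>R a" by (simp only: e)
  qed
  show "J \<alpha> (T a) = T (J \<alpha> a)"
  proof (rule J_unique[OF assms])
    have "T (T (J \<alpha> a)) + \<alpha> *\<^sub>R T (J \<alpha> a) = T (T (J \<alpha> a) + \<alpha> *\<^sub>R J \<alpha> a)"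
      by (simp add: T.add T.scaleR)
    then show "T (T (J \<alpha> a)) + \<alpha> *\<^sub>R T (J \<alpha> a) = T a" by (simp only: e)
  qed
qed

lemma J_sym:
  assumes "0 < \<alpha>"
  shows "J \<alpha> a \<bullet> b = a \<bullet> J \<alpha> b"
proof -
  have "J \<alpha> a \<bullet> b = J \<alpha> a \<bullet> (T (J \<alpha> b) + \<alpha> *\<^sub>R J \<alpha> b)" by (simp only: J_eq[OF assms])
  also have "\<dots> = (T (J \<alpha> a) + \<alpha> *\<^sub>R J \<alpha> a) \<bullet> J \<alpha> b"
    by (simp add: inner_add_left inner_add_right T_sym)
  finally show ?thesis by (simp only: J_eq[OF assms])
qed

lemma J_form:
  assumes "0 < \<alpha>"
  shows "z \<bullet> J \<alpha> z = (norm (L (J \<alpha> z)))\<^sup>2 + \<alpha> * (norm (J \<alpha> z))\<^sup>2"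
proof -
  have "z \<bullet> J \<alpha> z = (T (J \<alpha> z) + \<alpha> *\<^sub>R J \<alpha> z) \<bullet> J \<alpha> z" by (simp only: J_eq[OF assms])
  then show ?thesis by (simp add: inner_add_left T_inner power2_norm_eq_inner)
qed

text \<open>Each bound drops one of the two terms of \<open>J_form\<close>; the second one is
  multiplied by \<alpha> so that the first can be inserted.\<close>

lemma J_norm:
  assumes \<alpha>: "0 < \<alpha>"
  shows "\<alpha> * norm (J \<alpha> z) \<le> norm z" and "sqrt \<alpha> * norm (L (J \<alpha> z)) \<le> norm z"
proof -
  let ?n = "norm (J \<alpha> z)"
  have cs: "z \<bullet> J \<alpha> z \<le> norm z * ?n" by (rule norm_cauchy_schwarz)
  have "\<alpha> * ?n\<^sup>2 \<le> norm z * ?n" using cs J_form[OF \<alpha>, of z] zero_le_power2[of "norm (L (J \<alpha> z))"] by linarith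
  then have "(\<alpha> * ?n) * ?n \<le> norm z * ?n" by (simp add: power2_eq_square mult.assoc)
  then show *: "\<alpha> * ?n \<le> norm z"
    by (cases "?n = 0") (auto simp: mult_le_cancel_right)
  have "0 \<le> \<alpha> * ?n\<^sup>2" using \<alpha> by simp
  then have "(norm (L (J \<alpha> z)))\<^sup>2 \<le> norm z * ?n" using cs J_form[OF \<alpha>, of z] by linarith
  then have "\<alpha> * (norm (L (J \<alpha> z)))\<^sup>2 \<le> norm z * (\<alpha> * ?n)"
    using \<alpha> by (simp add: mult.left_commute)
  also have "\<dots> \<le> norm z * norm z" using * by (intro mult_left_mono) auto
  finally have "(sqrt \<alpha> * norm (L (J \<alpha> z)))\<^sup>2 \<le> (norm z)\<^sup>2"
    unfolding power_mult_distrib using \<alpha> by (simp add: power2_eq_square[of "norm z"])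
  then show "sqrt \<alpha> * norm (L (J \<alpha> z)) \<le> norm z" by (rule power2_le_imp_le) simp
qed

text \<open>The maps \<open>J \<alpha> \<circ> adjoint L\<close> and
  \<open>L \<circ> J \<alpha>\<close> are adjoint to each other and so share the bound 1 / sqrt
  \<alpha>. This is the amplification of the data noise.\<close>

lemma J_adjoint_norm:
  assumes \<alpha>: "0 < \<alpha>"
  shows "sqrt \<alpha> * norm (J \<alpha> (adjoint L v)) \<le> norm v"
proof -
  define w where "w = J \<alpha> (adjoint L v)"
  have "(norm w)\<^sup>2 = adjoint L v \<bullet> J \<alpha> w"
    unfolding power2_norm_eq_inner by (simp add: w_def J_sym[OF \<alpha>])
  also have "\<dots> = v \<bullet> L (J \<alpha> w)" using adj[of "J \<alpha> w" v] by (simp add: inner_commute)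
  also have "\<dots> \<le> norm v * norm (L (J \<alpha> w))" by (rule norm_cauchy_schwarz)
  finally have "sqrt \<alpha> * (norm w)\<^sup>2 \<le> norm v * (sqrt \<alpha> * norm (L (J \<alpha> w)))"
    using \<alpha> by (simp add: mult.left_commute)
  also have "\<dots> \<le> norm v * norm w" by (intro mult_left_mono J_norm \<alpha>) simp
  finally have "(sqrt \<alpha> * norm w) * norm w \<le> norm v * norm w" by (simp add: power2_eq_square mult.assoc)
  then show ?thesis unfolding w_def[symmetric]
    by (cases "norm w = 0") (auto simp: mult_le_cancel_right)
qed

text \<open>Completing the square: the resolvent equation at \<open>u0\<close> removes the linear
  term, and the functional exceeds its value there by a positive definite form in
  \<open>u - u0\<close>.\<close>

lemma regularized_solution_eq:
  assumes \<alpha>: "0 < \<alpha>"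
  shows "regularized_solution L \<alpha> y = J \<alpha> (adjoint L y)"
proof -
  define u0 where "u0 = J \<alpha> (adjoint L y)"
  define f where "f = (\<lambda>u. (norm (L u - y))\<^sup>2 + \<alpha> * (norm u)\<^sup>2)"
  have exp: "f u = f u0 + ((norm (L (u - u0)))\<^sup>2 + \<alpha> * (norm (u - u0))\<^sup>2)" for u
  proof -
    define h where "h = u - u0"
    have "f (u0 + h) = f u0 + ((norm (L h))\<^sup>2 + \<alpha> * (norm h)\<^sup>2)
        + 2 * (L u0 \<bullet> L h - y \<bullet> L h + \<alpha> * (u0 \<bullet> h))"
      by (simp add: f_def power2_norm_eq_inner L.add inner_simps inner_commute algebra_simps)
    moreover have "L u0 \<bullet> L h + \<alpha> * (u0 \<bullet> h) = adjoint L y \<bullet> h"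
    proof -
      have "L u0 \<bullet> L h + \<alpha> * (u0 \<bullet> h) = (T u0 + \<alpha> *\<^sub>R u0) \<bullet> h"
        by (simp only: inner_add_left inner_scaleR_left T_inner)
      then show ?thesis by (simp only: u0_def J_eq[OF \<alpha>])
    qed
    moreover have "adjoint L y \<bullet> h = y \<bullet> L h" using adj[of h y] by (simp add: inner_commute)
    ultimately show ?thesis by (simp add: h_def)
  qed
  have "f u0 \<le> f u" for u
    unfolding exp[of u] using \<alpha> by simp
  then have "is_arg_min f (\<lambda>u. True) u0"
    by (simp add: is_arg_min_def not_less)
  then have "is_arg_min f (\<lambda>u. True) (arg_min f (\<lambda>u. True))"
    unfolding arg_min_def by (rule someI)
  then have "f (arg_min f (\<lambda>u. True)) \<le> f u0" by (auto simp: is_arg_min_def not_less)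
  then have "(norm (L (arg_min f (\<lambda>u. True) - u0)))\<^sup>2 + \<alpha> * (norm (arg_min f (\<lambda>u. True) - u0))\<^sup>2 \<le> 0"
    using exp[of "arg_min f (\<lambda>u. True)"] by simp
  then have "\<alpha> * (norm (arg_min f (\<lambda>u. True) - u0))\<^sup>2 \<le> 0"
    using zero_le_power2[of "norm (L (arg_min f (\<lambda>u. True) - u0))"] by linarith
  then have "arg_min f (\<lambda>u. True) = u0" using \<alpha> by (simp add: mult_le_0_iff)
  then show ?thesis by (simp add: regularized_solution_def f_def u0_def)
qed

section \<open>The error of the regularized solution\<close>

definition R :: "real \<Rightarrow> 'u \<Rightarrow> 'u" where
  "R \<alpha> z = \<alpha> *\<^sub>R J \<alpha> z"

lemma T_J: "0 < \<alpha> \<Longrightarrow> T (J \<alpha> z) = z - R \<alpha> z"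
  using J_eq[of \<alpha> z] by (simp add: R_def algebra_simps)

lemma norm_R: "0 < \<alpha> \<Longrightarrow> norm (R \<alpha> z) \<le> norm z"
  using J_norm(1)[of \<alpha> z] by (simp add: R_def)

text \<open>\<open>R \<alpha>\<close> is firmly nonexpansive, its squared norm at z being at most
  its form at z, so its complement is a contraction as well.\<close>

lemma norm_diff_R:
  assumes \<alpha>: "0 < \<alpha>"
  shows "norm (z - R \<alpha> z) \<le> norm z"
proof -
  have "\<alpha> * (\<alpha> * (norm (J \<alpha> z))\<^sup>2) \<le> \<alpha> * (z \<bullet> J \<alpha> z)"
    using \<alpha> J_form[OF \<alpha>, of z] by (intro mult_left_mono) auto
  then have *: "(norm (R \<alpha> z))\<^sup>2 \<le> z \<bullet> R \<alpha> z"
    using \<alpha> by (simp add: R_def power2_eq_square mult_ac)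
  have "(norm (z - R \<alpha> z))\<^sup>2 = (norm z)\<^sup>2 - 2 * (z \<bullet> R \<alpha> z) + (norm (R \<alpha> z))\<^sup>2"
    by (simp add: power2_norm_eq_inner inner_simps inner_commute)
  also have "\<dots> \<le> (norm z)\<^sup>2" using * zero_le_power2[of "norm (R \<alpha> z)"] by linarith
  finally show ?thesis by (rule power2_le_imp_le) simp
qed

lemma R_sym: "0 < \<alpha> \<Longrightarrow> R \<alpha> a \<bullet> b = a \<bullet> R \<alpha> b"
  by (simp add: R_def J_sym)

text \<open>The first term is the propagated data noise, the second the bias.\<close>

lemma regularized_error:
  assumes \<alpha>: "0 < \<alpha>"
  shows "regularized_solution L \<alpha> y - x = J \<alpha> (adjoint L (y - L x)) - R \<alpha> x"
proof -
  have "J \<alpha> (adjoint L (y - L x)) = J \<alpha> (adjoint L y) - T (J \<alpha> x)"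
    by (simp add: A.diff J_linear[OF \<alpha>] T_apply[of x, symmetric])
  then show ?thesis by (simp add: regularized_solution_eq[OF \<alpha>] T_J[OF \<alpha>])
qed

end

section \<open>Equivalence of the conditions\<close>

lemma power2_powr: "0 < c \<Longrightarrow> (c\<^sup>2) powr s = c powr (2 * s)" for c s :: real
  using powr_powr[of c 2 s] by simp

text \<open>Let t tend to 0. This covers the degenerate cases \<open>T u = 0\<close>,
  \<open>L u = 0\<close> and the spectral projection at 0, where the balancing parameter would be
  0.\<close>

lemma nonpos_if_le_powr:
  fixes a c p :: real
  assumes le: "\<And>t. 0 < t \<Longrightarrow> a \<le> c * t powr p" and p: "0 < p" and c: "0 \<le> c"
  shows "a \<le> 0"
proof (rule ccontr)
  assume "\<not> a \<le> 0"
  then have a: "0 < a" by simp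
  define d where "d = a / (2 * (c + 1))"
  define t where "t = d powr (1 / p)"
  have pos: "0 < d" using a c by (simp add: d_def)
  then have "t powr p = d" using p by (simp add: t_def powr_powr)
  moreover have "0 < t" using pos by (simp add: t_def)
  ultimately have "a \<le> c * d" using le[of t] by simp
  then have "a \<le> c * (a / (2 * (c + 1)))" by (simp only: d_def)
  then have "a * (2 * (c + 1)) \<le> c * a" using c by (simp add: field_simps)
  then have "a * (c + 2) \<le> 0" by (simp add: algebra_simps)
  then show False using a c by (simp add: mult_le_0_iff)
qed

text \<open>Unrolling gives a geometric series of ratio \<open>q * 2 powr p\<close> and a remainder
  that \<open>lim\<close> removes. It is applied with q = 1 and p < 0 to
  \<open>L (J \<alpha> x)\<close>, and with q < 1 and p > 0 to \<open>R \<alpha> x\<close>.\<close>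

lemma doubling_recursion:
  fixes f :: "real \<Rightarrow> real"
  assumes rec: "\<And>\<alpha>. 0 < \<alpha> \<Longrightarrow> f \<alpha> \<le> q * f (2 * \<alpha>) + C * \<alpha> powr p"
    and q: "0 \<le> q" "q * 2 powr p < 1" and C: "0 \<le> C"
    and lim: "\<And>\<alpha>. 0 < \<alpha> \<Longrightarrow> (\<lambda>n. q ^ n * f (2 ^ n * \<alpha>)) \<longlonglongrightarrow> 0"
    and \<alpha>: "0 < \<alpha>"
  shows "f \<alpha> \<le> C / (1 - q * 2 powr p) * \<alpha> powr p"
proof -
  define r where "r = q * 2 powr p"
  have r: "0 \<le> r" "r < 1" using q by (simp_all add: r_def)
  have step: "f \<alpha> \<le> q ^ n * f (2 ^ n * \<alpha>) + C * \<alpha> powr p * (\<Sum>i<n. r ^ i)" for n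
  proof (induction n)
    case (Suc n)
    have "q ^ n * f (2 ^ n * \<alpha>) \<le> q ^ n * (q * f (2 * (2 ^ n * \<alpha>)) + C * (2 ^ n * \<alpha>) powr p)"
      using q(1) \<alpha> by (intro mult_left_mono rec) auto
    also have "(2 ^ n * \<alpha>) powr p = (2 powr p) ^ n * \<alpha> powr p"
      using \<alpha> by (simp add: powr_mult powr_realpow[symmetric] powr_powr mult.commute)
    also have "q ^ n * (q * f (2 * (2 ^ n * \<alpha>)) + C * ((2 powr p) ^ n * \<alpha> powr p))
        = q ^ Suc n * f (2 ^ Suc n * \<alpha>) + C * \<alpha> powr p * r ^ n"
      by (simp add: r_def power_mult_distrib algebra_simps)
    finally show ?case using Suc by (simp add: algebra_simps)
  qed simp
  have "f \<alpha> \<le> q ^ n * f (2 ^ n * \<alpha>) + C * \<alpha> powr p * (1 / (1 - r))" for n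
  proof -
    have "(\<Sum>i<n. r ^ i) \<le> (\<Sum>i. r ^ i)" using r by (intro sum_le_suminf summable_geometric) auto
    also have "\<dots> = 1 / (1 - r)" using r by (simp add: suminf_geometric)
    finally show ?thesis
      using step[of n] C mult_left_mono[of "\<Sum>i<n. r ^ i" "1 / (1 - r)" "C * \<alpha> powr p"] by auto
  qed
  moreover have "(\<lambda>n. q ^ n * f (2 ^ n * \<alpha>) + C * \<alpha> powr p * (1 / (1 - r)))
      \<longlonglongrightarrow> 0 + C * \<alpha> powr p * (1 / (1 - r))"
    by (intro tendsto_intros lim \<alpha>)
  ultimately have "f \<alpha> \<le> 0 + C * \<alpha> powr p * (1 / (1 - r))"
    by (intro LIMSEQ_le_const) auto
  then show ?thesis by (simp add: r_def)
qed

section \<open>Variational inequalities and the resolvent rate\<close>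

context tikhonov
begin

definition resolvent_rate :: "'u \<Rightarrow> real \<Rightarrow> bool" where
  "resolvent_rate x r \<longleftrightarrow> (\<exists>C>0. \<forall>\<alpha>>0. norm (R \<alpha> x) \<le> C * \<alpha> powr r)"

lemma noise_free_rate_iff: "noise_free_rate L (L x) x r \<longleftrightarrow> resolvent_rate x r"
  unfolding noise_free_rate_def resolvent_rate_def
proof (intro ex_cong1 conj_cong refl all_cong1 imp_cong)
  fix C \<alpha> :: real assume \<alpha>: "0 < \<alpha>"
  have "J \<alpha> 0 = 0" using J_linear(3)[OF \<alpha>, of 0 0] by simp
  then have "norm (regularized_solution L \<alpha> (L x) - x) = norm (R \<alpha> x)"
    by (simp add: regularized_error[OF \<alpha>] A.zero)
  then show "(norm (regularized_solution L \<alpha> (L x) - x) \<le> C * \<alpha> powr r)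
      = (norm (R \<alpha> x) \<le> C * \<alpha> powr r)" by simp
qed

lemma resolvent_rate_if_symmetrized_vi:
  assumes "symmetrized_vi L x \<nu>" and \<nu>: "0 < \<nu>" "\<nu> < 2"
  shows "resolvent_rate x (\<nu> / 2)"
proof -
  obtain \<beta> where \<beta>: "0 \<le> \<beta>" "\<And>u. 2 * (x \<bullet> u) \<le> \<beta> * norm (T u) powr (\<nu> / 2) * norm u powr (1 - \<nu> / 2)"
    using assms(1) unfolding symmetrized_vi_def T_apply by blast
  \<comment> \<open>The added 1 makes the constant positive when \<beta> = 0.\<close>
  have "norm (R \<alpha> x) \<le> (\<beta> / 2 + 1) * \<alpha> powr (\<nu> / 2)" if \<alpha>: "0 < \<alpha>" for \<alpha>
  proof (cases "R \<alpha> x = 0")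
    case True
    then show ?thesis using \<beta>(1) by simp
  next
    case False
    define r where "r = norm (R \<alpha> x)"
    have r: "0 < r" using False by (simp add: r_def)
    \<comment> \<open>Pairing with \<open>x\<close> gives the squared norm of
      \<open>R \<alpha> x\<close>, while the norms of \<open>T u\<close> and \<open>u\<close> are at
      most \<alpha> r and r; the right-hand side is then linear in r and one factor cancels.\<close>
    define u where "u = R \<alpha> (R \<alpha> x)"
    have "norm (T u) = \<alpha> * norm (R \<alpha> x - R \<alpha> (R \<alpha> x))"
      using \<alpha> by (simp add: u_def R_def[of \<alpha> "R \<alpha> x"] T.scaleR T_J)
    also have "\<dots> \<le> \<alpha> * r" using \<alpha> by (simp add: r_def norm_diff_R)
    finally have 1: "norm (T u) \<le> \<alpha> * r" .
    have 2: "norm u \<le> r" by (simp add: u_def r_def norm_R \<alpha>)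
    have "2 * r\<^sup>2 = 2 * (x \<bullet> u)"
      by (simp add: u_def r_def R_sym[OF \<alpha>, symmetric] power2_norm_eq_inner)
    also have "\<dots> \<le> \<beta> * norm (T u) powr (\<nu> / 2) * norm u powr (1 - \<nu> / 2)" by (rule \<beta>(2))
    also have "\<dots> \<le> \<beta> * (\<alpha> * r) powr (\<nu> / 2) * r powr (1 - \<nu> / 2)"
      using \<beta>(1) \<nu> 1 2 by (intro mult_mono powr_mono2) auto
    also have "\<dots> = \<beta> * \<alpha> powr (\<nu> / 2) * r"
      using \<alpha> r by (simp add: powr_mult powr_add[symmetric])
    finally have "r * (2 * r) \<le> r * (\<beta> * \<alpha> powr (\<nu> / 2))" by (simp add: power2_eq_square mult_ac)
    then have "r \<le> (\<beta> / 2) * \<alpha> powr (\<nu> / 2)" using r by simp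
    also have "\<dots> \<le> (\<beta> / 2 + 1) * \<alpha> powr (\<nu> / 2)" by (intro mult_right_mono) auto
    finally show ?thesis by (simp add: r_def)
  qed
  then show ?thesis unfolding resolvent_rate_def using \<beta>(1) by (intro exI[of _ "\<beta> / 2 + 1"]) auto
qed

lemma inner_split:
  assumes \<alpha>: "0 < \<alpha>"
  shows "x \<bullet> u = R \<alpha> x \<bullet> u + J \<alpha> x \<bullet> T u"
proof -
  have "x \<bullet> u = (T (J \<alpha> x) + R \<alpha> x) \<bullet> u" by (simp add: T_J[OF \<alpha>])
  then show ?thesis by (simp add: inner_add_left T_sym)
qed

lemma symmetrized_vi_if_resolvent_rate:
  assumes "resolvent_rate x (\<nu> / 2)" and \<nu>: "0 < \<nu>" "\<nu> < 2"
  shows "symmetrized_vi L x \<nu>"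
proof -
  obtain C where C: "0 < C" "\<And>\<alpha>. 0 < \<alpha> \<Longrightarrow> norm (R \<alpha> x) \<le> C * \<alpha> powr (\<nu> / 2)"
    using assms(1) unfolding resolvent_rate_def by blast
  have split: "x \<bullet> u \<le> C * \<alpha> powr (\<nu> / 2) * (norm u + norm (T u) / \<alpha>)" if \<alpha>: "0 < \<alpha>" for \<alpha> u
  proof -
    have "x \<bullet> u = R \<alpha> x \<bullet> u + (R \<alpha> x \<bullet> T u) / \<alpha>"
      using \<alpha> inner_split[OF \<alpha>, of x u] by (simp add: R_def)
    also have "\<dots> \<le> norm (R \<alpha> x) * norm u + (norm (R \<alpha> x) * norm (T u)) / \<alpha>"
      using \<alpha> by (intro add_mono divide_right_mono norm_cauchy_schwarz) auto
    also have "\<dots> = norm (R \<alpha> x) * (norm u + norm (T u) / \<alpha>)" by (simp add: distrib_left)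
    also have "\<dots> \<le> C * \<alpha> powr (\<nu> / 2) * (norm u + norm (T u) / \<alpha>)"
      using \<alpha> by (intro mult_right_mono C) auto
    finally show ?thesis .
  qed
  have "2 * (x \<bullet> u) \<le> (4 * C) * norm (T u) powr (\<nu> / 2) * norm u powr (1 - \<nu> / 2)" for u
  proof (cases "T u = 0")
    case True
    have "x \<bullet> u \<le> (C * norm u) * \<alpha> powr (\<nu> / 2)" if "0 < \<alpha>" for \<alpha>
      using split[OF that, of u] True by (simp add: mult_ac)
    then have "x \<bullet> u \<le> 0" by (rule nonpos_if_le_powr) (use \<nu> C in auto)
    with True show ?thesis by simp
  next
    case False
    define a where "a = norm (T u)"
    define b where "b = norm u"
    have ab: "0 < a" "0 < b" using False by (auto simp: a_def b_def T.zero)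
    have "x \<bullet> u \<le> C * (a / b) powr (\<nu> / 2) * (b + a / (a / b))"
      using split[of "a / b" u] ab by (simp add: a_def b_def)
    also have "\<dots> = 2 * C * (a powr (\<nu> / 2) * (b / b powr (\<nu> / 2)))"
      using ab by (simp add: powr_divide)
    also have "b / b powr (\<nu> / 2) = b powr (1 - \<nu> / 2)" using ab by (simp add: powr_diff)
    finally show ?thesis by (simp add: a_def b_def mult_ac)
  qed
  then show ?thesis unfolding symmetrized_vi_def T_apply using C(1) by (intro exI[of _ "4 * C"]) auto
qed

lemma homogeneous_vi_if_resolvent_rate:
  assumes "resolvent_rate x (\<nu> / 2)" and \<nu>: "0 < \<nu>" "\<nu> < 1"
  shows "homogeneous_vi L x \<nu>"
proof -
  obtain C where C: "0 < C" "\<And>\<alpha>. 0 < \<alpha> \<Longrightarrow> norm (R \<alpha> x) \<le> C * \<alpha> powr (\<nu> / 2)"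
    using assms(1) unfolding resolvent_rate_def by blast
  define p where "p = (\<nu> - 1) / 2"
  have p2: "2 * p = \<nu> - 1" by (simp add: p_def)
  define C1 where "C1 = C * 2 powr (\<nu> / 2)"
  define D where "D = C1 / (1 - 1 * 2 powr p)"
  \<comment> \<open>The resolvent identity J_a - J_2a = a J_a J_2a, in which a J_2a is half of R_2a;
    applying L costs the factor 1 / sqrt \<alpha>.\<close>
  have rec: "norm (L (J \<alpha> x)) \<le> 1 * norm (L (J (2 * \<alpha>) x)) + C1 * \<alpha> powr p" if \<alpha>: "0 < \<alpha>" for \<alpha>
  proof -
    have 2: "0 < 2 * \<alpha>" using \<alpha> by simp
    have "J \<alpha> x - J (2 * \<alpha>) x = (1/2) *\<^sub>R J \<alpha> (R (2 * \<alpha>) x)"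
    proof -
      define w where "w = J (2 * \<alpha>) x"
      have x: "x = (T w + \<alpha> *\<^sub>R w) + \<alpha> *\<^sub>R w"
        using J_eq[OF 2, of x] by (simp add: w_def add.assoc scaleR_add_left[symmetric])
      have "J \<alpha> x = J \<alpha> (T w + \<alpha> *\<^sub>R w) + J \<alpha> (\<alpha> *\<^sub>R w)"
        by (subst x) (rule J_linear(1)[OF \<alpha>])
      also have "J \<alpha> (T w + \<alpha> *\<^sub>R w) = w" by (rule J_unique[OF \<alpha> refl])
      finally have "J \<alpha> x - w = J \<alpha> (\<alpha> *\<^sub>R w)" by simp
      then show ?thesis by (simp add: w_def R_def J_linear[OF \<alpha>])
    qed
    then have "norm (L (J \<alpha> x)) = norm (L (J (2 * \<alpha>) x) + (1/2) *\<^sub>R L (J \<alpha> (R (2 * \<alpha>) x)))"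
      by (metis L.add L.scaleR add.commute diff_add_cancel)
    also have "\<dots> \<le> norm (L (J (2 * \<alpha>) x)) + norm ((1/2) *\<^sub>R L (J \<alpha> (R (2 * \<alpha>) x)))"
      by (rule norm_triangle_ineq)
    also have "norm ((1/2) *\<^sub>R L (J \<alpha> (R (2 * \<alpha>) x))) \<le> norm (L (J \<alpha> (R (2 * \<alpha>) x)))" by simp
    also have "\<dots> \<le> norm (R (2 * \<alpha>) x) / sqrt \<alpha>"
      using J_norm(2)[OF \<alpha>, of "R (2 * \<alpha>) x"] \<alpha> by (simp add: pos_le_divide_eq mult.commute)
    also have "\<dots> \<le> C * (2 * \<alpha>) powr (\<nu> / 2) / sqrt \<alpha>"
      using \<alpha> by (intro divide_right_mono C) auto
    also have "\<dots> = C1 * (\<alpha> powr (\<nu> / 2) / \<alpha> powr (1 / 2))"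
      using \<alpha> by (simp add: C1_def powr_mult powr_half_sqrt)
    also have "\<alpha> powr (\<nu> / 2) / \<alpha> powr (1 / 2) = \<alpha> powr p"
      by (simp add: p_def powr_diff[symmetric] diff_divide_distrib)
    finally show ?thesis by simp
  qed
  \<comment> \<open>Here \<nu> < 1 enters: the exponent \<open>p\<close> is negative, so the series
    converges with coefficient 1.\<close>
  have q: "1 * 2 powr p < (1::real)" using \<nu> by (simp add: p_def powr_less_one)
  have LJ: "norm (L (J \<alpha> x)) \<le> D * \<alpha> powr p" if \<alpha>: "0 < \<alpha>" for \<alpha>
    unfolding D_def
  proof (rule doubling_recursion[OF rec])
    fix \<alpha> :: real assume \<alpha>: "0 < \<alpha>"
    have "(\<lambda>n. (1 / sqrt 2) ^ n * (norm x / sqrt \<alpha>)) \<longlonglongrightarrow> 0"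
      by (intro tendsto_mult_left_zero LIMSEQ_power_zero) simp
    then show "(\<lambda>n. 1 ^ n * norm (L (J (2 ^ n * \<alpha>) x))) \<longlonglongrightarrow> 0"
    proof (rule Lim_null_comparison[rotated], intro always_eventually allI)
      fix n :: nat
      have "0 < 2 ^ n * \<alpha>" using \<alpha> by simp
      from J_norm(2)[OF this, of x]
      show "norm (1 ^ n * norm (L (J (2 ^ n * \<alpha>) x))) \<le> (1 / sqrt 2) ^ n * (norm x / sqrt \<alpha>)"
        using \<alpha> by (simp add: real_sqrt_mult real_sqrt_power field_simps)
    qed
  qed (use q C(1) \<alpha> in \<open>auto simp: C1_def\<close>)
  have D: "0 \<le> D" using q C(1) by (simp add: D_def C1_def)
  have split: "x \<bullet> u \<le> C * \<alpha> powr (\<nu> / 2) * norm u + D * \<alpha> powr p * norm (L u)" if \<alpha>: "0 < \<alpha>" for \<alpha> u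
  proof -
    have "x \<bullet> u = R \<alpha> x \<bullet> u + L (J \<alpha> x) \<bullet> L u"
      using inner_split[OF \<alpha>, of x u] by (simp add: T_sym[symmetric] T_inner)
    also have "\<dots> \<le> norm (R \<alpha> x) * norm u + norm (L (J \<alpha> x)) * norm (L u)"
      by (intro add_mono norm_cauchy_schwarz)
    also have "\<dots> \<le> C * \<alpha> powr (\<nu> / 2) * norm u + D * \<alpha> powr p * norm (L u)"
      by (intro add_mono mult_right_mono C LJ \<alpha>) auto
    finally show ?thesis .
  qed
  have "2 * (x \<bullet> u) \<le> (2 * (C + D)) * norm (L u) powr \<nu> * norm u powr (1 - \<nu>)" for u
  proof (cases "L u = 0")
    case True
    have "x \<bullet> u \<le> (C * norm u) * \<alpha> powr (\<nu> / 2)" if "0 < \<alpha>" for \<alpha>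
      using split[OF that, of u] True by (simp add: mult_ac)
    then have "x \<bullet> u \<le> 0" by (rule nonpos_if_le_powr) (use \<nu> C in auto)
    with True show ?thesis by simp
  next
    case False
    define a where "a = norm (L u)"
    define b where "b = norm u"
    have ab: "0 < a" "0 < b" using False by (auto simp: a_def b_def L.zero)
    have e: "((a / b)\<^sup>2) powr s = a powr (2 * s) / b powr (2 * s)" for s
      using ab by (simp add: power2_powr powr_divide)
    \<comment> \<open>The parameter \<alpha> = (a / b)^2 turns both terms into multiples of
      \<open>a powr \<nu> * b powr (1 - \<nu>)\<close>.\<close>
    have "x \<bullet> u \<le> C * (((a / b)\<^sup>2) powr (\<nu> / 2) * b) + D * (((a / b)\<^sup>2) powr p * a)"
      using split[of "(a / b)\<^sup>2" u] ab unfolding a_def b_def mult.assoc by simp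
    also have "((a / b)\<^sup>2) powr (\<nu> / 2) * b = a powr \<nu> * b powr (1 - \<nu>)"
      using ab by (simp add: e powr_diff)
    also have "((a / b)\<^sup>2) powr p * a = a powr \<nu> * b powr (1 - \<nu>)"
      using ab by (simp add: e p2 powr_diff)
    finally show ?thesis by (simp add: a_def b_def algebra_simps)
  qed
  then show ?thesis unfolding homogeneous_vi_def using C(1) D by (intro exI[of _ "2 * (C + D)"]) auto
qed

text \<open>The interpolation inequality bounding the squared norm of \<open>L u\<close> by
  \<open>norm (T u) * norm u\<close>, raised to the power \<nu> / 2, trades \<open>L\<close> for
  \<open>T\<close>.\<close>

lemma symmetrized_vi_if_homogeneous_vi:
  assumes "homogeneous_vi L x \<nu>" and \<nu>: "0 < \<nu>" "\<nu> < 1"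
  shows "symmetrized_vi L x \<nu>"
proof -
  obtain \<beta> where \<beta>: "0 \<le> \<beta>" "\<And>u. 2 * (x \<bullet> u) \<le> \<beta> * norm (L u) powr \<nu> * norm u powr (1 - \<nu>)"
    using assms(1) unfolding homogeneous_vi_def by blast
  have "2 * (x \<bullet> u) \<le> \<beta> * norm (T u) powr (\<nu> / 2) * norm u powr (1 - \<nu> / 2)" for u
  proof (cases "u = 0")
    case False
    have "(norm (L u))\<^sup>2 = T u \<bullet> u" by (simp add: T_inner power2_norm_eq_inner)
    also have "\<dots> \<le> norm (T u) * norm u" by (rule norm_cauchy_schwarz)
    finally have "norm (L u) powr \<nu> \<le> (norm (T u) * norm u) powr (\<nu> / 2)"
      using powr_mono2[of "\<nu> / 2" "(norm (L u))\<^sup>2" "norm (T u) * norm u"] \<nu>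
      by (cases "L u = 0") (simp_all add: power2_powr)
    then have "\<beta> * norm (L u) powr \<nu> * norm u powr (1 - \<nu>)
        \<le> \<beta> * (norm (T u) * norm u) powr (\<nu> / 2) * norm u powr (1 - \<nu>)"
      using \<beta>(1) by (intro mult_right_mono mult_left_mono) auto
    also have "\<dots> = \<beta> * norm (T u) powr (\<nu> / 2) * norm u powr (1 - \<nu> / 2)"
      using False by (simp add: powr_mult powr_add[symmetric])
    finally show ?thesis using \<beta>(2)[of u] by linarith
  qed simp
  then show ?thesis unfolding symmetrized_vi_def T_apply using \<beta>(1) by blast
qed

lemma inhomogeneous_vi_if_homogeneous_vi:
  assumes "homogeneous_vi L x \<nu>" and \<nu>: "0 < \<nu>" "\<nu> < 1"
  shows "inhomogeneous_vi L x (2 * \<nu> / (1 + \<nu>))"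
proof -
  obtain \<beta> where \<beta>: "0 \<le> \<beta>" "\<And>u. 2 * (x \<bullet> u) \<le> \<beta> * norm (L u) powr \<nu> * norm u powr (1 - \<nu>)"
    using assms(1) unfolding homogeneous_vi_def by blast
  \<comment> \<open>The Young weight for which the second factor becomes a power of
    \<open>(norm u)\<^sup>2\<close> with exponent 1 - \<theta> and the first one becomes
    \<open>a powr \<theta>\<close>; then \<gamma> = 1 - \<theta> < 1.\<close>
  define \<theta> where "\<theta> = (1 + \<nu>) / 2"
  have \<theta>: "0 < \<theta>" "\<theta> < 1" using \<nu> by (auto simp: \<theta>_def)
  define \<mu> where "\<mu> = 2 * \<nu> / (1 + \<nu>)"
  have \<theta>2: "2 * (1 - \<theta>) = 1 - \<nu>" by (simp add: \<theta>_def field_simps)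
  have \<mu>\<theta>: "\<mu> * \<theta> = \<nu>" using \<nu> by (simp add: \<mu>_def \<theta>_def)
  define B where "B = \<theta> * \<beta> powr (1 / \<theta>)"
  have "2 * (x \<bullet> u) \<le> B * norm (L u) powr \<mu> + (1 - \<theta>) * (norm u)\<^sup>2" for u
  proof -
    have "\<beta> * norm (L u) powr \<nu> * norm u powr (1 - \<nu>) \<le> B * norm (L u) powr \<mu> + (1 - \<theta>) * (norm u)\<^sup>2"
    proof (cases "\<beta> = 0 \<or> L u = 0")
      case True
      then have "\<beta> * norm (L u) powr \<nu> * norm u powr (1 - \<nu>) = 0" by auto
      moreover have "0 \<le> B * norm (L u) powr \<mu> + (1 - \<theta>) * (norm u)\<^sup>2" using \<theta> by (simp add: B_def)
      ultimately show ?thesis by linarith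
    next
      case False
      define a where "a = \<beta> powr (1 / \<theta>) * norm (L u) powr \<mu>"
      have pos: "0 < \<beta>" "0 < norm (L u)" "0 < norm u" using False \<beta>(1) by (auto simp: L.zero)
      have "\<beta> * norm (L u) powr \<nu> = a powr \<theta>"
        using pos \<theta> by (simp add: a_def powr_mult powr_powr \<mu>\<theta>)
      moreover have "norm u powr (1 - \<nu>) = ((norm u)\<^sup>2) powr (1 - \<theta>)"
        by (simp only: power2_powr[OF pos(3)] \<theta>2)
      ultimately have "\<beta> * norm (L u) powr \<nu> * norm u powr (1 - \<nu>) = a powr \<theta> * ((norm u)\<^sup>2) powr (1 - \<theta>)"
        by simp
      also have "\<dots> \<le> \<theta> * a + (1 - \<theta>) * (norm u)\<^sup>2"
        using \<theta> pos by (intro Youngs_inequality_0) (auto simp: a_def)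
      finally show ?thesis by (simp add: a_def B_def mult.assoc)
    qed
    then show ?thesis using \<beta>(2)[of u] by linarith
  qed
  then show ?thesis
    unfolding inhomogeneous_vi_def \<mu>_def[symmetric] using \<theta>
    by (intro exI[of _ B] conjI bexI[of _ "1 - \<theta>"]) (auto simp: B_def)
qed

text \<open>Testing with \<open>s *\<^sub>R u\<close> and optimizing over the scaling \<open>s\<close> balances the two terms.\<close>

lemma homogeneous_vi_if_inhomogeneous_vi:
  assumes "inhomogeneous_vi L x (2 * \<nu> / (1 + \<nu>))" and \<nu>: "0 < \<nu>" "\<nu> < 1"
  shows "homogeneous_vi L x \<nu>"
proof -
  define \<mu> where "\<mu> = 2 * \<nu> / (1 + \<nu>)"
  have "\<mu> * (1 + \<nu>) = 2 * \<nu>" using \<nu> by (simp add: \<mu>_def)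
  then have \<mu>: "\<nu> * \<mu> + \<mu> = 2 * \<nu>" by (simp add: distrib_left mult.commute)
  obtain \<beta> \<gamma> where \<beta>: "0 \<le> \<beta>" "0 \<le> \<gamma>" "\<And>u. 2 * (x \<bullet> u) \<le> \<beta> * norm (L u) powr \<mu> + \<gamma> * (norm u)\<^sup>2"
    using assms(1) unfolding inhomogeneous_vi_def \<mu>_def[symmetric] by auto
  have scaled: "2 * s * (x \<bullet> u) \<le> \<beta> * s powr \<mu> * norm (L u) powr \<mu> + \<gamma> * s\<^sup>2 * (norm u)\<^sup>2" if "0 < s" for s u
    using \<beta>(3)[of "s *\<^sub>R u"] that by (simp add: L.scaleR powr_mult power_mult_distrib mult_ac)
  have "2 * (x \<bullet> u) \<le> (\<beta> + \<gamma>) * norm (L u) powr \<nu> * norm u powr (1 - \<nu>)" for u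
  proof (cases "L u = 0")
    case True
    have "2 * (x \<bullet> u) \<le> (\<gamma> * (norm u)\<^sup>2) * s powr 1" if s: "0 < s" for s
    proof -
      have "s * (2 * (x \<bullet> u)) \<le> s * ((\<gamma> * (norm u)\<^sup>2) * s)"
        using scaled[OF s, of u] True by (simp add: power2_eq_square mult_ac)
      then show ?thesis using s by simp
    qed
    then have "2 * (x \<bullet> u) \<le> 0" by (rule nonpos_if_le_powr) (use \<beta> in auto)
    with True show ?thesis by simp
  next
    case False
    define a where "a = norm (L u)"
    define b where "b = norm u"
    have ab: "0 < a" "0 < b" using False by (auto simp: a_def b_def L.zero)
    \<comment> \<open>The scaling at which \<open>s\<^sup>2 * b\<^sup>2\<close> and
      \<open>s powr \<mu> * a powr \<mu>\<close> coincide; both equal s times the desired right-hand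
      side.\<close>
    define s where "s = a powr \<nu> * b powr (- 1 - \<nu>)"
    have s: "0 < s" using ab by (simp add: s_def)
    have 1: "s * (a powr \<nu> * b powr (1 - \<nu>)) = s powr \<mu> * a powr \<mu>"
    proof -
      have "s * (a powr \<nu> * b powr (1 - \<nu>)) = a powr (\<nu> * \<mu> + \<mu>) * b powr (- 2 * \<nu>)"
        using ab \<mu> by (simp add: s_def powr_add[symmetric] mult_ac)
      also have "- 2 * \<nu> = (- 1 - \<nu>) * \<mu>" using \<mu> by (simp add: algebra_simps)
      also have "a powr (\<nu> * \<mu> + \<mu>) * b powr ((- 1 - \<nu>) * \<mu>) = s powr \<mu> * a powr \<mu>"
        using ab by (simp add: s_def powr_mult powr_powr powr_add)
      finally show ?thesis .
    qed
    have 2: "s * (a powr \<nu> * b powr (1 - \<nu>)) = s\<^sup>2 * b\<^sup>2"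
    proof -
      have "a powr \<nu> * b powr (1 - \<nu>) = s * b\<^sup>2"
      proof -
        have "b powr (1 - \<nu>) = b powr (- 1 - \<nu>) * b powr 2"
          by (simp only: powr_add[symmetric]) simp
        then show ?thesis using ab by (simp add: s_def)
      qed
      then show ?thesis by (simp add: power2_eq_square mult_ac)
    qed
    have "s * (2 * (x \<bullet> u)) \<le> \<beta> * (s powr \<mu> * a powr \<mu>) + \<gamma> * (s\<^sup>2 * b\<^sup>2)"
      using scaled[OF s, of u] by (simp add: a_def b_def mult_ac)
    also have "\<dots> = s * ((\<beta> + \<gamma>) * (a powr \<nu> * b powr (1 - \<nu>)))"
      unfolding 1[symmetric] 2[symmetric] by (simp add: algebra_simps)
    finally have "2 * (x \<bullet> u) \<le> (\<beta> + \<gamma>) * (a powr \<nu> * b powr (1 - \<nu>))" using s by simp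
    then show ?thesis by (simp add: a_def b_def mult.assoc)
  qed
  then show ?thesis unfolding homogeneous_vi_def using \<beta>(1,2) by (intro exI[of _ "\<beta> + \<gamma>"]) auto
qed

section \<open>The spectral tail and the resolvent rate\<close>

definition E :: "real set \<Rightarrow> 'u \<Rightarrow> 'u" where
  "E = spectral_measure T"

sublocale spec: operator_with_spectral_measure T E
proof
  show "is_spectral_measure T E"
    unfolding E_def spectral_measure_def by (rule someI_ex[OF spectral_measure_exists[OF T_selfadjoint]])
qed (rule T_selfadjoint)

lemma E_orthogonal_projection: "orthogonal_projection (E {0..t})"
  by (rule spec.E_proj) simp

lemmas E_simps = orthogonal_projection_simps[OF E_orthogonal_projection]

lemma spectral_tail_iff:
  "spectral_tail L x \<nu> \<longleftrightarrow> (\<exists>C>0. \<forall>t\<ge>0. (norm (E {0..t} x))\<^sup>2 \<le> C\<^sup>2 * t powr \<nu>)"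
  by (simp add: spectral_tail_def E_def T_def)

lemma L_norm_E:
  assumes t: "0 \<le> t"
  shows "norm (L (E {0..t} u)) \<le> sqrt t * norm (E {0..t} u)"
proof (rule power2_le_imp_le)
  have "(norm (L (E {0..t} u)))\<^sup>2 = T (E {0..t} u) \<bullet> E {0..t} u"
    by (simp add: T_inner power2_norm_eq_inner)
  also have "\<dots> \<le> t * (norm (E {0..t} u))\<^sup>2" by (rule spec.form_E_le) auto
  finally show "(norm (L (E {0..t} u)))\<^sup>2 \<le> (sqrt t * norm (E {0..t} u))\<^sup>2"
    using t by (simp add: power_mult_distrib)
qed (use t in simp)

lemma E_form_above:
  assumes "0 \<le> t" "E {0..t} v = 0"
  shows "t * (norm v)\<^sup>2 \<le> (norm (L v))\<^sup>2"
  using spec.form_above[OF _ assms] by (simp add: T_inner power2_norm_eq_inner)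

lemma J_E:
  assumes \<alpha>: "0 < \<alpha>"
  shows "J \<alpha> (E {0..t} u) = E {0..t} (J \<alpha> u)"
proof (rule J_unique[OF \<alpha>])
  have "T (E {0..t} (J \<alpha> u)) + \<alpha> *\<^sub>R E {0..t} (J \<alpha> u) = E {0..t} (T (J \<alpha> u) + \<alpha> *\<^sub>R J \<alpha> u)"
    by (simp add: E_simps(1,5) spec.T_E_commute)
  then show "T (E {0..t} (J \<alpha> u)) + \<alpha> *\<^sub>R E {0..t} (J \<alpha> u) = E {0..t} u"
    by (simp only: J_eq[OF \<alpha>])
qed

lemma norm_E_mono: "s \<le> t \<Longrightarrow> norm (E {0..s} u) \<le> norm (E {0..t} u)"
proof -
  assume "s \<le> t"
  then have I: "{0..s} \<inter> {0..t} = {0..s}" by auto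
  have "E ({0..s} \<inter> {0..t}) u = E {0..s} (E {0..t} u)" by (rule spec.E_Int) auto
  then have "E {0..s} (E {0..t} u) = E {0..s} u" unfolding I ..
  then show ?thesis using orthogonal_projection_norm(3)[OF E_orthogonal_projection, of s "E {0..t} u"] by simp
qed

text \<open>On the range of \<open>E {0..\<alpha>}\<close> the operator T + \<alpha> has norm at
  most 2 \<alpha>, and it maps the projection of \<open>J \<alpha> x\<close> to that of
  \<open>x\<close>.\<close>

lemma norm_E_le_R:
  assumes \<alpha>: "0 < \<alpha>"
  shows "norm (E {0..\<alpha>} x) \<le> 2 * norm (R \<alpha> x)"
proof -
  define v where "v = E {0..\<alpha>} (J \<alpha> x)"
  have Lv: "norm (L v) \<le> sqrt \<alpha> * norm v"
    unfolding v_def using \<alpha> by (intro L_norm_E) simp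
  have "T v = E {0..\<alpha>} (T (J \<alpha> x))" by (simp add: v_def spec.T_E_commute)
  then have LTv: "norm (L (T v)) \<le> sqrt \<alpha> * norm (T v)"
    using L_norm_E[of \<alpha> "T (J \<alpha> x)"] \<alpha> by simp
  \<comment> \<open>Cauchy-Schwarz for the form of \<open>T\<close>, applied to \<open>v\<close> and
    \<open>T v\<close>, upgrades the form bound to the norm bound \<alpha>.\<close>
  have "(norm (T v))\<^sup>2 = L v \<bullet> L (T v)" by (simp add: T_inner[symmetric] power2_norm_eq_inner)
  also have "\<dots> \<le> norm (L v) * norm (L (T v))" by (rule norm_cauchy_schwarz)
  also have "\<dots> \<le> (sqrt \<alpha> * norm v) * (sqrt \<alpha> * norm (T v))"
    using \<alpha> by (intro mult_mono Lv LTv) auto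
  also have "\<dots> = (\<alpha> * norm v) * norm (T v)" using \<alpha> by simp
  finally have "norm (T v) * norm (T v) \<le> (\<alpha> * norm v) * norm (T v)" by (simp add: power2_eq_square)
  then have Tv: "norm (T v) \<le> \<alpha> * norm v"
    using \<alpha> by (cases "T v = 0") (auto simp: mult_le_cancel_right)
  have "E {0..\<alpha>} x = T v + \<alpha> *\<^sub>R v"
    using J_eq[OF \<alpha>, of "E {0..\<alpha>} x"] by (simp add: v_def J_E[OF \<alpha>])
  then have "norm (E {0..\<alpha>} x) \<le> norm (T v) + \<alpha> * norm v"
    using norm_triangle_ineq[of "T v" "\<alpha> *\<^sub>R v"] \<alpha> by simp
  also have "\<dots> \<le> 2 * (\<alpha> * norm v)" using Tv by simp
  also have "\<dots> \<le> 2 * (\<alpha> * norm (J \<alpha> x))"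
    unfolding v_def using \<alpha> orthogonal_projection_norm(3)[OF E_orthogonal_projection] by simp
  finally show ?thesis using \<alpha> by (simp add: R_def)
qed

text \<open>The spectral tail at t = 0 demands that this component vanish, while the rates speak of
  positive parameters; monotonicity in t and the limit t to 0 bridge the gap.\<close>

lemma norm_E_zero_le:
  assumes le: "\<And>t. 0 < t \<Longrightarrow> norm (E {0..t} x) \<le> C * t powr p" and p: "0 < p" and C: "0 \<le> C"
  shows "E {0..0} x = 0"
proof -
  have "norm (E {0..0} x) \<le> C * t powr p" if "0 < t" for t
    using norm_E_mono[of 0 t x] le[OF that] that by linarith
  then have "norm (E {0..0} x) \<le> 0" by (rule nonpos_if_le_powr[OF _ p C])
  then show ?thesis by simp
qed

lemma spectral_tailI:
  assumes le: "\<And>t. 0 < t \<Longrightarrow> norm (E {0..t} x) \<le> C * t powr (\<nu> / 2)" and \<nu>: "0 < \<nu>" and C: "0 < C"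
  shows "spectral_tail L x \<nu>"
  unfolding spectral_tail_iff
proof (intro exI[of _ C] conjI C allI impI)
  fix t :: real assume t: "0 \<le> t"
  show "(norm (E {0..t} x))\<^sup>2 \<le> C\<^sup>2 * t powr \<nu>"
  proof (cases "t = 0")
    case True
    have "0 < \<nu> / 2" using \<nu> by simp
    from norm_E_zero_le[OF le this] True C show ?thesis by simp
  next
    case False
    then have t: "0 < t" using t by simp
    have "(norm (E {0..t} x))\<^sup>2 \<le> (C * t powr (\<nu> / 2))\<^sup>2" by (intro power_mono le t) simp
    also have "\<dots> = C\<^sup>2 * t powr \<nu>"
      by (simp add: power_mult_distrib power2_eq_square powr_add[symmetric])
    finally show ?thesis .
  qed
qed

lemma spectral_tail_if_resolvent_rate:
  assumes "resolvent_rate x (\<nu> / 2)" and \<nu>: "0 < \<nu>"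
  shows "spectral_tail L x \<nu>"
proof -
  obtain C where C: "0 < C" "\<And>\<alpha>. 0 < \<alpha> \<Longrightarrow> norm (R \<alpha> x) \<le> C * \<alpha> powr (\<nu> / 2)"
    using assms(1) unfolding resolvent_rate_def by blast
  show ?thesis
  proof (rule spectral_tailI[where C = "2 * C"])
    fix t :: real assume t: "0 < t"
    show "norm (E {0..t} x) \<le> 2 * C * t powr (\<nu> / 2)"
      using norm_E_le_R[OF t, of x] C(2)[OF t] by linarith
  qed (use \<nu> C in auto)
qed

text \<open>The operator form of \<alpha> / (t + \<alpha>) \<le> 1 / (K + 1) for t \<ge> K \<alpha>,
  obtained by inserting the lower bound of the form into \<open>J_form\<close>.\<close>

lemma norm_R_above:
  assumes \<alpha>: "0 < \<alpha>" and K: "0 \<le> K" and v: "E {0..K * \<alpha>} v = 0"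
  shows "norm (R \<alpha> v) \<le> norm v / (K + 1)"
proof -
  define s where "s = J \<alpha> v"
  have "E {0..K * \<alpha>} s = 0"
    using J_E[OF \<alpha>, of "K * \<alpha>" v] J_linear(3)[OF \<alpha>, of 0 0] by (simp add: s_def v)
  then have "K * \<alpha> * (norm s)\<^sup>2 \<le> (norm (L s))\<^sup>2" using \<alpha> K by (intro E_form_above) auto
  then have "(K + 1) * \<alpha> * (norm s)\<^sup>2 \<le> v \<bullet> s"
    unfolding s_def J_form[OF \<alpha>] by (simp add: algebra_simps)
  also have "\<dots> \<le> norm v * norm s" by (rule norm_cauchy_schwarz)
  finally have "((K + 1) * \<alpha> * norm s) * norm s \<le> norm v * norm s"
    by (simp add: power2_eq_square mult.assoc)
  then have "(K + 1) * \<alpha> * norm s \<le> norm v"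
    by (cases "s = 0") (auto simp: mult_le_cancel_right)
  then have "(K + 1) * norm (R \<alpha> v) \<le> norm v"
    using \<alpha> by (simp add: R_def s_def mult.assoc)
  then show ?thesis using K by (simp add: pos_le_divide_eq mult.commute)
qed

text \<open>On the spectrum it reads \<alpha> / (t + \<alpha>) = (1/2) (1 + \<alpha> / (t +
  \<alpha>)) 2\<alpha> / (t + 2\<alpha>), which exhibits the contraction factor when the inner
  fraction is small.\<close>

lemma R_doubling:
  assumes \<alpha>: "0 < \<alpha>"
  shows "R \<alpha> w = (1/2) *\<^sub>R (R (2 * \<alpha>) w + R \<alpha> (R (2 * \<alpha>) w))"
proof -
  have 2: "0 < 2 * \<alpha>" using \<alpha> by simp
  define z where "z = J (2 * \<alpha>) w"
  have w: "w = (T z + \<alpha> *\<^sub>R z) + \<alpha> *\<^sub>R z"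
    using J_eq[OF 2, of w] by (simp add: z_def add.assoc scaleR_add_left[symmetric])
  have "J \<alpha> w = J \<alpha> (T z + \<alpha> *\<^sub>R z) + J \<alpha> (\<alpha> *\<^sub>R z)"
    by (subst w) (rule J_linear(1)[OF \<alpha>])
  also have "J \<alpha> (T z + \<alpha> *\<^sub>R z) = z" by (rule J_unique[OF \<alpha> refl])
  finally have "J \<alpha> w = z + J \<alpha> (\<alpha> *\<^sub>R z)" .
  then show ?thesis by (simp add: R_def z_def J_linear[OF \<alpha>] scaleR_add_right)
qed

text \<open>Above the spectral value \<open>K * \<alpha>\<close>, doubling the parameter nearly doubles the resolvent
  error; for \<open>\<nu> < 2\<close> this beats the loss \<open>2 powr (\<nu> / 2)\<close> in the rate when \<open>K\<close> is large.\<close>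

lemma resolvent_rate_if_spectral_tail:
  assumes "spectral_tail L x \<nu>" and \<nu>: "0 < \<nu>" "\<nu> < 2"
  shows "resolvent_rate x (\<nu> / 2)"
proof -
  obtain C where C: "0 < C" "\<And>t. 0 \<le> t \<Longrightarrow> (norm (E {0..t} x))\<^sup>2 \<le> C\<^sup>2 * t powr \<nu>"
    using assms(1) unfolding spectral_tail_iff by blast
  have tail: "norm (E {0..t} x) \<le> C * t powr (\<nu> / 2)" if "0 \<le> t" for t
  proof (rule power2_le_imp_le)
    have "(C * t powr (\<nu> / 2))\<^sup>2 = C\<^sup>2 * t powr \<nu>"
      by (simp add: power_mult_distrib power2_eq_square powr_add[symmetric])
    then show "(norm (E {0..t} x))\<^sup>2 \<le> (C * t powr (\<nu> / 2))\<^sup>2" using C(2)[OF that] by simp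
  qed (use C(1) in simp)
  define \<theta> where "\<theta> = 2 powr (\<nu> / 2 - 1)"
  have \<theta>: "0 < \<theta>" "\<theta> < 1" using \<nu> by (auto simp: \<theta>_def powr_less_one)
  \<comment> \<open>Chosen so that 1 / (K + 1) = 1 - \<theta>. The contraction factor is then q = 1
    - \<theta> / 2, and with 2 powr (\<nu> / 2) = 2 \<theta> the ratio is 1 - (1 - \<theta>)^2 <
    1.\<close>
  define K where "K = \<theta> / (1 - \<theta>)"
  have K: "0 \<le> K" using \<theta> by (simp add: K_def)
  have K1: "1 / (K + 1) = 1 - \<theta>" using \<theta> by (simp add: K_def field_simps)
  define q where "q = (1 + (1 - \<theta>)) / 2"
  have q0: "0 \<le> q" "q < 1" using \<theta> by (auto simp: q_def)
  have "2 powr (\<nu> / 2) = \<theta> * 2" by (simp add: \<theta>_def powr_diff)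
  moreover have "q * (\<theta> * 2) = 1 - (1 - \<theta>)\<^sup>2" by (simp add: q_def power2_eq_square field_simps)
  ultimately have "q * 2 powr (\<nu> / 2) = 1 - (1 - \<theta>)\<^sup>2" by simp
  also have "\<dots> < 1" using \<theta> by simp
  finally have q1: "q * 2 powr (\<nu> / 2) < 1" .
  define C1 where "C1 = C * K powr (\<nu> / 2)"
  define D where "D = C1 / (1 - q * 2 powr (\<nu> / 2))"
  have rec: "norm (R \<alpha> x) \<le> q * norm (R (2 * \<alpha>) x) + C1 * \<alpha> powr (\<nu> / 2)" if \<alpha>: "0 < \<alpha>" for \<alpha>
  proof -
    let ?P = "E {0..K * \<alpha>}"
    have 2: "0 < 2 * \<alpha>" using \<alpha> by simp
    define w where "w = x - ?P x"
    define v where "v = R (2 * \<alpha>) w"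
    have "v = R (2 * \<alpha>) x - ?P (R (2 * \<alpha>) x)"
      by (simp add: v_def w_def R_def J_linear[OF 2] J_E[OF 2] E_simps scaleR_diff_right)
    then have v: "?P v = 0" "norm v \<le> norm (R (2 * \<alpha>) x)"
      using orthogonal_projection_norm(2)[OF E_orthogonal_projection, of "R (2 * \<alpha>) x" "K * \<alpha>"]
      by (simp_all add: E_simps) (rule power2_le_imp_le, simp_all)
    have "norm (R \<alpha> w) = (1/2) * norm (v + R \<alpha> v)" by (subst R_doubling[OF \<alpha>]) (simp add: v_def)
    also have "\<dots> \<le> (1/2) * (norm v + norm v / (K + 1))"
      by (intro mult_left_mono norm_triangle_mono order_refl norm_R_above \<alpha> K v) simp
    also have "norm v / (K + 1) = norm v * (1 - \<theta>)"
      using arg_cong[OF K1, of "\<lambda>c. norm v * c"] by simp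
    also have "(1/2) * (norm v + norm v * (1 - \<theta>)) = q * norm v"
      by (simp add: q_def algebra_simps)
    also have "\<dots> \<le> q * norm (R (2 * \<alpha>) x)" by (intro mult_left_mono v q0)
    finally have 1: "norm (R \<alpha> w) \<le> q * norm (R (2 * \<alpha>) x)" .
    \<comment> \<open>Below the cut the tail bound applies directly, since \<open>R \<alpha>\<close>
      is a contraction.\<close>
    have "norm (R \<alpha> (?P x)) \<le> norm (?P x)" by (rule norm_R[OF \<alpha>])
    also have "\<dots> \<le> C * (K * \<alpha>) powr (\<nu> / 2)" using K \<alpha> by (intro tail) simp
    also have "\<dots> = C1 * \<alpha> powr (\<nu> / 2)" using K \<alpha> by (simp add: C1_def powr_mult)
    finally have 2: "norm (R \<alpha> (?P x)) \<le> C1 * \<alpha> powr (\<nu> / 2)" .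
    have eq: "R \<alpha> x = R \<alpha> w + R \<alpha> (?P x)"
      by (simp add: R_def w_def J_linear[OF \<alpha>] scaleR_diff_right)
    have "norm (R \<alpha> x) \<le> norm (R \<alpha> w) + norm (R \<alpha> (?P x))"
      by (subst eq) (rule norm_triangle_ineq)
    with 1 2 show ?thesis by linarith
  qed
  have C1: "0 \<le> C1" using C(1) by (simp add: C1_def)
  have bound: "norm (R \<alpha> x) \<le> D * \<alpha> powr (\<nu> / 2)" if \<alpha>: "0 < \<alpha>" for \<alpha>
    unfolding D_def
  proof (rule doubling_recursion[OF rec q0(1) q1 C1 _ \<alpha>])
    fix \<alpha> :: real assume \<alpha>: "0 < \<alpha>"
    have "(\<lambda>n. q ^ n * norm x) \<longlonglongrightarrow> 0"
      using q0 by (intro tendsto_mult_left_zero LIMSEQ_power_zero) simp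
    then show "(\<lambda>n. q ^ n * norm (R (2 ^ n * \<alpha>) x)) \<longlonglongrightarrow> 0"
    proof (rule Lim_null_comparison[rotated], intro always_eventually allI)
      fix n :: nat
      have "0 < 2 ^ n * \<alpha>" using \<alpha> by simp
      from norm_R[OF this, of x] q0(1)
      show "norm (q ^ n * norm (R (2 ^ n * \<alpha>) x)) \<le> q ^ n * norm x"
        by (simp add: abs_mult mult_left_mono)
    qed
  qed
  have D: "0 \<le> D" using C1 q1 by (simp add: D_def)
  have "norm (R \<alpha> x) \<le> (D + 1) * \<alpha> powr (\<nu> / 2)" if "0 < \<alpha>" for \<alpha>
    by (rule order_trans[OF bound[OF that]]) (intro mult_right_mono, auto)
  then show ?thesis unfolding resolvent_rate_def using D by (intro exI[of _ "D + 1"]) auto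
qed

section \<open>Rates for noisy data\<close>

lemma convergence_rate_if_resolvent_rate:
  assumes "resolvent_rate x (\<nu> / 2)" and \<nu>: "0 < \<nu>"
  shows "convergence_rate L (L x) x (\<nu> / (\<nu> + 1))"
proof -
  obtain C where C: "0 < C" "\<And>\<alpha>. 0 < \<alpha> \<Longrightarrow> norm (R \<alpha> x) \<le> C * \<alpha> powr (\<nu> / 2)"
    using assms(1) unfolding resolvent_rate_def by blast
  have "(SUP y'\<in>{y'. norm (y' - L x) \<le> \<delta>}. INF \<alpha>\<in>{0<..}. norm (regularized_solution L \<alpha> y' - x))
      \<le> (1 + C) * \<delta> powr (\<nu> / (\<nu> + 1))" if \<delta>: "0 < \<delta>" for \<delta>
  proof (rule cSUP_least)
    have "L x \<in> {y'. norm (y' - L x) \<le> \<delta>}" using \<delta> by simp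
    then show "{y'. norm (y' - L x) \<le> \<delta>} \<noteq> {}" by blast
    fix y' assume "y' \<in> {y'. norm (y' - L x) \<le> \<delta>}"
    then have y': "norm (y' - L x) \<le> \<delta>" by simp
    \<comment> \<open>Balances the noise term \<delta> / sqrt \<alpha> against the bias \<alpha>
      powr (\<nu> / 2).\<close>
    define \<alpha> where "\<alpha> = \<delta> powr (2 / (\<nu> + 1))"
    have \<alpha>: "0 < \<alpha>" using \<delta> by (simp add: \<alpha>_def)
    have "norm (regularized_solution L \<alpha> y' - x) \<le> norm (J \<alpha> (adjoint L (y' - L x))) + norm (R \<alpha> x)"
      unfolding regularized_error[OF \<alpha>] by (rule norm_triangle_ineq4)
    also have "\<dots> \<le> \<delta> / sqrt \<alpha> + C * \<alpha> powr (\<nu> / 2)"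
    proof (rule add_mono)
      have "sqrt \<alpha> * norm (J \<alpha> (adjoint L (y' - L x))) \<le> \<delta>"
        using J_adjoint_norm[OF \<alpha>, of "y' - L x"] y' by linarith
      then show "norm (J \<alpha> (adjoint L (y' - L x))) \<le> \<delta> / sqrt \<alpha>"
        using \<alpha> by (simp add: pos_le_divide_eq mult.commute)
    qed (rule C(2)[OF \<alpha>])
    also have "sqrt \<alpha> = \<delta> powr (1 / (\<nu> + 1))"
    proof -
      have "sqrt \<alpha> = \<alpha> powr (1 / 2)" using \<alpha> by (simp add: powr_half_sqrt)
      also have "\<dots> = \<delta> powr (2 / (\<nu> + 1) * (1 / 2))" unfolding \<alpha>_def by (rule powr_powr)
      also have "2 / (\<nu> + 1) * (1 / 2) = 1 / (\<nu> + 1)" using \<nu> by (simp add: field_simps)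
      finally show ?thesis .
    qed
    also have "\<delta> / \<delta> powr (1 / (\<nu> + 1)) = \<delta> powr (1 - 1 / (\<nu> + 1))"
      using \<delta> by (simp add: powr_diff)
    also have "1 - 1 / (\<nu> + 1) = \<nu> / (\<nu> + 1)" using \<nu> by (simp add: field_simps)
    also have "\<alpha> powr (\<nu> / 2) = \<delta> powr (\<nu> / (\<nu> + 1))"
    proof -
      have "\<alpha> powr (\<nu> / 2) = \<delta> powr (2 / (\<nu> + 1) * (\<nu> / 2))" unfolding \<alpha>_def by (rule powr_powr)
      also have "2 / (\<nu> + 1) * (\<nu> / 2) = \<nu> / (\<nu> + 1)" using \<nu> by (simp add: field_simps)
      finally show ?thesis .
    qed
    finally have "norm (regularized_solution L \<alpha> y' - x) \<le> (1 + C) * \<delta> powr (\<nu> / (\<nu> + 1))"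
      by (simp add: distrib_right)
    moreover have "bdd_below ((\<lambda>\<alpha>. norm (regularized_solution L \<alpha> y' - x)) ` {0<..})"
      by (rule bdd_belowI[of _ 0]) auto
    ultimately show "(INF \<alpha>\<in>{0<..}. norm (regularized_solution L \<alpha> y' - x)) \<le> (1 + C) * \<delta> powr (\<nu> / (\<nu> + 1))"
      using \<alpha> by (intro cINF_lower2[of _ _ \<alpha>]) auto
  qed
  then show ?thesis unfolding convergence_rate_def using C(1) by (intro exI[of _ "1 + C"]) auto
qed

text \<open>For the data \<open>L (x - E x)\<close> every regularized solution has vanishing component in the
  range of \<open>E = E {0..t}\<close>, so no choice of \<open>\<alpha>\<close> makes the error smaller than \<open>norm (E x)\<close>.\<close>

lemma spectral_tail_if_convergence_rate:
  assumes "convergence_rate L (L x) x (\<nu> / (\<nu> + 1))" and \<nu>: "0 < \<nu>"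
  shows "spectral_tail L x \<nu>"
proof -
  define f where "f = (\<lambda>y'. INF \<alpha>\<in>{0<..}. norm (regularized_solution L \<alpha> y' - x))"
  obtain C where C: "0 < C"
    "\<And>\<delta>. 0 < \<delta> \<Longrightarrow> (SUP y'\<in>{y'. norm (y' - L x) \<le> \<delta>}. f y') \<le> C * \<delta> powr (\<nu> / (\<nu> + 1))"
    using assms(1) unfolding convergence_rate_def f_def by blast
  \<comment> \<open>The real supremum dominates the individual errors only for a set bounded above;
    \<alpha> = 1 supplies a bound on the infima.\<close>
  have bdd: "bdd_above (f ` {y'. norm (y' - L x) \<le> \<delta>})" for \<delta>
  proof (rule bdd_aboveI2)
    fix y' assume "y' \<in> {y'. norm (y' - L x) \<le> \<delta>}"
    then have y': "norm (y' - L x) \<le> \<delta>" by simp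
    have "bdd_below ((\<lambda>\<alpha>. norm (regularized_solution L \<alpha> y' - x)) ` {0<..})"
      by (rule bdd_belowI[of _ 0]) auto
    then have "f y' \<le> norm (regularized_solution L 1 y' - x)"
      unfolding f_def by (rule cINF_lower) simp
    also have "\<dots> \<le> norm (J 1 (adjoint L (y' - L x))) + norm (R 1 x)"
      unfolding regularized_error[OF zero_less_one] by (rule norm_triangle_ineq4)
    also have "\<dots> \<le> \<delta> + norm x"
      using J_adjoint_norm[of 1 "y' - L x"] norm_R[of 1 x] y' by (intro add_mono) auto
    finally show "f y' \<le> \<delta> + norm x" .
  qed
  have "norm (E {0..t} x) \<le> C powr (\<nu> + 1) * t powr (\<nu> / 2)" if t: "0 < t" for t
  proof (cases "E {0..t} x = 0")
    case False
    let ?P = "E {0..t}"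
    define e where "e = norm (?P x)"
    have e: "0 < e" using False by (simp add: e_def)
    define y' where "y' = L (x - ?P x)"
    \<comment> \<open>The bound of \<open>L_norm_E\<close> for the distance of \<open>y'\<close>
      from \<open>L x\<close>. As it contains \<open>e\<close> itself, the rate is raised to the
      power \<nu> + 1 below and \<open>e powr \<nu>\<close> is cancelled.\<close>
    define \<delta> where "\<delta> = sqrt t * e"
    have \<delta>: "0 < \<delta>" using t e by (simp add: \<delta>_def)
    have y': "norm (y' - L x) \<le> \<delta>"
      using L_norm_E[of t x] t by (simp add: y'_def L.diff \<delta>_def e_def)
    have "e \<le> f y'"
      unfolding f_def
    proof (rule cINF_greatest)
      fix \<alpha> :: real assume "\<alpha> \<in> {0<..}"
      then have \<alpha>: "0 < \<alpha>" by simp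
      have "?P (regularized_solution L \<alpha> y') = J \<alpha> (?P (T (x - ?P x)))"
        by (simp add: regularized_solution_eq[OF \<alpha>] y'_def T_apply[symmetric] J_E[OF \<alpha>])
      also have "?P (T (x - ?P x)) = T (?P (x - ?P x))" by (simp add: spec.T_E_commute)
      also have "?P (x - ?P x) = 0" by (simp add: E_simps)
      also have "J \<alpha> (T 0) = 0" using J_linear(3)[OF \<alpha>, of 0 0] by (simp add: T.zero)
      finally have "?P (regularized_solution L \<alpha> y' - x) = - ?P x" by (simp add: E_simps)
      then show "e \<le> norm (regularized_solution L \<alpha> y' - x)"
        using orthogonal_projection_norm(3)[OF E_orthogonal_projection, of t "regularized_solution L \<alpha> y' - x"]
        by (simp add: e_def)
    qed simp
    also have "\<dots> \<le> (SUP y'\<in>{y'. norm (y' - L x) \<le> \<delta>}. f y')"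
      by (rule cSUP_upper[OF _ bdd]) (use y' in simp)
    also have "\<dots> \<le> C * \<delta> powr (\<nu> / (\<nu> + 1))" by (rule C(2)[OF \<delta>])
    finally have "e powr (\<nu> + 1) \<le> (C * \<delta> powr (\<nu> / (\<nu> + 1))) powr (\<nu> + 1)"
      using e \<nu> by (intro powr_mono2) auto
    also have "\<dots> = C powr (\<nu> + 1) * \<delta> powr \<nu>"
      using C(1) \<nu> by (simp add: powr_mult powr_powr)
    also have "\<delta> powr \<nu> = t powr (\<nu> / 2) * e powr \<nu>"
      using t e by (simp add: \<delta>_def powr_mult powr_half_sqrt[symmetric] powr_powr)
    finally have "e * e powr \<nu> \<le> (C powr (\<nu> + 1) * t powr (\<nu> / 2)) * e powr \<nu>"
      using e by (simp add: powr_add mult_ac)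
    then show ?thesis using e unfolding e_def[symmetric] by (simp add: mult_le_cancel_right)
  qed simp
  then show ?thesis by (rule spectral_tailI) (use C(1) \<nu> in auto)
qed

end

theorem theorem12:
  fixes L :: "'u::{real_inner,complete_space} \<Rightarrow> 'v::{real_inner,complete_space}"
    and y :: 'v and x :: 'u and \<nu> :: real
  assumes "bounded_linear L"
    and "y \<in> range L"
    and "x = min_norm_solution L y"
    and "0 < \<nu>" and "\<nu> < 2"
  shows "(symmetrized_vi L x \<nu> \<longleftrightarrow> noise_free_rate L y x (\<nu> / 2)) \<and>
    (symmetrized_vi L x \<nu> \<longleftrightarrow> convergence_rate L y x (\<nu> / (\<nu> + 1))) \<and>
    (symmetrized_vi L x \<nu> \<longleftrightarrow> spectral_tail L x \<nu>) \<and>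
    (\<nu> < 1 \<longrightarrow>
      (symmetrized_vi L x \<nu> \<longleftrightarrow> homogeneous_vi L x \<nu>) \<and>
      (symmetrized_vi L x \<nu> \<longleftrightarrow> inhomogeneous_vi L x (2 * \<nu> / (1 + \<nu>))))"
proof -
  interpret tikhonov L by (rule tikhonov.intro[OF assms(1)])
  have y: "y = L x" using min_norm_solution_solves[OF assms(1,2)] assms(3) by simp
  note \<nu> = \<open>0 < \<nu>\<close> \<open>\<nu> < 2\<close>
  have symm: "symmetrized_vi L x \<nu> \<longleftrightarrow> resolvent_rate x (\<nu> / 2)"
    using resolvent_rate_if_symmetrized_vi symmetrized_vi_if_resolvent_rate \<nu> by blast
  have tail: "spectral_tail L x \<nu> \<longleftrightarrow> resolvent_rate x (\<nu> / 2)"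
    using resolvent_rate_if_spectral_tail spectral_tail_if_resolvent_rate \<nu> by blast
  \<comment> \<open>Closes the cycle from the resolvent rate through the noisy rate and the spectral
    tail back to the resolvent rate.\<close>
  have conv: "convergence_rate L (L x) x (\<nu> / (\<nu> + 1)) \<longleftrightarrow> resolvent_rate x (\<nu> / 2)"
    using convergence_rate_if_resolvent_rate spectral_tail_if_convergence_rate tail \<nu> by blast
  have hom: "homogeneous_vi L x \<nu> \<longleftrightarrow> resolvent_rate x (\<nu> / 2)" if "\<nu> < 1"
    using homogeneous_vi_if_resolvent_rate symmetrized_vi_if_homogeneous_vi symm \<nu> that by blast
  have inhom: "inhomogeneous_vi L x (2 * \<nu> / (1 + \<nu>)) \<longleftrightarrow> homogeneous_vi L x \<nu>" if "\<nu> < 1"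
    using homogeneous_vi_if_inhomogeneous_vi inhomogeneous_vi_if_homogeneous_vi \<nu> that by blast
  show ?thesis
    unfolding y noise_free_rate_iff using symm tail conv hom inhom by blast
qed

end
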